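(* There is a suitably large absolute constant $C>0$ (the constant appearing in the definition of $m(f)$ below) such that the following holds. For every $n$ and every (total or partial) permutation-invariant function $f:\{0,1\}^n\times\{0,1\}^n\to\{0,1,?\}$, $$m(f)\le \mathrm{IC}(f)\le \mathrm{R}(f)\le \mathrm{poly}(m(f))+O(\log n),$$ i.e. there exist a polynomial $p$ and an absolute constant $K$, both independent of $n$ and $f$, with $\mathrm{R}(f)\le p(m(f))+K\log n$.
   Context: For $\mathbf{x},\mathbf{y}\in\{0,1\}^n$, $|\mathbf{x}|$ is the Hamming weight and $\Delta(\mathbf{x},\mathbf{y})$ the (unnormalized) Hamming distance; $[n]=\{1,\dots,n\}$. A partial function $f:\{0,1\}^n\times\{0,1\}^n\to\{0,1,?\}$ is permutation-invariant if $f(\mathbf{x}^\pi,\mathbf{y}^\pi)=f(\mathbf{x},\mathbf{y})$ for all $\mathbf{x},\mathbf{y}$ and every bijection $\pi:[n]\to[n]$, where $x^\pi_i=x_{\pi(i)}$; the value $?$ means "undefined", and a protocol may output anything on such inputs. $\mathrm{R}(f)$ is the minimum worst-case number of bits exchanged by a two-way protocol with public (shared) randomness that, for every input with $f(\mathbf{x},\mathbf{y})\neq ?$, outputs $f(\mathbf{x},\mathbf{y})$ with probability at least $2/3$. $\mathrm{IC}(f)$ (prior-free interactive information complexity) is $\inf_\Pi\sup_\mu [I(X;\Pi\mid Y)+I(Y;\Pi\mid X)]$, where the infimum is over randomized protocols $\Pi$ with $\Pr[\Pi(\mathbf{x},\mathbf{y})\ne f(\mathbf{x},\mathbf{y})]\le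 1/3$ whenever $f(\mathbf{x},\mathbf{y})\ne ?$, the supremum is over distributions $\mu$ of $(X,Y)$ on $\{0,1\}^n\times\{0,1\}^n$, and $\Pi$ also denotes the transcript. For $0\le a,b\le n$ let $h_{a,b}:\{0,\dots,n\}\to\{0,1,?\}$ be $h_{a,b}(d)=f(\mathbf{x},\mathbf{y})$ if there exist $\mathbf{x},\mathbf{y}$ with $|\mathbf{x}|=a$, $|\mathbf{y}|=b$, $\Delta(\mathbf{x},\mathbf{y})=d$ (well defined by permutation invariance), and $?$ otherwise. The set of jumps is $\mathcal{J}(h_{a,b})=\{(c,g): h_{a,b}(c-g),h_{a,b}(c+g)\in\{0,1\},\ h_{a,b}(c-g)\neq h_{a,b}(c+g),\ h_{a,b}(i)=?\ \text{for all } c-g<i<c+g\}$. Then $$m(f)=\frac1C\max_{a,b\in[n],\ (c,g)\in\mathcal{J}(h_{a,b})}\max\left\{\frac{\min\{a,b,c,n-a,n-b,n-c\}}{g},\ \log\left(\frac{\min\{c,n-c\}}{g}\right)\right\}.$$ *)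

theory Defs
  imports
    "HOL-Probability.Probability"
    "HOL-Probability.Information"
    "HOL-Combinatorics.Permutations"
    "HOL-Computational_Algebra.Polynomial"
begin

section \<open>Partial functions on pairs of bit strings\<close>

text \<open>
  An element of \<open>{0,1}\<^sup>n\<close> is a Boolean list of length \<open>n\<close>; coordinates are indexed by
  \<open>0, ..., n - 1\<close> instead of \<open>1, ..., n\<close>. A partial function has \<open>None\<close> as its value
  \<open>?\<close>; its values on lists of other lengths are irrelevant.
\<close>

type_synonym bitstring = "bool list"

type_synonym partial_fun = "bitstring \<Rightarrow> bitstring \<Rightarrow> bool option"

definition cube :: "nat \<Rightarrow> bitstring set" where
  "cube n = {x. length x = n}"

definition weight :: "bitstring \<Rightarrow> nat" where
  "weight x = card {i. i < length x \<and> x ! i}"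

definition hdist :: "bitstring \<Rightarrow> bitstring \<Rightarrow> nat" where
  "hdist x y = card {i. i < length x \<and> x ! i \<noteq> y ! i}"

definition permutation_invariant :: "nat \<Rightarrow> partial_fun \<Rightarrow> bool" where
  "permutation_invariant n f \<longleftrightarrow>
     (\<forall>x\<in>cube n. \<forall>y\<in>cube n. \<forall>\<pi>. \<pi> permutes {..<n} \<longrightarrow>
        f (permute_list \<pi> x) (permute_list \<pi> y) = f x y)"


section \<open>The measure m\<close>

text \<open>
  The description operator \<open>THE\<close> picks the common value of \<open>f\<close> on all pairs with the given
  weights and distance; it is unique when \<open>f\<close> is permutation-invariant.
\<close>

definition h_fun :: "nat \<Rightarrow> partial_fun \<Rightarrow> nat \<Rightarrow> nat \<Rightarrow> nat \<Rightarrow> bool option" where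
  "h_fun n f a b d =
     (if \<exists>x\<in>cube n. \<exists>y\<in>cube n. weight x = a \<and> weight y = b \<and> hdist x y = d
      then THE v. \<exists>x\<in>cube n. \<exists>y\<in>cube n.
             weight x = a \<and> weight y = b \<and> hdist x y = d \<and> f x y = v
      else None)"

text \<open>
  The end points of a jump are \<open>l = c - g\<close> and \<open>u = c + g\<close>, with \<open>g > 0\<close>. Both are at most
  \<open>n\<close>, because \<open>h_fun n f a b\<close> is \<open>None\<close> beyond \<open>n\<close>.
\<close>

definition jumps :: "(nat \<Rightarrow> bool option) \<Rightarrow> (real \<times> real) set" where
  "jumps k = {(c, g). \<exists>l u :: nat. real l = c - g \<and> real u = c + g \<and> l < u \<and>
                k l \<noteq> None \<and> k u \<noteq> None \<and> k l \<noteq> k u \<and> (\<forall>i. l < i \<and> i < u \<longrightarrow> k i = None)}"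

definition jump_values :: "nat \<Rightarrow> partial_fun \<Rightarrow> real set" where
  "jump_values n f =
     {max (Min {real a, real b, c, real n - real a, real n - real b, real n - c} / g)
          (log 2 (min c (real n - c) / g))
      | a b c g. a \<in> {1..n} \<and> b \<in> {1..n} \<and> (c, g) \<in> jumps (h_fun n f a b)}"

text \<open>
  The maximum over no jumps at all is \<open>0\<close>. No value for \<open>log 0\<close> is involved: a jump satisfies
  \<open>0 < g \<le> min c (n - c)\<close>, so the logarithms are nonnegative.
\<close>

definition m_measure :: "real \<Rightarrow> nat \<Rightarrow> partial_fun \<Rightarrow> real" where
  "m_measure C n f = 1 / C * (if jump_values n f = {} then 0 else Max (jump_values n f))"


section \<open>Two-way protocols\<close>

text \<open>
  A private-coin protocol is a finite binary tree. At each inner node the owner of the node sends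
  one bit, drawn with fresh private coins from a distribution that depends on the owner's own
  input; the other distributions along the path may depend on the earlier bits because they are
  attached to nodes of the tree. Leaves are labelled with the output, which is thus determined by
  the bits exchanged. The subtrees belong to the bits \<open>False\<close> and \<open>True\<close>, in this order.
\<close>

datatype protocol =
    Leaf bool
  | Alice "bitstring \<Rightarrow> bool pmf" protocol protocol
  | Bob "bitstring \<Rightarrow> bool pmf" protocol protocol

primrec messages :: "protocol \<Rightarrow> bitstring \<Rightarrow> bitstring \<Rightarrow> bitstring pmf" where
  "messages (Leaf v) x y = return_pmf []"
| "messages (Alice q p0 p1) x y =
     bind_pmf (q x) (\<lambda>b. map_pmf ((#) b) (if b then messages p1 x y else messages p0 x y))"
| "messages (Bob q p0 p1) x y =
     bind_pmf (q y) (\<lambda>b. map_pmf ((#) b) (if b then messages p1 x y else messages p0 x y))"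

primrec leaf_output :: "protocol \<Rightarrow> bitstring \<Rightarrow> bool" where
  "leaf_output (Leaf v) t = v"
| "leaf_output (Alice q p0 p1) t = (if hd t then leaf_output p1 (tl t) else leaf_output p0 (tl t))"
| "leaf_output (Bob q p0 p1) t = (if hd t then leaf_output p1 (tl t) else leaf_output p0 (tl t))"

primrec deterministic :: "protocol \<Rightarrow> bool" where
  "deterministic (Leaf v) \<longleftrightarrow> True"
| "deterministic (Alice q p0 p1) \<longleftrightarrow>
     (\<forall>x. \<exists>b. q x = return_pmf b) \<and> deterministic p0 \<and> deterministic p1"
| "deterministic (Bob q p0 p1) \<longleftrightarrow>
     (\<forall>y. \<exists>b. q y = return_pmf b) \<and> deterministic p0 \<and> deterministic p1"

text \<open>
  A randomized protocol: a public random string (encoded as a natural number) is drawn, and the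
  parties then run the private-coin protocol it selects. Its transcript consists of the public
  random string and the bits exchanged.
\<close>

type_synonym randomized_protocol = "nat pmf \<times> (nat \<Rightarrow> protocol)"

definition transcript ::
    "randomized_protocol \<Rightarrow> bitstring \<Rightarrow> bitstring \<Rightarrow> (nat \<times> bitstring) pmf" where
  "transcript P x y = bind_pmf (fst P) (\<lambda>r. map_pmf (Pair r) (messages (snd P r) x y))"

definition result :: "randomized_protocol \<Rightarrow> bitstring \<Rightarrow> bitstring \<Rightarrow> bool pmf" where
  "result P x y = map_pmf (\<lambda>(r, t). leaf_output (snd P r) t) (transcript P x y)"

definition computes :: "nat \<Rightarrow> partial_fun \<Rightarrow> randomized_protocol \<Rightarrow> bool" where
  "computes n f P \<longleftrightarrow>
     (\<forall>x\<in>cube n. \<forall>y\<in>cube n. \<forall>v. f x y = Some v \<longrightarrow> pmf (result P x y) v \<ge> 2 / 3)"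


section \<open>Randomized communication complexity\<close>

definition public_coin :: "randomized_protocol \<Rightarrow> bool" where
  "public_coin P \<longleftrightarrow> (\<forall>r\<in>set_pmf (fst P). deterministic (snd P r))"

definition communication_at_most :: "nat \<Rightarrow> randomized_protocol \<Rightarrow> nat \<Rightarrow> bool" where
  "communication_at_most n P k \<longleftrightarrow>
     (\<forall>x\<in>cube n. \<forall>y\<in>cube n. \<forall>(r, t)\<in>set_pmf (transcript P x y). length t \<le> k)"

definition R_public :: "nat \<Rightarrow> partial_fun \<Rightarrow> nat" where
  "R_public n f = (LEAST k. \<exists>P. public_coin P \<and> computes n f P \<and> communication_at_most n P k)"


section \<open>Interactive information complexity\<close>

definition input_distributions :: "nat \<Rightarrow> (bitstring \<times> bitstring) pmf set" where
  "input_distributions n = {\<mu>. set_pmf \<mu> \<subseteq> cube n \<times> cube n}"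

text \<open>The joint distribution of \<open>X\<close>, \<open>Y\<close> and the transcript.\<close>

definition joint ::
    "randomized_protocol \<Rightarrow> (bitstring \<times> bitstring) pmf
      \<Rightarrow> (bitstring \<times> bitstring \<times> (nat \<times> bitstring)) pmf" where
  "joint P \<mu> = bind_pmf \<mu> (\<lambda>(x, y). map_pmf (\<lambda>t. (x, y, t)) (transcript P x y))"

text \<open>
  \<open>I(U; V | W)\<close> in bits, for discrete random variables. Countability of the value types ensures
  that the product sigma-algebras formed by the library definition are again discrete.
\<close>

definition cond_mutual_info ::
    "'a pmf \<Rightarrow> ('a \<Rightarrow> 'u::countable) \<Rightarrow> ('a \<Rightarrow> 'v::countable) \<Rightarrow> ('a \<Rightarrow> 'w::countable)
      \<Rightarrow> real" where
  "cond_mutual_info D U V W =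
     prob_space.conditional_mutual_information (measure_pmf D) 2
       (count_space UNIV) (count_space UNIV) (count_space UNIV) U V W"

definition information_cost ::
    "randomized_protocol \<Rightarrow> (bitstring \<times> bitstring) pmf \<Rightarrow> real" where
  "information_cost P \<mu> =
     (let X = (\<lambda>(x, y, t). x); Y = (\<lambda>(x, y, t). y); T = (\<lambda>(x, y, t). t) in
      cond_mutual_info (joint P \<mu>) X T Y + cond_mutual_info (joint P \<mu>) Y T X)"

definition IC :: "nat \<Rightarrow> partial_fun \<Rightarrow> ereal" where
  "IC n f = (INF P\<in>{P. computes n f P}. SUP \<mu>\<in>input_distributions n.
               ereal (information_cost P \<mu>))"

end

(*
  Lower bound. By the Donsker--Varadhan inequality, the information cost under a uniform product
  distribution is bounded below with explicit test functions. A jump (c, g) lets one embed, with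
  blocks of g equal positions and constant padding, an indexing problem of length about
  min(c, n - c) / g and a unique disjointness problem of length about
  min(a, b, c, n - a, n - b, n - c) / g. Indexing on N positions costs log N, because Bob can only
  reveal few positions and Alice then has to reveal where hers lies. Disjointness costs a constant per
  coordinate, by the Hellinger cut-and-paste argument. Because the cost is a supremum over input
  distributions, the average over product distributions suffices and no conditioning variable is
  needed.

  Upper bound. After exchanging the weights, the parties locate the distance among the jumps by binary
  search. By the logarithmic part of m the jumps grow geometrically, so there are at most
  2^O(m) log n of them and O(m + log log n) rounds; by the linear part each test succeeds with
  advantage 1 / O(m) using O(m) bits, by a parity sketch if c or n - c is small compared with g and
  by sampling a single one of the sparser string otherwise.
*)
theory Submission
  imports Defs
begin

section \<open>Information theory of transcripts, and IC at most R\<close>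

section \<open>Conditional mutual information of discrete variables\<close>

text \<open>The lower bound rests on one property of protocols, \<open>rectangular\<close>: the
  probability of a transcript factors into a term in x and a term in y. For a fixed transcript the
  claim is then an inequality between finite sums, which is integrated over transcripts afterwards.
  The constant 4000 comes from the linear part of m: a ratio q \<ge> 5 yields disjointness on k
  \<ge> 1 coordinates with q \<le> 2 * k + 5 \<le> 7 * k at cost k / 560, and 7 * 560 = 3920.

  In the upper bound the union bound over fewer than 2 ^ e jumps costs a factor of order e in
  repetitions. This comes on top of the e rounds, the O(M^2) repetitions that advantage 1 / O(M)
  requires, and the O(M) bits of a test, so the total is of the order of the fifth power of M + log
  log n. As (log log n)^5 is O(log n), it splits into a sum of a polynomial in m and O(log n)
  instead of a product of the two.\<close>

lemma abs_mult_log_ratio_le: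
  fixes p q K :: real
  assumes "0 \<le> p" "0 \<le> q" "p \<le> K * q" "K \<ge> 1"
  shows "\<bar>p * log 2 (p / q)\<bar> \<le> p * log 2 K + q / ln 2"
proof (cases "p = 0")
  case True
  then show ?thesis using assms by simp
next
  case False
  with assms have p: "p > 0" and q: "q > 0"
    by (auto simp: order_less_le)
  have "p / q \<le> K" using assms q by (simp add: field_simps)
  then have up: "log 2 (p / q) \<le> log 2 K" using p q by (intro log_mono) auto
  \<comment> \<open>The negative part of the logarithm needs no lower bound on p / q, because p * ln
    (q / p) is at most q.\<close>
  have "ln (q / p) \<le> q / p - 1" using p q by (intro ln_le_minus_one) simp
  then have "- ln (p / q) \<le> q / p" using p q by (simp add: ln_div)
  then have "p * (- ln (p / q)) \<le> p * (q / p)" using p by (intro mult_left_mono) auto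
  then have "- (p * log 2 (p / q)) \<le> q / ln 2"
    using p by (simp add: log_def divide_simps)
  moreover have "p * log 2 (p / q) \<le> p * log 2 K" using up p by simp
  moreover have "0 \<le> p * log 2 K" "0 \<le> q / ln 2" using p q assms by auto
  ultimately show ?thesis by linarith
qed

lemma integrable_measure_pmf_iff:
  fixes f :: "'a \<Rightarrow> real"
  shows "integrable (measure_pmf p) f \<longleftrightarrow> integrable (count_space UNIV) (\<lambda>x. pmf p x * f x)"
  by (subst measure_pmf_eq_density, subst integrable_density) auto

lemma expectation_eq_count_space:
  fixes f :: "'a \<Rightarrow> real"
  shows "measure_pmf.expectation p f = (\<integral>x. pmf p x * f x \<partial>count_space UNIV)"
  by (subst measure_pmf_eq_density, subst integral_density) auto

lemma pmf_le_pmf_map: "pmf p x \<le> pmf (map_pmf f p) (f x)"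
  unfolding pmf_map by (subst measure_pmf_single[symmetric], intro measure_pmf.finite_measure_mono) auto

text \<open>The density of p against the product of its marginals is at most 1 / \<delta>, where
  \<delta> is the least mass of an atom of the first marginal: \<open>pmf p z\<close> never exceeds
  the mass of the second component of z. So finiteness of one side is enough, and the other may
  range over all transcripts.\<close>

lemma integrable_log_density_ratio:
  fixes p :: "('u \<times> 'w) pmf"
  assumes fin: "finite (fst ` set_pmf p)"
  shows "integrable (measure_pmf p)
     (\<lambda>z. log 2 (pmf p z / (pmf (map_pmf fst p) (fst z) * pmf (map_pmf snd p) (snd z))))"
proof -
  define pu where "pu = map_pmf fst p"
  define pw where "pw = map_pmf snd p"
  define \<delta> where "\<delta> = Min (pmf pu ` (fst ` set_pmf p))"
  have \<delta>mem: "\<delta> \<in> pmf pu ` (fst ` set_pmf p)"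
    unfolding \<delta>_def using fin by (intro Min_in) (auto simp: set_pmf_not_empty)
  then have \<delta>: "\<delta> > 0"
    by (force simp: pu_def intro!: pmf_positive)
  have \<delta>1: "\<delta> \<le> 1" using \<delta>mem by (auto simp: pmf_le_1)
  have dom: "pmf p z \<le> (1/\<delta>) * (pmf pu (fst z) * pmf pw (snd z))" for z
  proof (cases "z \<in> set_pmf p")
    case True
    then have "\<delta> \<le> pmf pu (fst z)" unfolding \<delta>_def using fin by (intro Min_le) auto
    then have "pmf pw (snd z) * \<delta> \<le> pmf pw (snd z) * pmf pu (fst z)"
      by (intro mult_left_mono) auto
    moreover have "pmf p z \<le> pmf pw (snd z)" unfolding pw_def by (rule pmf_le_pmf_map)
    ultimately have "pmf p z * \<delta> \<le> pmf pw (snd z) * pmf pu (fst z)"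
      using \<delta> by (meson mult_right_mono order_trans less_imp_le)
    then show ?thesis using \<delta> by (simp add: field_simps)
  next
    case False
    then show ?thesis using \<delta> by (simp add: set_pmf_iff)
  qed
  have "integrable (count_space UNIV) (\<lambda>z. pmf p z * log 2 (pmf p z / (pmf pu (fst z) * pmf pw (snd z))))"
  proof (rule Bochner_Integration.integrable_bound)
    show "integrable (count_space UNIV)
      (\<lambda>z. pmf p z * log 2 (1/\<delta>) + (pmf (pair_pmf pu pw) z) / ln 2)"
      by (intro Bochner_Integration.integrable_add integrable_mult_left integrable_divide integrable_pmf)
    show "AE z in count_space UNIV. norm (pmf p z * log 2 (pmf p z / (pmf pu (fst z) * pmf pw (snd z))))
        \<le> norm (pmf p z * log 2 (1/\<delta>) + pmf (pair_pmf pu pw) z / ln 2)"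
    proof (rule AE_I2)
      fix z :: "'u \<times> 'w"
      have "\<bar>pmf p z * log 2 (pmf p z / (pmf pu (fst z) * pmf pw (snd z)))\<bar>
         \<le> pmf p z * log 2 (1/\<delta>) + (pmf pu (fst z) * pmf pw (snd z)) / ln 2"
        using dom \<delta> \<delta>1 by (intro abs_mult_log_ratio_le) auto
      moreover have "pmf pu (fst z) * pmf pw (snd z) = pmf (pair_pmf pu pw) z"
        by (cases z) (simp add: pmf_pair)
      ultimately show "norm (pmf p z * log 2 (pmf p z / (pmf pu (fst z) * pmf pw (snd z))))
        \<le> norm (pmf p z * log 2 (1/\<delta>) + pmf (pair_pmf pu pw) z / ln 2)" by simp
    qed
  qed auto
  then show ?thesis unfolding integrable_measure_pmf_iff pu_def pw_def .
qed

lemma distributed_measure_pmf: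
  fixes X :: "'a \<Rightarrow> 'b::countable"
  shows "distributed (measure_pmf D) (count_space UNIV) X (\<lambda>x. ennreal (pmf (map_pmf X D) x))"
  unfolding distributed_def
  by (auto simp: map_pmf_rep_eq[symmetric] measure_pmf_eq_density[symmetric])

lemma count_space_pair_UNIV:
  "count_space (UNIV :: 'a::countable set) \<Otimes>\<^sub>M count_space (UNIV :: 'b::countable set) = count_space UNIV"
  by (subst pair_measure_countable) (auto)

text \<open>The conditional information density p(u,v | w) / (p(u | w) p(v | w)), with the divisions
  by p(w) cleared.\<close>

definition info_ratio where
  "info_ratio D U V W \<omega> =
     pmf (map_pmf (\<lambda>\<omega>. (U \<omega>, V \<omega>, W \<omega>)) D) (U \<omega>, V \<omega>, W \<omega>) * pmf (map_pmf W D) (W \<omega>) /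
     (pmf (map_pmf (\<lambda>\<omega>. (U \<omega>, W \<omega>)) D) (U \<omega>, W \<omega>) * pmf (map_pmf (\<lambda>\<omega>. (V \<omega>, W \<omega>)) D) (V \<omega>, W \<omega>))"

text \<open>The library formula asks for integrability of the densities of I(U; V, W) and I(U; W).
  Both have U, with its finitely many values, on one side, and by the chain rule the conditional
  density is their difference.\<close>

lemma cond_mutual_info_eq:
  fixes U :: "'a \<Rightarrow> 'u::countable" and V :: "'a \<Rightarrow> 'v::countable" and W :: "'a \<Rightarrow> 'w::countable"
  assumes fin: "finite (U ` set_pmf D)"
  shows "cond_mutual_info D U V W = measure_pmf.expectation D (\<lambda>\<omega>. log 2 (info_ratio D U V W \<omega>))"
    and "integrable (measure_pmf D) (\<lambda>\<omega>. log 2 (info_ratio D U V W \<omega>))"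
proof -
  interpret information_space "measure_pmf D" 2
    by unfold_locales auto
  define Pu where "Pu = map_pmf U D"
  define Pw where "Pw = map_pmf W D"
  define Puw where "Puw = map_pmf (\<lambda>\<omega>. (U \<omega>, W \<omega>)) D"
  define Pvw where "Pvw = map_pmf (\<lambda>\<omega>. (V \<omega>, W \<omega>)) D"
  define Puvw where "Puvw = map_pmf (\<lambda>\<omega>. (U \<omega>, V \<omega>, W \<omega>)) D"
  have m1: "Pu = map_pmf fst Puvw" "Pvw = map_pmf snd Puvw" "Pu = map_pmf fst Puw" "Pw = map_pmf snd Puw"
       "Puw = map_pmf (\<lambda>(u,v,w). (u,w)) Puvw" "Pw = map_pmf (\<lambda>(u,v,w). w) Puvw"
    unfolding Pu_def Pvw_def Puvw_def Puw_def Pw_def by (simp_all add: pmf.map_comp o_def)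
  have I1: "integrable (measure_pmf Puvw) (\<lambda>z. log 2 (pmf Puvw z / (pmf Pu (fst z) * pmf Pvw (snd z))))"
    unfolding m1(1,2) using fin
    by (intro integrable_log_density_ratio) (auto simp: Puvw_def image_image)
  have "integrable (measure_pmf Puw) (\<lambda>z. log 2 (pmf Puw z / (pmf Pu (fst z) * pmf Pw (snd z))))"
    unfolding m1(3,4) using fin
    by (intro integrable_log_density_ratio) (auto simp: Puw_def image_image)
  then have I2: "integrable (measure_pmf Puvw) (\<lambda>(u,v,w). log 2 (pmf Puw (u,w) / (pmf Pu u * pmf Pw w)))"
    unfolding m1(5) by (subst (asm) integrable_map_pmf_eq) (simp add: case_prod_unfold)
  have cmi: "cond_mutual_info D U V W = (\<integral>(x, y, z). pmf Puvw (x, y, z) * log 2 (pmf Puvw (x, y, z) / (pmf Puw (x, z) *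
     (pmf Pvw (y,z) / pmf Pw z))) \<partial>(count_space UNIV \<Otimes>\<^sub>M count_space UNIV \<Otimes>\<^sub>M count_space UNIV))"
    unfolding cond_mutual_info_def
    apply (rule conditional_mutual_information_generic_eq[where Px = "pmf Pu"])
    using I1 I2
    by (auto simp: sigma_finite_measure_count_space_countable count_space_pair_UNIV Pu_def Pw_def Puw_def Pvw_def Puvw_def
        distributed_measure_pmf integrable_measure_pmf_iff case_prod_unfold)
  also have "\<dots> = measure_pmf.expectation Puvw (\<lambda>(x,y,z). log 2 (pmf Puvw (x, y, z) / (pmf Puw (x, z) *
     (pmf Pvw (y,z) / pmf Pw z))))"
    by (simp add: count_space_pair_UNIV expectation_eq_count_space case_prod_unfold)
  also have "\<dots> = measure_pmf.expectation D (\<lambda>\<omega>. log 2 (info_ratio D U V W \<omega>))"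
    unfolding info_ratio_def
    by (simp add: Puvw_def Puw_def Pvw_def Pw_def)
  finally show "cond_mutual_info D U V W = measure_pmf.expectation D (\<lambda>\<omega>. log 2 (info_ratio D U V W \<omega>))" .
  have "integrable (measure_pmf Puvw) (\<lambda>(u,v,w). log 2 (pmf Puvw (u,v,w) / (pmf Pu u * pmf Pvw (v,w)))
       - log 2 (pmf Puw (u,w) / (pmf Pu u * pmf Pw w)))"
    using Bochner_Integration.integrable_diff[OF I1 I2] by (simp add: case_prod_unfold)
  then have int: "integrable (measure_pmf D) (\<lambda>\<omega>. log 2 (pmf Puvw (U \<omega>,V \<omega>,W \<omega>) / (pmf Pu (U \<omega>) * pmf Pvw (V \<omega>,W \<omega>)))
       - log 2 (pmf Puw (U \<omega>,W \<omega>) / (pmf Pu (U \<omega>) * pmf Pw (W \<omega>))))"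
    unfolding Puvw_def[of] by (subst (asm) integrable_map_pmf_eq) (simp add: case_prod_unfold)
  show "integrable (measure_pmf D) (\<lambda>\<omega>. log 2 (info_ratio D U V W \<omega>))"
  proof (rule integrable_cong_AE_imp[OF int])
    show "AE \<omega> in measure_pmf D. log 2 (pmf Puvw (U \<omega>,V \<omega>,W \<omega>) / (pmf Pu (U \<omega>) * pmf Pvw (V \<omega>,W \<omega>)))
       - log 2 (pmf Puw (U \<omega>,W \<omega>) / (pmf Pu (U \<omega>) * pmf Pw (W \<omega>))) = log 2 (info_ratio D U V W \<omega>)"
    proof (rule AE_pmfI)
      fix \<omega> assume w: "\<omega> \<in> set_pmf D"
      have "pmf Puvw (U \<omega>,V \<omega>,W \<omega>) > 0" "pmf Pu (U \<omega>) > 0" "pmf Pvw (V \<omega>, W \<omega>) > 0"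
         "pmf Puw (U \<omega>,W \<omega>) > 0" "pmf Pw (W \<omega>) > 0"
        unfolding Pu_def Pvw_def Puvw_def Puw_def Pw_def
        using w by (auto intro!: pmf_positive)
      then show "log 2 (pmf Puvw (U \<omega>,V \<omega>,W \<omega>) / (pmf Pu (U \<omega>) * pmf Pvw (V \<omega>,W \<omega>)))
       - log 2 (pmf Puw (U \<omega>,W \<omega>) / (pmf Pu (U \<omega>) * pmf Pw (W \<omega>))) = log 2 (info_ratio D U V W \<omega>)"
        unfolding info_ratio_def
        by (simp add: Pu_def[symmetric] Pvw_def[symmetric] Puvw_def[symmetric] Puw_def[symmetric] Pw_def[symmetric]
           log_mult log_divide)
    qed
  qed auto
qed

text \<open>The expectation runs over the support of p, so mass of q elsewhere is lost and only an
  inequality results. Together with ln z \<le> z - 1 it takes the place of Jensen's inequality in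
  the two divergence bounds.\<close>

lemma expectation_pmf_ratio_le:
  fixes p :: "'a pmf" and q :: "'a \<Rightarrow> real"
  assumes nn: "\<And>x. 0 \<le> q x" and le: "(\<integral>\<^sup>+x. ennreal (q x) \<partial>count_space UNIV) \<le> 1"
  shows "integrable (measure_pmf p) (\<lambda>x. q x / pmf p x)"
    and "measure_pmf.expectation p (\<lambda>x. q x / pmf p x) \<le> 1"
proof -
  have "(\<integral>\<^sup>+x. ennreal (q x / pmf p x) \<partial>measure_pmf p) = (\<integral>\<^sup>+x. ennreal (pmf p x) * ennreal (q x / pmf p x) \<partial>count_space UNIV)"
    by (rule nn_integral_measure_pmf)
  also have "\<dots> \<le> (\<integral>\<^sup>+x. ennreal (q x) \<partial>count_space UNIV)"
    using nn by (intro nn_integral_mono) (auto simp: ennreal_mult[symmetric] intro!: ennreal_leI)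
  also note le
  finally have le1: "(\<integral>\<^sup>+x. ennreal (q x / pmf p x) \<partial>measure_pmf p) \<le> 1" .
  show int: "integrable (measure_pmf p) (\<lambda>x. q x / pmf p x)"
    using le1 nn by (intro integrableI_nonneg) (auto simp: less_top[symmetric] top_unique)
  have "ennreal (measure_pmf.expectation p (\<lambda>x. q x / pmf p x)) \<le> 1"
    using le1 nn by (subst nn_integral_eq_integral[symmetric, OF int]) auto
  then show "measure_pmf.expectation p (\<lambda>x. q x / pmf p x) \<le> 1"
    by simp
qed

text \<open>
  The Donsker--Varadhan lower bound. Independence of \<open>U\<close> and \<open>W\<close> turns the conditional
  information into the divergence of the law of \<open>(U, V, W)\<close> from a product law.
\<close>

lemma cond_mutual_info_ge:
  fixes U :: "'a \<Rightarrow> 'u::countable" and V :: "'a \<Rightarrow> 'v::countable" and W :: "'a \<Rightarrow> 'w::countable"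
    and \<phi> :: "'u \<Rightarrow> 'v \<Rightarrow> real"
  assumes fin: "finite (U ` set_pmf D)"
    and indep: "map_pmf (\<lambda>\<omega>. (U \<omega>, W \<omega>)) D = pair_pmf (map_pmf U D) (map_pmf W D)"
    and bound: "\<And>u v. \<bar>\<phi> u v\<bar> \<le> B"
    and le: "\<And>v. measure_pmf.expectation (map_pmf U D) (\<lambda>u. exp (\<phi> u v)) \<le> 1"
  shows "measure_pmf.expectation D (\<lambda>\<omega>. \<phi> (U \<omega>) (V \<omega>)) \<le> ln 2 * cond_mutual_info D U V W"
proof -
  define Pu where "Pu = map_pmf U D"
  define Pw where "Pw = map_pmf W D"
  define Pvw where "Pvw = map_pmf (\<lambda>\<omega>. (V \<omega>, W \<omega>)) D"
  define Puvw where "Puvw = map_pmf (\<lambda>\<omega>. (U \<omega>, V \<omega>, W \<omega>)) D"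
  \<comment> \<open>The product law of U and (V, W), tilted by \<open>exp (\<phi> u v)\<close>. For
    fixed v the tilt averages to at most 1 over U, so q has total mass at most 1.\<close>
  define q where "q = (\<lambda>(u,v,w). pmf Pu u * pmf Pvw (v,w) * exp (\<phi> u v))"
  have q_nn: "0 \<le> q z" for z by (auto simp: q_def split: prod.splits)
  have "(\<integral>\<^sup>+z. ennreal (q z) \<partial>count_space UNIV) =
     (\<integral>\<^sup>+z. ennreal (pmf (pair_pmf Pu Pvw) z) * (case z of (u,v,w) \<Rightarrow> ennreal (exp (\<phi> u v))) \<partial>count_space UNIV)"
    by (intro nn_integral_cong) (auto simp: q_def pmf_pair ennreal_mult)
  also have "\<dots> = (\<integral>\<^sup>+z. (case z of (u,v,w) \<Rightarrow> ennreal (exp (\<phi> u v))) \<partial>measure_pmf (pair_pmf Pu Pvw))"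
    by (rule nn_integral_measure_pmf[symmetric])
  also have "\<dots> = (\<integral>\<^sup>+vw. \<integral>\<^sup>+u. ennreal (exp (\<phi> u (fst vw))) \<partial>measure_pmf Pu \<partial>measure_pmf Pvw)"
    by (subst pair_commute_pmf) (simp add: nn_integral_pair_pmf' case_prod_unfold)
  also have "\<dots> \<le> (\<integral>\<^sup>+vw. 1 \<partial>measure_pmf Pvw)"
  proof (rule nn_integral_mono)
    fix vw :: "'v \<times> 'w"
    have "integrable (measure_pmf Pu) (\<lambda>u. exp (\<phi> u (fst vw)))"
      using bound by (intro measure_pmf.integrable_const_bound[where B="exp B"])
        (auto simp: abs_le_iff)
    then have "(\<integral>\<^sup>+u. ennreal (exp (\<phi> u (fst vw))) \<partial>measure_pmf Pu)
       = ennreal (measure_pmf.expectation Pu (\<lambda>u. exp (\<phi> u (fst vw))))"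
      by (intro nn_integral_eq_integral) auto
    also have "\<dots> \<le> ennreal 1"
      using le unfolding Pu_def[symmetric] by (intro ennreal_leI) auto
    finally show "(\<integral>\<^sup>+u. ennreal (exp (\<phi> u (fst vw))) \<partial>measure_pmf Pu) \<le> 1" by simp
  qed
  also have "\<dots> = 1" by simp
  finally have q_le: "(\<integral>\<^sup>+z. ennreal (q z) \<partial>count_space UNIV) \<le> 1" .
  have int1: "integrable (measure_pmf D) (\<lambda>\<omega>. q (U \<omega>, V \<omega>, W \<omega>) / pmf Puvw (U \<omega>, V \<omega>, W \<omega>))"
    using expectation_pmf_ratio_le(1)[OF q_nn q_le, of Puvw]
    unfolding Puvw_def by (subst (asm) integrable_map_pmf_eq)
  have E1: "measure_pmf.expectation D (\<lambda>\<omega>. q (U \<omega>, V \<omega>, W \<omega>) / pmf Puvw (U \<omega>, V \<omega>, W \<omega>)) \<le> 1"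
    using expectation_pmf_ratio_le(2)[OF q_nn q_le, of Puvw]
    unfolding Puvw_def by (subst (asm) integral_map_pmf)
  have int\<phi>: "integrable (measure_pmf D) (\<lambda>\<omega>. \<phi> (U \<omega>) (V \<omega>))"
    using bound by (intro measure_pmf.integrable_const_bound[where B=B]) auto
  note int2 = cond_mutual_info_eq(2)[OF fin, of V W]
  \<comment> \<open>This is ln z \<le> z - 1, where z compares the tilted product law with the true
    law. Independence cancels the mass of W in \<open>info_ratio\<close>.\<close>
  have pw: "\<phi> (U \<omega>) (V \<omega>) + 1 - q (U \<omega>, V \<omega>, W \<omega>) / pmf Puvw (U \<omega>, V \<omega>, W \<omega>) \<le> ln 2 * log 2 (info_ratio D U V W \<omega>)"
    if w: "\<omega> \<in> set_pmf D" for \<omega>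
  proof -
    have pos: "pmf Puvw (U \<omega>,V \<omega>,W \<omega>) > 0" "pmf Pu (U \<omega>) > 0" "pmf Pvw (V \<omega>, W \<omega>) > 0" "pmf Pw (W \<omega>) > 0"
      unfolding Pu_def Pvw_def Puvw_def Pw_def
      using w by (auto intro!: pmf_positive)
    have "info_ratio D U V W \<omega> = pmf Puvw (U \<omega>,V \<omega>,W \<omega>) * pmf Pw (W \<omega>) / (pmf Pu (U \<omega>) * pmf Pw (W \<omega>) * pmf Pvw (V \<omega>, W \<omega>))"
      unfolding info_ratio_def indep by (simp add: pmf_pair Pu_def Pvw_def Puvw_def Pw_def)
    also have "\<dots> = pmf Puvw (U \<omega>,V \<omega>,W \<omega>) / (pmf Pu (U \<omega>) * pmf Pvw (V \<omega>, W \<omega>))"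
      using pos by (simp add: field_simps)
    finally have r: "info_ratio D U V W \<omega> = pmf Puvw (U \<omega>,V \<omega>,W \<omega>) / (pmf Pu (U \<omega>) * pmf Pvw (V \<omega>, W \<omega>))" .
    define z where "z = q (U \<omega>, V \<omega>, W \<omega>) / pmf Puvw (U \<omega>, V \<omega>, W \<omega>)"
    have z: "z = exp (\<phi> (U \<omega>) (V \<omega>)) / info_ratio D U V W \<omega>"
      unfolding z_def r q_def using pos by (simp add: field_simps)
    have rp: "info_ratio D U V W \<omega> > 0" unfolding r using pos by simp
    have "ln z \<le> z - 1" using z rp by (intro ln_le_minus_one) auto
    then have "\<phi> (U \<omega>) (V \<omega>) - ln (info_ratio D U V W \<omega>) \<le> z - 1"
      using rp by (simp add: z ln_div)
    then show ?thesis unfolding z_def[symmetric] by (simp add: log_def)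
  qed
  have "measure_pmf.expectation D (\<lambda>\<omega>. \<phi> (U \<omega>) (V \<omega>)) \<le>
     measure_pmf.expectation D (\<lambda>\<omega>. \<phi> (U \<omega>) (V \<omega>)) + 1 -
     measure_pmf.expectation D (\<lambda>\<omega>. q (U \<omega>, V \<omega>, W \<omega>) / pmf Puvw (U \<omega>, V \<omega>, W \<omega>))"
    using E1 by simp
  also have "\<dots> = measure_pmf.expectation D (\<lambda>\<omega>. \<phi> (U \<omega>) (V \<omega>) + 1 - q (U \<omega>, V \<omega>, W \<omega>) / pmf Puvw (U \<omega>, V \<omega>, W \<omega>))"
    using int1 int\<phi> by simp
  also have "\<dots> \<le> measure_pmf.expectation D (\<lambda>\<omega>. ln 2 * log 2 (info_ratio D U V W \<omega>))"
    using int1 int2 int\<phi> pw by (intro integral_mono_AE) (auto intro!: AE_pmfI)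
  finally show ?thesis
    by (simp add: cond_mutual_info_eq(1)[OF fin])
qed

text \<open>
  Gibbs' inequality: replacing the conditional law of \<open>V\<close> given \<open>W\<close> by any other kernel \<open>Q\<close>
  can only increase the divergence.
\<close>

lemma cond_mutual_info_le:
  fixes U :: "'a \<Rightarrow> 'u::countable" and V :: "'a \<Rightarrow> 'v::countable" and W :: "'a \<Rightarrow> 'w::countable"
    and c :: "'a \<Rightarrow> real" and Q :: "'w \<Rightarrow> 'v pmf"
  assumes fin: "finite (U ` set_pmf D)"
    and int_c: "integrable (measure_pmf D) c"
    and le: "\<And>\<omega>. \<omega> \<in> set_pmf D \<Longrightarrow>
        pmf (map_pmf (\<lambda>\<omega>. (U \<omega>, V \<omega>, W \<omega>)) D) (U \<omega>, V \<omega>, W \<omega>)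
        \<le> 2 powr c \<omega> * pmf (Q (W \<omega>)) (V \<omega>) * pmf (map_pmf (\<lambda>\<omega>. (U \<omega>, W \<omega>)) D) (U \<omega>, W \<omega>)"
  shows "cond_mutual_info D U V W \<le> measure_pmf.expectation D c"
proof -
  define Puw where "Puw = map_pmf (\<lambda>\<omega>. (U \<omega>, W \<omega>)) D"
  define Pw where "Pw = map_pmf W D"
  define Pvw where "Pvw = map_pmf (\<lambda>\<omega>. (V \<omega>, W \<omega>)) D"
  define Puvw where "Puvw = map_pmf (\<lambda>\<omega>. (U \<omega>, V \<omega>, W \<omega>)) D"
  define q where "q = (\<lambda>(v,w). pmf (Q w) v * pmf Pw w)"
  have q_nn: "0 \<le> q z" for z by (auto simp: q_def split: prod.splits)
  \<comment> \<open>Recognising q as the law of a pair, with V redrawn from \<open>Q W\<close>,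
    gives its total mass 1.\<close>
  define QQ where "QQ = bind_pmf Pw (\<lambda>w. map_pmf (\<lambda>v. (v, w)) (Q w))"
  have "q z = pmf QQ z" for z
  proof (cases z)
    case (Pair v w)
    have "pmf QQ z = measure_pmf.expectation Pw (\<lambda>w'. pmf (map_pmf (\<lambda>v. (v, w')) (Q w')) z)"
      unfolding QQ_def pmf_bind ..
    also have "(\<lambda>w'. pmf (map_pmf (\<lambda>v. (v, w')) (Q w')) z) = (\<lambda>w'. pmf (Q w) v * indicator {w} w')"
    proof
      fix w'
      show "pmf (map_pmf (\<lambda>v. (v, w')) (Q w')) z = pmf (Q w) v * indicator {w} w'"
      proof (cases "w' = w")
        case True
        have "pmf (map_pmf (\<lambda>v. (v, w)) (Q w)) (v, w) = pmf (Q w) v"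
          by (rule pmf_map_inj') (auto simp: inj_on_def)
        then show ?thesis using True Pair by simp
      next
        case False
        then show ?thesis unfolding Pair by (auto simp: pmf_eq_0_set_pmf)
      qed
    qed
    also have "measure_pmf.expectation Pw \<dots> = pmf (Q w) v * pmf Pw w"
      by (simp add: measure_pmf_single)
    finally show ?thesis using Pair by (simp add: q_def)
  qed
  then have q_le: "(\<integral>\<^sup>+z. ennreal (q z) \<partial>count_space UNIV) \<le> 1"
    by (simp add: nn_integral_pmf_eq_1)
  have int1: "integrable (measure_pmf D) (\<lambda>\<omega>. q (V \<omega>, W \<omega>) / pmf Pvw (V \<omega>, W \<omega>))"
    using expectation_pmf_ratio_le(1)[OF q_nn q_le, of Pvw]
    unfolding Pvw_def by (subst (asm) integrable_map_pmf_eq)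
  have E1: "measure_pmf.expectation D (\<lambda>\<omega>. q (V \<omega>, W \<omega>) / pmf Pvw (V \<omega>, W \<omega>)) \<le> 1"
    using expectation_pmf_ratio_le(2)[OF q_nn q_le, of Pvw]
    unfolding Pvw_def by (subst (asm) integral_map_pmf)
  note int2 = cond_mutual_info_eq(2)[OF fin, of V W]
  have pw: "log 2 (info_ratio D U V W \<omega>) \<le> c \<omega> + (q (V \<omega>, W \<omega>) / pmf Pvw (V \<omega>, W \<omega>) - 1) / ln 2"
    if w: "\<omega> \<in> set_pmf D" for \<omega>
  proof -
    have pos: "pmf Puvw (U \<omega>,V \<omega>,W \<omega>) > 0" "pmf Puw (U \<omega>, W \<omega>) > 0" "pmf Pvw (V \<omega>, W \<omega>) > 0" "pmf Pw (W \<omega>) > 0"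
      unfolding Puw_def Pvw_def Puvw_def Pw_def
      using w by (auto intro!: pmf_positive)
    note le' = le[OF w, folded Puvw_def Puw_def]
    have Qpos: "pmf (Q (W \<omega>)) (V \<omega>) > 0"
    proof (rule ccontr)
      assume "\<not> ?thesis"
      then have "pmf (Q (W \<omega>)) (V \<omega>) = 0" by (simp add: order_less_le)
      with le' pos show False by simp
    qed
    define z where "z = q (V \<omega>, W \<omega>) / pmf Pvw (V \<omega>, W \<omega>)"
    have zp: "z > 0" unfolding z_def q_def using pos Qpos by simp
    have "info_ratio D U V W \<omega> = pmf Puvw (U \<omega>,V \<omega>,W \<omega>) * pmf Pw (W \<omega>) / (pmf Puw (U \<omega>, W \<omega>) * pmf Pvw (V \<omega>, W \<omega>))"
      unfolding info_ratio_def by (simp add: Puw_def Pvw_def Puvw_def Pw_def)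
    also have "\<dots> \<le> 2 powr c \<omega> * pmf (Q (W \<omega>)) (V \<omega>) * pmf Puw (U \<omega>, W \<omega>) * pmf Pw (W \<omega>) / (pmf Puw (U \<omega>, W \<omega>) * pmf Pvw (V \<omega>, W \<omega>))"
      using le' pos by (intro divide_right_mono mult_right_mono) auto
    also have "\<dots> = 2 powr c \<omega> * z" unfolding z_def q_def using pos by (simp add: field_simps)
    finally have "info_ratio D U V W \<omega> \<le> 2 powr c \<omega> * z" .
    moreover have "info_ratio D U V W \<omega> > 0"
      unfolding info_ratio_def using pos by (simp add: Puw_def Pvw_def Puvw_def Pw_def)
    ultimately have "log 2 (info_ratio D U V W \<omega>) \<le> log 2 (2 powr c \<omega> * z)"
      by (intro log_mono) auto
    also have "\<dots> = c \<omega> + ln z / ln 2" using zp by (simp add: log_def ln_mult ln_powr add_divide_distrib)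
    also have "\<dots> \<le> c \<omega> + (z - 1) / ln 2"
      using ln_le_minus_one[OF zp] by (intro add_left_mono divide_right_mono) auto
    finally show ?thesis by (simp add: z_def)
  qed
  have "cond_mutual_info D U V W \<le> measure_pmf.expectation D (\<lambda>\<omega>. c \<omega> + (q (V \<omega>, W \<omega>) / pmf Pvw (V \<omega>, W \<omega>) - 1) / ln 2)"
    unfolding cond_mutual_info_eq(1)[OF fin]
    using int1 int2 int_c pw by (intro integral_mono_AE) (auto intro!: AE_pmfI)
  also have "\<dots> = measure_pmf.expectation D c + (measure_pmf.expectation D (\<lambda>\<omega>. q (V \<omega>, W \<omega>) / pmf Pvw (V \<omega>, W \<omega>)) - 1) / ln 2"
    using int1 int_c by simp
  also have "\<dots> \<le> measure_pmf.expectation D c"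
    using E1 by (simp add: divide_le_0_iff)
  finally show ?thesis .
qed

section \<open>Information cost and communication\<close>

lemma finite_cube: "finite (cube n)"
  using finite_lists_length_eq[of "UNIV::bool set" n] unfolding cube_def by simp

lemma pmf_map_Pair: "pmf (map_pmf (Pair a) p) (a', b) = (if a = a' then pmf p b else 0)"
proof (cases "a = a'")
  case True
  then show ?thesis by (simp add: pmf_map_inj' inj_on_def)
next
  case False
  then show ?thesis by (auto simp: pmf_eq_0_set_pmf)
qed

lemma pmf_bind_map_Pair:
  "pmf (bind_pmf p (\<lambda>r. map_pmf (Pair r) (K r))) (r, t) = pmf p r * pmf (K r) t"
proof -
  have "pmf (bind_pmf p (\<lambda>r. map_pmf (Pair r) (K r))) (r, t)
      = measure_pmf.expectation p (\<lambda>r'. pmf (K r) t * indicator {r} r')"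
    unfolding pmf_bind pmf_map_Pair by (intro Bochner_Integration.integral_cong) (auto simp: indicator_def)
  then show ?thesis by (simp add: measure_pmf_single)
qed

lemma pmf_transcript: "pmf (transcript P x y) (r, t) = pmf (fst P) r * pmf (messages (snd P r) x y) t"
  unfolding transcript_def by (rule pmf_bind_map_Pair)

lemma pmf_joint: "pmf (joint P \<mu>) (x, y, t) = pmf \<mu> (x, y) * pmf (transcript P x y) t"
proof -
  have "joint P \<mu> = map_pmf (\<lambda>(xy, t). (fst xy, snd xy, t)) (bind_pmf \<mu> (\<lambda>xy. map_pmf (Pair xy) (transcript P (fst xy) (snd xy))))"
    unfolding joint_def by (simp add: map_bind_pmf pmf.map_comp o_def case_prod_unfold)
  moreover have "pmf (map_pmf (\<lambda>(xy, t). (fst xy, snd xy, t)) (bind_pmf \<mu> (\<lambda>xy. map_pmf (Pair xy) (transcript P (fst xy) (snd xy))))) ((\<lambda>(xy, t). (fst xy, snd xy, t)) ((x, y), t))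
     = pmf (bind_pmf \<mu> (\<lambda>xy. map_pmf (Pair xy) (transcript P (fst xy) (snd xy)))) ((x, y), t)"
    by (rule pmf_map_inj') (auto simp: inj_on_def)
  ultimately show ?thesis by (simp add: pmf_bind_map_Pair)
qed

lemma map_joint_inputs: "map_pmf (\<lambda>(x, y, t). (x, y)) (joint P \<mu>) = \<mu>"
  unfolding joint_def by (simp add: map_bind_pmf pmf.map_comp o_def case_prod_unfold map_pmf_const bind_return_pmf')

lemma set_joint: "set_pmf (joint P \<mu>) = {(x, y, t). (x, y) \<in> set_pmf \<mu> \<and> t \<in> set_pmf (transcript P x y)}"
  unfolding joint_def by (auto simp: image_iff)

abbreviation "jX \<equiv> (\<lambda>(x::bitstring, y::bitstring, t::nat \<times> bitstring). x)"
abbreviation "jY \<equiv> (\<lambda>(x::bitstring, y::bitstring, t::nat \<times> bitstring). y)"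
abbreviation "jT \<equiv> (\<lambda>(x::bitstring, y::bitstring, t::nat \<times> bitstring). t)"

lemma information_cost_eq:
  "information_cost P \<mu> = cond_mutual_info (joint P \<mu>) jX jT jY + cond_mutual_info (joint P \<mu>) jY jT jX"
  unfolding information_cost_def Let_def ..

lemma finite_inputs:
  assumes "\<mu> \<in> input_distributions n"
  shows "finite (jX ` set_pmf (joint P \<mu>))" "finite (jY ` set_pmf (joint P \<mu>))"
proof -
  have "jX ` set_pmf (joint P \<mu>) \<subseteq> cube n" "jY ` set_pmf (joint P \<mu>) \<subseteq> cube n"
    using assms by (auto simp: input_distributions_def set_joint)
  then show "finite (jX ` set_pmf (joint P \<mu>))" "finite (jY ` set_pmf (joint P \<mu>))"
    using finite_cube finite_subset by blast+
qed

text \<open>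
  With Alice's coins replaced by fair ones the transcript no longer depends on her input, which makes it
  an admissible guess for an observer who knows only Bob's input; each bit sent by Alice then costs
  that observer at most one bit of divergence.
\<close>

primrec fair_alice :: "protocol \<Rightarrow> protocol" where
  "fair_alice (Leaf v) = Leaf v"
| "fair_alice (Alice q p0 p1) = Alice (\<lambda>_. bernoulli_pmf (1/2)) (fair_alice p0) (fair_alice p1)"
| "fair_alice (Bob q p0 p1) = Bob q (fair_alice p0) (fair_alice p1)"

primrec fair_bob :: "protocol \<Rightarrow> protocol" where
  "fair_bob (Leaf v) = Leaf v"
| "fair_bob (Alice q p0 p1) = Alice q (fair_bob p0) (fair_bob p1)"
| "fair_bob (Bob q p0 p1) = Bob (\<lambda>_. bernoulli_pmf (1/2)) (fair_bob p0) (fair_bob p1)"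

primrec alice_bits :: "protocol \<Rightarrow> bitstring \<Rightarrow> nat" where
  "alice_bits (Leaf v) t = 0"
| "alice_bits (Alice q p0 p1) t = (case t of [] \<Rightarrow> 0 | b # t' \<Rightarrow> Suc (if b then alice_bits p1 t' else alice_bits p0 t'))"
| "alice_bits (Bob q p0 p1) t = (case t of [] \<Rightarrow> 0 | b # t' \<Rightarrow> (if b then alice_bits p1 t' else alice_bits p0 t'))"

primrec bob_bits :: "protocol \<Rightarrow> bitstring \<Rightarrow> nat" where
  "bob_bits (Leaf v) t = 0"
| "bob_bits (Alice q p0 p1) t = (case t of [] \<Rightarrow> 0 | b # t' \<Rightarrow> (if b then bob_bits p1 t' else bob_bits p0 t'))"
| "bob_bits (Bob q p0 p1) t = (case t of [] \<Rightarrow> 0 | b # t' \<Rightarrow> Suc (if b then bob_bits p1 t' else bob_bits p0 t'))"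

lemma alice_bits_plus_bob_bits_le: "alice_bits p t + bob_bits p t \<le> length t"
proof (induction p arbitrary: t)
  case (Alice q p0 p1)
  then show ?case by (cases t) auto
next
  case (Bob q p0 p1)
  then show ?case by (cases t) auto
qed auto

lemma pmf_bind_bool_Cons:
  "pmf (bind_pmf (q :: bool pmf) (\<lambda>b. map_pmf ((#) b) (if b then m1 else m0))) t =
     (case t of [] \<Rightarrow> 0 | b # t' \<Rightarrow> pmf q b * pmf (if b then m1 else m0) t')"
proof (cases t)
  case Nil
  then show ?thesis by (auto simp: pmf_eq_0_set_pmf)
next
  case (Cons b t')
  have "pmf (map_pmf ((#) b') m) (b # t') = (if b' = b then pmf m t' else 0)" for b' m
  proof (cases "b' = b")
    case True
    then show ?thesis by (simp add: pmf_map_inj' inj_on_def)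
  next
    case False
    then show ?thesis by (auto simp: pmf_eq_0_set_pmf)
  qed
  then show ?thesis unfolding Cons pmf_bind
    by (subst integral_measure_pmf_real[where A=UNIV]) (auto simp: UNIV_bool)
qed

lemma pmf_messages_le_fair_alice:
  "pmf (messages p x y) t \<le> 2 ^ alice_bits p t * pmf (messages (fair_alice p) x' y) t"
proof (induction p arbitrary: t)
  case (Leaf v)
  then show ?case by simp
next
  case (Alice q p0 p1)
  show ?case
  proof (cases t)
    case Nil
    then show ?thesis unfolding messages.simps pmf_bind_bool_Cons by simp
  next
    case (Cons b t')
    have "pmf (q x) b * pmf (if b then messages p1 x y else messages p0 x y) t' \<le>
       1 * pmf (if b then messages p1 x y else messages p0 x y) t'"
      by (intro mult_right_mono pmf_le_1) auto
    also have "\<dots> \<le> 2 ^ (if b then alice_bits p1 t' else alice_bits p0 t') *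
       pmf (if b then messages (fair_alice p1) x' y else messages (fair_alice p0) x' y) t'"
      using Alice.IH by simp
    finally show ?thesis
      unfolding messages.simps fair_alice.simps pmf_bind_bool_Cons Cons by (cases b) (simp_all)
  qed
next
  case (Bob q p0 p1)
  show ?case
  proof (cases t)
    case Nil
    then show ?thesis unfolding messages.simps pmf_bind_bool_Cons by simp
  next
    case (Cons b t')
    have "pmf (q y) b * pmf (if b then messages p1 x y else messages p0 x y) t' \<le> pmf (q y) b * (2 ^ (if b then alice_bits p1 t' else alice_bits p0 t') *
       pmf (if b then messages (fair_alice p1) x' y else messages (fair_alice p0) x' y) t')"
      using Bob.IH by (intro mult_left_mono) auto
    then show ?thesis
      unfolding messages.simps fair_alice.simps pmf_bind_bool_Cons Cons by (cases b) (simp_all add: mult_ac)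
  qed
qed

lemma pmf_messages_le_fair_bob:
  "pmf (messages p x y) t \<le> 2 ^ bob_bits p t * pmf (messages (fair_bob p) x y') t"
proof (induction p arbitrary: t)
  case (Leaf v)
  then show ?case by simp
next
  case (Bob q p0 p1)
  show ?case
  proof (cases t)
    case Nil
    then show ?thesis unfolding messages.simps pmf_bind_bool_Cons by simp
  next
    case (Cons b t')
    have "pmf (q y) b * pmf (if b then messages p1 x y else messages p0 x y) t' \<le>
       1 * pmf (if b then messages p1 x y else messages p0 x y) t'"
      by (intro mult_right_mono pmf_le_1) auto
    also have "\<dots> \<le> 2 ^ (if b then bob_bits p1 t' else bob_bits p0 t') *
       pmf (if b then messages (fair_bob p1) x y' else messages (fair_bob p0) x y') t'"
      using Bob.IH by simp
    finally show ?thesis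
      unfolding messages.simps fair_bob.simps pmf_bind_bool_Cons Cons by (cases b) (simp_all)
  qed
next
  case (Alice q p0 p1)
  show ?case
  proof (cases t)
    case Nil
    then show ?thesis unfolding messages.simps pmf_bind_bool_Cons by simp
  next
    case (Cons b t')
    have "pmf (q x) b * pmf (if b then messages p1 x y else messages p0 x y) t' \<le> pmf (q x) b * (2 ^ (if b then bob_bits p1 t' else bob_bits p0 t') *
       pmf (if b then messages (fair_bob p1) x y' else messages (fair_bob p0) x y') t')"
      using Alice.IH by (intro mult_left_mono) auto
    then show ?thesis
      unfolding messages.simps fair_bob.simps pmf_bind_bool_Cons Cons by (cases b) (simp_all add: mult_ac)
  qed
qed

text \<open>The bits of the two players are charged separately: those of Alice bound I(X; T | Y),
  those of Bob bound I(Y; T | X). Together they number at most the length of the transcript, so no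
  factor 2 is lost.\<close>

lemma information_cost_le:
  assumes \<mu>: "\<mu> \<in> input_distributions n" and comm: "communication_at_most n P k"
  shows "information_cost P \<mu> \<le> k"
proof -
  let ?D = "joint P \<mu>"
  define cA where "cA = (\<lambda>(x::bitstring, y::bitstring, t). real (alice_bits (snd P (fst t)) (snd t)))"
  define cB where "cB = (\<lambda>(x::bitstring, y::bitstring, t). real (bob_bits (snd P (fst t)) (snd t)))"
  have sum_le: "cA \<omega> + cB \<omega> \<le> k" if "\<omega> \<in> set_pmf ?D" for \<omega>
  proof -
    obtain x y r t where w: "\<omega> = (x, y, r, t)" by (cases \<omega>)
    have "(x, y) \<in> set_pmf \<mu>" and rt: "(r, t) \<in> set_pmf (transcript P x y)"
      using that by (auto simp: w set_joint)
    then have "x \<in> cube n" "y \<in> cube n" using \<mu> by (auto simp: input_distributions_def)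
    with comm rt have "case (r, t) of (r, t) \<Rightarrow> length t \<le> k"
      unfolding communication_at_most_def by blast
    then have "length t \<le> k" by simp
    then show ?thesis using alice_bits_plus_bob_bits_le[of "snd P r" t] unfolding w cA_def cB_def by simp
  qed
  have nn: "cA \<omega> \<ge> 0" "cB \<omega> \<ge> 0" for \<omega> by (auto simp: cA_def cB_def split: prod.splits)
  have intA: "integrable (measure_pmf ?D) cA"
  proof (intro measure_pmf.integrable_const_bound[where B=k] AE_pmfI)
    fix \<omega> assume "\<omega> \<in> set_pmf ?D"
    from sum_le[OF this] nn[of \<omega>] show "norm (cA \<omega>) \<le> k" by simp
  qed auto
  have intB: "integrable (measure_pmf ?D) cB"
  proof (intro measure_pmf.integrable_const_bound[where B=k] AE_pmfI)
    fix \<omega> assume "\<omega> \<in> set_pmf ?D"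
    from sum_le[OF this] nn[of \<omega>] show "norm (cB \<omega>) \<le> k" by simp
  qed auto
  \<comment> \<open>A dummy input: the player whose coins are fair ignores it.\<close>
  define x0 :: bitstring where "x0 = []"
  have A: "cond_mutual_info ?D jX jT jY \<le> measure_pmf.expectation ?D cA"
  proof (rule cond_mutual_info_le[where Q = "\<lambda>y. transcript (fst P, \<lambda>r. fair_alice (snd P r)) x0 y"])
    fix \<omega> assume "\<omega> \<in> set_pmf ?D"
    obtain x y r t where w: "\<omega> = (x, y, r, t)" by (cases \<omega>)
    have "pmf (map_pmf (\<lambda>\<omega>. (jX \<omega>, jT \<omega>, jY \<omega>)) ?D) ((\<lambda>\<omega>. (jX \<omega>, jT \<omega>, jY \<omega>)) \<omega>) = pmf ?D \<omega>"
      by (rule pmf_map_inj') (auto simp: inj_on_def)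
    moreover have "map_pmf (\<lambda>\<omega>. (jX \<omega>, jY \<omega>)) ?D = \<mu>"
      using map_joint_inputs[of P \<mu>] by (simp add: case_prod_unfold)
    moreover have "pmf ?D \<omega> \<le> 2 powr cA \<omega> * pmf (transcript (fst P, \<lambda>r. fair_alice (snd P r)) x0 y) (r, t) * pmf \<mu> (x, y)"
    proof -
      have "pmf ?D \<omega> = pmf (messages (snd P r) x y) t * (pmf \<mu> (x, y) * pmf (fst P) r)"
        unfolding w pmf_joint pmf_transcript by simp
      also have "\<dots> \<le> 2 ^ alice_bits (snd P r) t * pmf (messages (fair_alice (snd P r)) x0 y) t * (pmf \<mu> (x, y) * pmf (fst P) r)"
        by (intro mult_right_mono pmf_messages_le_fair_alice) auto
      finally show ?thesis unfolding w pmf_transcript cA_def by (simp add: powr_realpow mult_ac)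
    qed
    ultimately show "pmf (map_pmf (\<lambda>\<omega>. (jX \<omega>, jT \<omega>, jY \<omega>)) ?D) (jX \<omega>, jT \<omega>, jY \<omega>) \<le>
         2 powr cA \<omega> * pmf (transcript (fst P, \<lambda>r. fair_alice (snd P r)) x0 (jY \<omega>)) (jT \<omega>) *
         pmf (map_pmf (\<lambda>\<omega>. (jX \<omega>, jY \<omega>)) ?D) (jX \<omega>, jY \<omega>)"
      by (simp add: w)
  qed (use intA finite_inputs[OF \<mu>] in auto)
  have B: "cond_mutual_info ?D jY jT jX \<le> measure_pmf.expectation ?D cB"
  proof (rule cond_mutual_info_le[where Q = "\<lambda>x. transcript (fst P, \<lambda>r. fair_bob (snd P r)) x x0"])
    fix \<omega> assume "\<omega> \<in> set_pmf ?D"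
    obtain x y r t where w: "\<omega> = (x, y, r, t)" by (cases \<omega>)
    have "pmf (map_pmf (\<lambda>\<omega>. (jY \<omega>, jT \<omega>, jX \<omega>)) ?D) ((\<lambda>\<omega>. (jY \<omega>, jT \<omega>, jX \<omega>)) \<omega>) = pmf ?D \<omega>"
      by (rule pmf_map_inj') (auto simp: inj_on_def)
    moreover have "pmf (map_pmf (\<lambda>\<omega>. (jY \<omega>, jX \<omega>)) ?D) (y, x) = pmf \<mu> (x, y)"
    proof -
      have "map_pmf (\<lambda>\<omega>. (jY \<omega>, jX \<omega>)) ?D = map_pmf prod.swap \<mu>"
        by (subst map_joint_inputs[of P \<mu>, symmetric]) (simp add: pmf.map_comp o_def case_prod_unfold)
      moreover have "pmf (map_pmf prod.swap \<mu>) (prod.swap (x, y)) = pmf \<mu> (x, y)"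
        by (rule pmf_map_inj') auto
      ultimately show ?thesis by simp
    qed
    moreover have "pmf ?D \<omega> \<le> 2 powr cB \<omega> * pmf (transcript (fst P, \<lambda>r. fair_bob (snd P r)) x x0) (r, t) * pmf \<mu> (x, y)"
    proof -
      have "pmf ?D \<omega> = pmf (messages (snd P r) x y) t * (pmf \<mu> (x, y) * pmf (fst P) r)"
        unfolding w pmf_joint pmf_transcript by simp
      also have "\<dots> \<le> 2 ^ bob_bits (snd P r) t * pmf (messages (fair_bob (snd P r)) x x0) t * (pmf \<mu> (x, y) * pmf (fst P) r)"
        by (intro mult_right_mono pmf_messages_le_fair_bob) auto
      finally show ?thesis unfolding w pmf_transcript cB_def by (simp add: powr_realpow mult_ac)
    qed
    ultimately show "pmf (map_pmf (\<lambda>\<omega>. (jY \<omega>, jT \<omega>, jX \<omega>)) ?D) (jY \<omega>, jT \<omega>, jX \<omega>) \<le>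
         2 powr cB \<omega> * pmf (transcript (fst P, \<lambda>r. fair_bob (snd P r)) (jX \<omega>) x0) (jT \<omega>) *
         pmf (map_pmf (\<lambda>\<omega>. (jY \<omega>, jX \<omega>)) ?D) (jY \<omega>, jX \<omega>)"
      by (simp add: w)
  qed (use intB finite_inputs[OF \<mu>] in auto)
  have "information_cost P \<mu> \<le> measure_pmf.expectation ?D (\<lambda>\<omega>. cA \<omega> + cB \<omega>)"
    unfolding information_cost_eq using A B intA intB by simp
  also have "\<dots> \<le> measure_pmf.expectation ?D (\<lambda>\<omega>. real k)"
    using intA intB sum_le by (intro integral_mono_AE) (auto intro!: AE_pmfI)
  finally show ?thesis by simp
qed

text \<open>The hypothesis ensures that the \<open>LEAST\<close> in \<open>R_public\<close> is
  attained; the protocol of the upper bound supplies it.\<close>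

lemma IC_le_R_public:
  assumes "\<exists>k P. public_coin P \<and> computes n f P \<and> communication_at_most n P k"
  shows "IC n f \<le> ereal (real (R_public n f))"
proof -
  have "\<exists>P. public_coin P \<and> computes n f P \<and> communication_at_most n P (R_public n f)"
    unfolding R_public_def by (rule LeastI_ex) (use assms in blast)
  then obtain P where P: "computes n f P" "communication_at_most n P (R_public n f)" by blast
  have "IC n f \<le> (SUP \<mu>\<in>input_distributions n. ereal (information_cost P \<mu>))"
    unfolding IC_def using P(1) by (intro INF_lower) auto
  also have "\<dots> \<le> ereal (real (R_public n f))"
    using information_cost_le[OF _ P(2)] by (intro SUP_least) auto
  finally show ?thesis .
qed

section \<open>Lower bound m at most IC: test functions for indexing and disjointness\<close>

section \<open>Lower bounds on information cost for product inputs\<close>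

lemma expectation_bind_pmf:
  fixes f :: "'b \<Rightarrow> real"
  assumes b: "\<And>y. \<bar>f y\<bar> \<le> B"
  shows "measure_pmf.expectation (bind_pmf p N) f = measure_pmf.expectation p (\<lambda>x. measure_pmf.expectation (N x) f)"
  unfolding measure_pmf_bind using measurable_measure_pmf[of N]
  by (intro integral_bind[where K="count_space UNIV" and B'=1 and B=B]) (use b in auto)

text \<open>
  The information (in nats) that the transcript carries about uniform inputs from \<open>I \<times> J\<close> is at least
  \<open>\<theta>\<close>, witnessed by test functions \<open>\<phi>\<close> and \<open>\<psi>\<close> for the Donsker--Varadhan bound. The functions
  have to be bounded because the transcript ranges over an infinite set.
\<close>

definition product_cost_at_least ::
  "('x \<Rightarrow> 'y \<Rightarrow> 't pmf) \<Rightarrow> 'x set \<Rightarrow> 'y set \<Rightarrow> real \<Rightarrow> bool" where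
  "product_cost_at_least K I J \<theta> \<longleftrightarrow> finite I \<and> I \<noteq> {} \<and> finite J \<and> J \<noteq> {} \<and>
     (\<exists>\<phi> \<psi> B. (\<forall>x t. \<bar>\<phi> x t\<bar> \<le> B) \<and> (\<forall>y t. \<bar>\<psi> y t\<bar> \<le> (B::real)) \<and>
        (\<forall>t. (\<Sum>x\<in>I. exp (\<phi> x t)) \<le> card I) \<and> (\<forall>t. (\<Sum>y\<in>J. exp (\<psi> y t)) \<le> card J) \<and>
        \<theta> * (card I * card J) \<le> (\<Sum>x\<in>I. \<Sum>y\<in>J. measure_pmf.expectation (K x y) (\<lambda>t. \<phi> x t + \<psi> y t)))"

text \<open>For a uniform product law the inputs are independent, so the Donsker--Varadhan bound
  applies to both halves of the cost: \<phi> tests what the transcript tells about X given Y, and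
  \<psi> what it tells about Y given X.\<close>

lemma information_cost_ge_product_cost:
  assumes I: "I \<subseteq> cube n" and J: "J \<subseteq> cube n" and pc: "product_cost_at_least (transcript P) I J \<theta>"
  shows "\<exists>\<mu>\<in>input_distributions n. \<theta> \<le> ln 2 * information_cost P \<mu>"
proof -
  from pc obtain \<phi> \<psi> B where fin: "finite I" "I \<noteq> {}" "finite J" "J \<noteq> {}"
    and b\<phi>: "\<And>x t. \<bar>\<phi> x t\<bar> \<le> B" and b\<psi>: "\<And>y t. \<bar>\<psi> y t\<bar> \<le> B"
    and s\<phi>: "\<And>t. (\<Sum>x\<in>I. exp (\<phi> x t)) \<le> card I" and s\<psi>: "\<And>t. (\<Sum>y\<in>J. exp (\<psi> y t)) \<le> card J"
    and \<theta>: "\<theta> * (card I * card J) \<le> (\<Sum>x\<in>I. \<Sum>y\<in>J. measure_pmf.expectation (transcript P x y) (\<lambda>t. \<phi> x t + \<psi> y t))"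
    unfolding product_cost_at_least_def by blast
  define \<mu> where "\<mu> = pair_pmf (pmf_of_set I) (pmf_of_set J)"
  let ?D = "joint P \<mu>"
  have \<mu>: "\<mu> \<in> input_distributions n"
    using I J fin by (auto simp: input_distributions_def \<mu>_def)
  have XY: "map_pmf (\<lambda>\<omega>. (jX \<omega>, jY \<omega>)) ?D = \<mu>"
      using map_joint_inputs[of P \<mu>] by (simp add: case_prod_unfold)
  have "map_pmf jX ?D = map_pmf fst (map_pmf (\<lambda>\<omega>. (jX \<omega>, jY \<omega>)) ?D)"
    "map_pmf jY ?D = map_pmf snd (map_pmf (\<lambda>\<omega>. (jX \<omega>, jY \<omega>)) ?D)"
    by (simp_all only: pmf.map_comp o_def fst_conv snd_conv)
  then have mX: "map_pmf jX ?D = pmf_of_set I" and mY: "map_pmf jY ?D = pmf_of_set J"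
    unfolding XY by (simp_all add: \<mu>_def map_fst_pair_pmf map_snd_pair_pmf)
  have YX: "map_pmf (\<lambda>\<omega>. (jY \<omega>, jX \<omega>)) ?D = pair_pmf (pmf_of_set J) (pmf_of_set I)"
  proof -
    have "map_pmf (\<lambda>\<omega>. (jY \<omega>, jX \<omega>)) ?D = map_pmf (\<lambda>(x,y). (y,x)) (map_pmf (\<lambda>\<omega>. (jX \<omega>, jY \<omega>)) ?D)"
      by (simp only: pmf.map_comp o_def case_prod_conv)
    then show ?thesis unfolding XY unfolding \<mu>_def by (subst pair_commute_pmf) (simp add: pmf.map_comp o_def case_prod_unfold)
  qed
  have 1: "measure_pmf.expectation ?D (\<lambda>\<omega>. \<phi> (jX \<omega>) (jT \<omega>)) \<le> ln 2 * cond_mutual_info ?D jX jT jY"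
  proof (rule cond_mutual_info_ge)
    show "measure_pmf.expectation (map_pmf jX ?D) (\<lambda>u. exp (\<phi> u v)) \<le> 1" for v
      unfolding mX using fin s\<phi>[of v] by (simp add: integral_pmf_of_set divide_le_eq card_gt_0_iff)
  qed (use XY mX mY finite_inputs[OF \<mu>] b\<phi> in \<open>simp_all add: \<mu>_def\<close>)
  have 2: "measure_pmf.expectation ?D (\<lambda>\<omega>. \<psi> (jY \<omega>) (jT \<omega>)) \<le> ln 2 * cond_mutual_info ?D jY jT jX"
  proof (rule cond_mutual_info_ge)
    show "measure_pmf.expectation (map_pmf jY ?D) (\<lambda>u. exp (\<psi> u v)) \<le> 1" for v
      unfolding mY using fin s\<psi>[of v] by (simp add: integral_pmf_of_set divide_le_eq card_gt_0_iff)
  qed (use YX mX mY finite_inputs[OF \<mu>] b\<psi> in \<open>simp_all\<close>)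
  have i1: "integrable (measure_pmf p) (\<lambda>\<omega>. \<phi> (f \<omega>) (g \<omega>))" for p and f :: "'c \<Rightarrow> _" and g
    using b\<phi> by (intro measure_pmf.integrable_const_bound[where B=B]) auto
  have i2: "integrable (measure_pmf p) (\<lambda>\<omega>. \<psi> (f \<omega>) (g \<omega>))" for p and f :: "'c \<Rightarrow> _" and g
    using b\<psi> by (intro measure_pmf.integrable_const_bound[where B=B]) auto
  have \<mu>_unif: "\<mu> = pmf_of_set (I \<times> J)" unfolding \<mu>_def
  proof (rule pmf_eqI)
    fix i show "pmf (pair_pmf (pmf_of_set I) (pmf_of_set J)) i = pmf (pmf_of_set (I \<times> J)) i"
      using fin by (cases i) (simp add: pmf_pair indicator_def)
  qed
  define g where "g = (\<lambda>(x,y). measure_pmf.expectation (transcript P x y) (\<lambda>t. \<phi> x t + \<psi> y t))"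
  have "measure_pmf.expectation ?D (\<lambda>\<omega>. \<phi> (jX \<omega>) (jT \<omega>) + \<psi> (jY \<omega>) (jT \<omega>)) = measure_pmf.expectation \<mu> g"
  proof -
    have bound: "\<bar>\<phi> (jX \<omega>) (jT \<omega>) + \<psi> (jY \<omega>) (jT \<omega>)\<bar> \<le> 2 * B" for \<omega>
      using b\<phi>[of "jX \<omega>" "jT \<omega>"] b\<psi>[of "jY \<omega>" "jT \<omega>"] by linarith
    show ?thesis
      unfolding joint_def by (subst expectation_bind_pmf[OF bound]) (simp add: g_def case_prod_unfold)
  qed
  also have "measure_pmf.expectation \<mu> g = (\<Sum>x\<in>I. \<Sum>y\<in>J. g (x, y)) / (card I * card J)"
    unfolding \<mu>_unif using fin by (subst integral_pmf_of_set) (auto simp: sum.cartesian_product)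
  also have "\<dots> \<ge> \<theta>"
    using \<theta> fin by (subst pos_le_divide_eq) (auto simp: g_def card_gt_0_iff)
  finally have "\<theta> \<le> measure_pmf.expectation ?D (\<lambda>\<omega>. \<phi> (jX \<omega>) (jT \<omega>) + \<psi> (jY \<omega>) (jT \<omega>))" .
  also have "\<dots> \<le> ln 2 * information_cost P \<mu>"
    unfolding information_cost_eq using 1 2
    by (subst Bochner_Integration.integral_add[OF i1 i2]) (simp add: ring_distribs)
  finally show ?thesis using \<mu> by blast
qed

text \<open>The randomized form of the fact that the inputs reaching a leaf form a rectangle: one
  factor collects the coins of Alice, the other those of Bob.\<close>

definition rectangular :: "('x \<Rightarrow> 'y \<Rightarrow> 't pmf) \<Rightarrow> bool" where
  "rectangular K \<longleftrightarrow> (\<exists>\<alpha> \<beta>. (\<forall>x t. 0 \<le> (\<alpha> x t :: real)) \<and> (\<forall>y t. 0 \<le> (\<beta> y t :: real)) \<and>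
     (\<forall>x y t. pmf (K x y) t = \<alpha> x t * \<beta> y t))"

lemma rectangular_messages: "rectangular (messages p)"
proof (induction p)
  case (Leaf v)
  show ?case unfolding rectangular_def
    by (rule exI[where x="\<lambda>x t. pmf (return_pmf []) t"], rule exI[where x="\<lambda>x t. 1"]) simp
next
  case (Alice q p0 p1)
  then obtain \<alpha>0 \<beta>0 \<alpha>1 \<beta>1 where nn: "\<And>x t. 0 \<le> (\<alpha>0 x t :: real)" "\<And>y t. 0 \<le> (\<beta>0 y t :: real)"
      "\<And>x t. 0 \<le> (\<alpha>1 x t :: real)" "\<And>y t. 0 \<le> (\<beta>1 y t :: real)"
    and eq: "\<And>x y t. pmf (messages p0 x y) t = \<alpha>0 x t * \<beta>0 y t" "\<And>x y t. pmf (messages p1 x y) t = \<alpha>1 x t * \<beta>1 y t"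
    unfolding rectangular_def by metis
  show ?case unfolding rectangular_def messages.simps pmf_bind_bool_Cons
    by (rule exI[where x="\<lambda>x t. case t of [] \<Rightarrow> 0 | b # t' \<Rightarrow> pmf (q x) b * (if b then \<alpha>1 x t' else \<alpha>0 x t')"],
        rule exI[where x="\<lambda>y t. case t of [] \<Rightarrow> 0 | b # t' \<Rightarrow> if b then \<beta>1 y t' else \<beta>0 y t'"])
       (auto simp: nn eq split: list.splits)
next
  case (Bob q p0 p1)
  then obtain \<alpha>0 \<beta>0 \<alpha>1 \<beta>1 where nn: "\<And>x t. 0 \<le> (\<alpha>0 x t :: real)" "\<And>y t. 0 \<le> (\<beta>0 y t :: real)"
      "\<And>x t. 0 \<le> (\<alpha>1 x t :: real)" "\<And>y t. 0 \<le> (\<beta>1 y t :: real)"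
    and eq: "\<And>x y t. pmf (messages p0 x y) t = \<alpha>0 x t * \<beta>0 y t" "\<And>x y t. pmf (messages p1 x y) t = \<alpha>1 x t * \<beta>1 y t"
    unfolding rectangular_def by metis
  show ?case unfolding rectangular_def messages.simps pmf_bind_bool_Cons
    by (rule exI[where x="\<lambda>x t. case t of [] \<Rightarrow> 0 | b # t' \<Rightarrow> if b then \<alpha>1 x t' else \<alpha>0 x t'"],
        rule exI[where x="\<lambda>y t. case t of [] \<Rightarrow> 0 | b # t' \<Rightarrow> pmf (q y) b * (if b then \<beta>1 y t' else \<beta>0 y t')"])
       (auto simp: nn eq split: list.splits)
qed

lemma rectangular_transcript: "rectangular (transcript P)"
proof -
  have "\<forall>r. \<exists>\<alpha> \<beta>. (\<forall>x t. 0 \<le> (\<alpha> x t :: real)) \<and> (\<forall>y t. 0 \<le> (\<beta> y t :: real)) \<and>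
     (\<forall>x y t. pmf (messages (snd P r) x y) t = \<alpha> x t * \<beta> y t)"
    using rectangular_messages unfolding rectangular_def by blast
  then obtain \<alpha> \<beta> where nn: "\<And>r x t. 0 \<le> (\<alpha> r x t :: real)" "\<And>r y t. 0 \<le> (\<beta> r y t :: real)"
    and eq: "\<And>r x y t. pmf (messages (snd P r) x y) t = \<alpha> r x t * \<beta> r y t"
    by metis
  show ?thesis unfolding rectangular_def
    by (rule exI[where x="\<lambda>x (r, t). pmf (fst P) r * \<alpha> r x t"], rule exI[where x="\<lambda>y (r, t). \<beta> r y t"])
       (auto simp: nn eq pmf_transcript)
qed

lemma rectangular_swap: "rectangular K \<Longrightarrow> rectangular (\<lambda>y x. K x y)"
  unfolding rectangular_def by (metis mult.commute)

lemma rectangular_compose: "rectangular K \<Longrightarrow> rectangular (\<lambda>x y. K (f x) (g y))"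
  unfolding rectangular_def
proof (elim exE conjE)
  fix \<alpha> :: "'a \<Rightarrow> 'c \<Rightarrow> real" and \<beta> :: "'b \<Rightarrow> 'c \<Rightarrow> real"
  assume "\<forall>x t. 0 \<le> \<alpha> x t" "\<forall>y t. 0 \<le> \<beta> y t" "\<forall>x y t. pmf (K x y) t = \<alpha> x t * \<beta> y t"
  then show "\<exists>\<alpha> \<beta>. (\<forall>x t. 0 \<le> (\<alpha> x t :: real)) \<and> (\<forall>y t. 0 \<le> (\<beta> y t :: real)) \<and>
     (\<forall>x y t. pmf (K (f x) (g y)) t = \<alpha> x t * \<beta> y t)"
    by (intro exI[where x="\<lambda>x. \<alpha> (f x)"] exI[where x="\<lambda>y. \<beta> (g y)"]) auto
qed

lemma product_cost_swap:
  "product_cost_at_least K I J \<theta> \<Longrightarrow> product_cost_at_least (\<lambda>y x. K x y) J I \<theta>"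
proof -
  assume "product_cost_at_least K I J \<theta>"
  then obtain \<phi> \<psi> B where *: "finite I" "I \<noteq> {}" "finite J" "J \<noteq> {}"
    "\<forall>x t. \<bar>\<phi> x t\<bar> \<le> B" "\<forall>y t. \<bar>\<psi> y t\<bar> \<le> (B::real)"
    "\<forall>t. (\<Sum>x\<in>I. exp (\<phi> x t)) \<le> card I" "\<forall>t. (\<Sum>y\<in>J. exp (\<psi> y t)) \<le> card J"
    and le: "\<theta> * (card I * card J) \<le> (\<Sum>x\<in>I. \<Sum>y\<in>J. measure_pmf.expectation (K x y) (\<lambda>t. \<phi> x t + \<psi> y t))"
    unfolding product_cost_at_least_def by blast
  have "\<theta> * (card J * card I) \<le> (\<Sum>y\<in>J. \<Sum>x\<in>I. measure_pmf.expectation (K x y) (\<lambda>t. \<psi> y t + \<phi> x t))"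
    using le by (subst sum.swap) (simp add: add.commute mult.commute)
  with * show ?thesis unfolding product_cost_at_least_def by blast
qed

text \<open>For protocols restricted to embedded instances of a smaller problem. Injectivity keeps
  the cardinalities and lets the test functions be transported along the inverse of the
  embedding.\<close>

lemma product_cost_image:
  assumes pc: "product_cost_at_least (\<lambda>i j. K (f i) (g j)) I J \<theta>" and inj: "inj_on f I" "inj_on g J"
  shows "product_cost_at_least K (f ` I) (g ` J) \<theta>"
proof -
  obtain \<phi> \<psi> B where *: "finite I" "I \<noteq> {}" "finite J" "J \<noteq> {}"
    and b: "\<And>x t. \<bar>\<phi> x t\<bar> \<le> B" "\<And>y t. \<bar>\<psi> y t\<bar> \<le> (B::real)"
    and s: "\<And>t. (\<Sum>x\<in>I. exp (\<phi> x t)) \<le> card I" "\<And>t. (\<Sum>y\<in>J. exp (\<psi> y t)) \<le> card J"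
    and le: "\<theta> * (card I * card J) \<le> (\<Sum>x\<in>I. \<Sum>y\<in>J. measure_pmf.expectation (K (f x) (g y)) (\<lambda>t. \<phi> x t + \<psi> y t))"
    using pc unfolding product_cost_at_least_def by blast
  show ?thesis unfolding product_cost_at_least_def
    apply (intro conjI exI[where x="\<lambda>x. \<phi> (the_inv_into I f x)"] exI[where x="\<lambda>x. \<psi> (the_inv_into J g x)"] exI[where x=B])
    using * b s le inj
    by (simp_all add: sum.reindex card_image the_inv_into_f_f)
qed

lemma expectation_affine_indicator:
  "measure_pmf.expectation p (\<lambda>t. a + b * indicator A t) = a + b * measure_pmf.prob p A" for a b :: real
proof -
  have "integrable (measure_pmf p) (\<lambda>t. indicator A t :: real)"
    by (intro measure_pmf.integrable_const_bound[where B=1]) (auto simp: indicator_def)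
  then show ?thesis by (subst Bochner_Integration.integral_add) auto
qed

text \<open>The output alone reveals part of one bit of y, which gives a positive cost even where
  the main estimates are negative. The factors 4/3 for a right and 2/3 for a wrong output add up to
  2, the number of inputs of Bob.\<close>

lemma product_cost_two_inputs:
  fixes K :: "'x \<Rightarrow> 'y \<Rightarrow> 't pmf"
  assumes y: "y0 \<noteq> y1"
    and p1: "measure_pmf.prob (K x y1) {t. out t} \<ge> 2/3"
    and p0: "measure_pmf.prob (K x y0) {t. \<not> out t} \<ge> 2/3"
  shows "product_cost_at_least K {x} {y0, y1} (1/20)"
proof -
  define \<psi> :: "'y \<Rightarrow> 't \<Rightarrow> real" where "\<psi> = (\<lambda>y t. if (y = y1) = out t then ln (4/3) else ln (2/3))"
  have l: "ln (4/3 :: real) = ln (2/3) + ln 2" using ln_realpow[of 2 2] by (simp add: ln_div)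
  have E: "measure_pmf.expectation (K x y) (\<psi> y) = ln (2/3) + ln 2 * measure_pmf.prob (K x y) {t. (y = y1) = out t}" for y
  proof -
    have "\<psi> y = (\<lambda>t. ln (2/3) + ln 2 * indicator {t. (y = y1) = out t} t)"
      by (auto simp: \<psi>_def l)
    then show ?thesis by (simp only: expectation_affine_indicator)
  qed
  \<comment> \<open>The left side equals ln (32/27) / 3, which is at least 5/96.\<close>
  have num: "ln (2/3) + ln 2 * (2/3) \<ge> (1/20 :: real)"
  proof -
    have "ln (27/32 :: real) \<le> 27/32 - 1" by (rule ln_le_minus_one) simp
    moreover have "ln (27/32 :: real) = 3 * ln 3 - 5 * ln 2"
      using ln_realpow[of 3 3] ln_realpow[of 2 5] by (simp add: ln_div)
    moreover have "ln (2/3 :: real) = ln 2 - ln 3" by (simp add: ln_div)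
    ultimately show ?thesis by simp
  qed
  have "1/20 \<le> measure_pmf.expectation (K x y) (\<psi> y)" if "y \<in> {y0, y1}" for y
  proof -
    have "2/3 \<le> measure_pmf.prob (K x y) {t. (y = y1) = out t}"
      using that p0 p1 y by auto
    then have "ln 2 * (2/3 :: real) \<le> ln 2 * measure_pmf.prob (K x y) {t. (y = y1) = out t}"
      by (intro mult_left_mono) auto
    then show ?thesis unfolding E using num by linarith
  qed
  then have ge: "1/20 \<le> measure_pmf.expectation (K x y0) (\<psi> y0)" "1/20 \<le> measure_pmf.expectation (K x y1) (\<psi> y1)"
    by auto
  have bnd: "\<bar>\<psi> y t\<bar> \<le> \<bar>ln (4/3)\<bar> + \<bar>ln (2/3)\<bar>" for y t by (auto simp: \<psi>_def)
  have s: "(\<Sum>y\<in>{y0, y1}. exp (\<psi> y t)) \<le> card {y0, y1}" for t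
    using y by (simp add: \<psi>_def)
  have le: "1/20 * real (card {x} * card {y0, y1}) \<le> (\<Sum>x\<in>{x}. \<Sum>y\<in>{y0, y1}. measure_pmf.expectation (K x y) (\<lambda>t. 0 + \<psi> y t))"
    using y ge by simp
  show ?thesis unfolding product_cost_at_least_def
    by (intro conjI exI[where x="\<lambda>_ _. 0"] exI[where x=\<psi>] exI[where x="\<bar>ln (4/3)\<bar> + \<bar>ln (2/3)\<bar>"] allI s le bnd) auto
qed

lemma integrable_pmf_mult:
  fixes f :: "'t \<Rightarrow> real"
  assumes "\<And>t. \<bar>f t\<bar> \<le> B"
  shows "integrable (count_space UNIV) (\<lambda>t. pmf p t * f t)"
  unfolding integrable_measure_pmf_iff[symmetric]
  using assms by (intro measure_pmf.integrable_const_bound[where B=B]) auto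

text \<open>The passage from a single transcript to expectations; boundedness makes every summand
  integrable over the infinite set of transcripts.\<close>

lemma sum_expectation_mono:
  fixes f g :: "'x \<Rightarrow> 'y \<Rightarrow> 't \<Rightarrow> real"
  assumes "\<And>x y t. \<bar>f x y t\<bar> \<le> B" "\<And>x y t. \<bar>g x y t\<bar> \<le> B'"
    and "\<And>t. (\<Sum>x\<in>I. \<Sum>y\<in>J. pmf (K x y) t * g x y t) \<le> (\<Sum>x\<in>I. \<Sum>y\<in>J. pmf (K x y) t * f x y t)"
  shows "(\<Sum>x\<in>I. \<Sum>y\<in>J. measure_pmf.expectation (K x y) (g x y)) \<le> (\<Sum>x\<in>I. \<Sum>y\<in>J. measure_pmf.expectation (K x y) (f x y))"
proof -
  have "(\<Sum>x\<in>I. \<Sum>y\<in>J. measure_pmf.expectation (K x y) (g x y)) = (\<integral>t. (\<Sum>x\<in>I. \<Sum>y\<in>J. pmf (K x y) t * g x y t) \<partial>count_space UNIV)"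
    unfolding expectation_eq_count_space
    by (simp add: integrable_pmf_mult[OF assms(2)])
  also have "\<dots> \<le> (\<integral>t. (\<Sum>x\<in>I. \<Sum>y\<in>J. pmf (K x y) t * f x y t) \<partial>count_space UNIV)"
    using assms by (intro integral_mono) (auto intro!: Bochner_Integration.integrable_sum integrable_pmf_mult)
  also have "\<dots> = (\<Sum>x\<in>I. \<Sum>y\<in>J. measure_pmf.expectation (K x y) (f x y))"
    unfolding expectation_eq_count_space
    by (simp add: integrable_pmf_mult[OF assms(1)])
  finally show ?thesis .
qed

lemma sum_Pow_prod:
  fixes f :: "'a \<Rightarrow> bool \<Rightarrow> 'b::comm_semiring_1"
  assumes "finite A"
  shows "(\<Sum>S\<in>Pow A. \<Prod>i\<in>A. f i (i \<in> S)) = (\<Prod>i\<in>A. f i True + f i False)"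
proof -
  have "(\<Prod>i\<in>A. f i True + f i False) = (\<Sum>S\<in>Pow A. (\<Prod>i\<in>S. f i True) * (\<Prod>i\<in>A - S. f i False))"
    using assms by (rule prod_add)
  also have "\<dots> = (\<Sum>S\<in>Pow A. \<Prod>i\<in>A. f i (i \<in> S))"
  proof (rule sum.cong)
    fix S assume "S \<in> Pow A"
    then have "(\<Prod>i\<in>A. f i (i \<in> S)) = (\<Prod>i\<in>S. f i (i \<in> S)) * (\<Prod>i\<in>A - S. f i (i \<in> S))"
      using assms by (subst prod.subset_diff[of S A]) (auto simp: mult.commute)
    then show "(\<Prod>i\<in>S. f i True) * (\<Prod>i\<in>A - S. f i False) = (\<Prod>i\<in>A. f i (i \<in> S))"
      by simp
  qed simp
  finally show ?thesis ..
qed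

text \<open>If s has mean r, averaging the first bound leaves r^2/4 - r^2/8 = r^2/8: a bias r is
  rewarded quadratically, as by relative entropy up to a constant. The factor 1/4 keeps the
  logarithm bounded.\<close>

lemma ln_one_plus_quarter_ge:
  fixes r s :: real
  assumes "\<bar>r\<bar> \<le> 1" "\<bar>s\<bar> = 1"
  shows "ln (1 + r * s / 4) \<ge> r * s / 4 - r\<^sup>2 / 8" "\<bar>ln (1 + r * s / 4)\<bar> \<le> 1"
    "1 + r * s / 4 > 0"
proof -
  have rs: "\<bar>r * s\<bar> \<le> 1" using assms by (simp add: abs_mult)
  have s2: "s\<^sup>2 = 1" using assms(2) by (metis power2_abs one_power2)
  have "\<bar>ln (1 + r * s / 4) - r * s / 4\<bar> \<le> 2 * (r * s / 4)\<^sup>2"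
    using rs by (intro abs_ln_one_plus_x_minus_x_bound) auto
  moreover have "2 * (r * s / 4)\<^sup>2 = r\<^sup>2 / 8" by (simp add: power_mult_distrib power_divide s2)
  moreover have "r\<^sup>2 \<le> 1" using assms(1) by (simp add: abs_square_le_1)
  ultimately have "\<bar>ln (1 + r * s / 4) - r * s / 4\<bar> \<le> r\<^sup>2 / 8" "r\<^sup>2 \<le> 1" by simp_all
  then show "ln (1 + r * s / 4) \<ge> r * s / 4 - r\<^sup>2 / 8" "\<bar>ln (1 + r * s / 4)\<bar> \<le> 1"
    using rs by linarith+
  show "1 + r * s / 4 > 0" using rs by (simp add: abs_le_iff)
qed

section \<open>Indexing\<close>

text \<open>The tangent of ln at 8. With it, Bob's gain \<open>S2 / 8\<close> pays for the
  normalisation \<open>ln (1 + S2)\<close> of Alice's test function up to the constant 2.\<close>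

lemma ln_one_plus_le_eighth:
  assumes "(s::real) \<ge> 0" shows "ln (1 + s) \<le> s / 8 + 2"
proof -
  have "ln ((1 + s) / 8) \<le> (1 + s) / 8 - 1" using assms by (intro ln_le_minus_one) simp
  moreover have "ln ((1 + s) / 8) = ln (1 + s) - ln 8" using assms by (subst ln_div) auto
  ultimately have "ln (1 + s) \<le> s / 8 - 7 / 8 + ln 8" by (simp add: add_divide_distrib)
  moreover have "ln (8::real) = 3 * ln 2" using ln_realpow[of 2 3] by simp
  moreover have "ln (2::real) \<le> 25/36" by (rule ln2_le_25_over_36)
  ultimately show ?thesis by linarith
qed

text \<open>The chord of the concave function ln between 1 and 1 + N.\<close>

lemma scaled_ln_le_ln_one_plus:
  fixes N q :: real
  assumes "0 \<le> q" "q \<le> 1" "N \<ge> 0"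
  shows "q * ln (1 + N) \<le> ln (1 + N * q)"
proof -
  have "concave_on {0<..} (ln :: real \<Rightarrow> real)" by (rule ln_concave)
  from concave_onD[OF this, of "q" 1 "1 + N"] assms
  have "q * ln (1 + N) \<le> ln ((1 - q) *\<^sub>R 1 + q *\<^sub>R (1 + N))" by simp
  also have "(1 - q) *\<^sub>R 1 + q *\<^sub>R (1 + N) = 1 + N * q" by (simp add: algebra_simps)
  finally show ?thesis .
qed

text \<open>
  Here \<open>sg i S\<close> is \<open>1\<close> if the output on the given transcript is right for \<open>(i, S)\<close> and \<open>-1\<close> if not,
  and \<open>r i\<close> is its posterior mean. Bob reveals at least \<open>S2 / 8\<close>, and as few \<open>r i\<close> can be large,
  Alice has to reveal about \<open>ln N - ln S2\<close> for the output to be right on average.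
\<close>

lemma index_pointwise:
  fixes \<alpha> :: "nat \<Rightarrow> real" and \<beta> :: "nat set \<Rightarrow> real" and sg :: "nat \<Rightarrow> nat set \<Rightarrow> real" and N :: nat
  assumes nn: "\<And>i. 0 \<le> \<alpha> i" "\<And>S. 0 \<le> \<beta> S" and sg: "\<And>i S. \<bar>sg i S\<bar> = 1" and finJ: "finite J"
  defines "r \<equiv> \<lambda>i. (\<Sum>S\<in>J. \<beta> S * sg i S) / (\<Sum>S\<in>J. \<beta> S)"
  defines "S2 \<equiv> (\<Sum>i<N. (r i)\<^sup>2)"
  shows "(\<Sum>i<N. \<Sum>S\<in>J. \<alpha> i * \<beta> S * (ln (1 + real N) * (2/3 * sg i S - 1/9) - 2))
    \<le> (\<Sum>i<N. \<Sum>S\<in>J. \<alpha> i * \<beta> S * ((ln (1 + real N * (r i)\<^sup>2) - ln (1 + S2)) + (\<Sum>j<N. ln (1 + r j * sg j S / 4))))"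
proof -
  define b where "b = (\<Sum>S\<in>J. \<beta> S)"
  define a where "a = (\<Sum>i<N. \<alpha> i)"
  have b0: "b \<ge> 0" and a0: "a \<ge> 0" unfolding b_def a_def using nn by (auto intro: sum_nonneg)
  \<comment> \<open>For b = 0 all weights vanish, and \<open>r i\<close> is 0 because division by 0
    gives 0.\<close>
  have br: "(\<Sum>S\<in>J. \<beta> S * sg i S) = b * r i" for i
  proof (cases "b = 0")
    case True
    then have "\<forall>S\<in>J. \<beta> S = 0" unfolding b_def using nn finJ by (subst (asm) sum_nonneg_eq_0_iff) auto
    then show ?thesis using True by simp
  next
    case False
    then show ?thesis unfolding r_def b_def[symmetric] by simp
  qed
  have r1: "\<bar>r i\<bar> \<le> 1" for i
  proof -
    have "\<bar>\<Sum>S\<in>J. \<beta> S * sg i S\<bar> \<le> (\<Sum>S\<in>J. \<bar>\<beta> S * sg i S\<bar>)" by (rule sum_abs)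
    also have "\<dots> = b" unfolding b_def using nn sg by (simp add: abs_mult)
    finally show ?thesis unfolding r_def b_def[symmetric] using b0 by (simp add: abs_divide divide_le_eq)
  qed
  have S20: "S2 \<ge> 0" unfolding S2_def by (intro sum_nonneg) auto
  have psi: "(\<Sum>S\<in>J. \<beta> S * (\<Sum>j<N. ln (1 + r j * sg j S / 4))) \<ge> b * S2 / 8"
  proof -
    have "b * S2 / 8 = (\<Sum>j<N. b * ((r j)\<^sup>2 / 4 - (r j)\<^sup>2 / 8))"
      unfolding S2_def by (simp add: sum_distrib_left sum_divide_distrib algebra_simps)
    also have "\<dots> = (\<Sum>j<N. \<Sum>S\<in>J. \<beta> S * (r j * sg j S / 4 - (r j)\<^sup>2 / 8))"
    proof (rule sum.cong)
      fix j
      have "(\<Sum>S\<in>J. \<beta> S * (r j * sg j S / 4 - (r j)\<^sup>2 / 8)) = (r j / 4) * (\<Sum>S\<in>J. \<beta> S * sg j S) - b * ((r j)\<^sup>2 / 8)"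
        unfolding b_def by (simp add: sum_distrib_left sum_distrib_right sum_subtractf algebra_simps)
      also have "\<dots> = b * ((r j)\<^sup>2 / 4 - (r j)\<^sup>2 / 8)" unfolding br by (simp add: algebra_simps power2_eq_square)
      finally show "b * ((r j)\<^sup>2 / 4 - (r j)\<^sup>2 / 8) = (\<Sum>S\<in>J. \<beta> S * (r j * sg j S / 4 - (r j)\<^sup>2 / 8))" ..
    qed simp
    also have "\<dots> \<le> (\<Sum>j<N. \<Sum>S\<in>J. \<beta> S * ln (1 + r j * sg j S / 4))"
      using nn ln_one_plus_quarter_ge(1)[OF r1 sg] by (intro sum_mono mult_left_mono) auto
    also have "\<dots> = (\<Sum>S\<in>J. \<beta> S * (\<Sum>j<N. ln (1 + r j * sg j S / 4)))"
      by (subst sum.swap) (simp add: sum_distrib_left)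
    finally show ?thesis .
  qed
  define L where "L = ln (1 + real N)"
  have L0: "L \<ge> 0" unfolding L_def by simp
  have phi: "L * (2/3 * r i - 1/9) \<le> ln (1 + real N * (r i)\<^sup>2)" for i
  proof -
    \<comment> \<open>The tangent of the square at 1/3, the least mean sign at error 1/3. Being
      linear in \<open>r i\<close>, it can be averaged over S, which turns it into a success
      probability.\<close>
    have "0 \<le> (r i - 1/3)\<^sup>2" by simp
    then have "2/3 * r i - 1/9 \<le> (r i)\<^sup>2" by (simp add: power2_eq_square algebra_simps)
    then have "L * (2/3 * r i - 1/9) \<le> L * (r i)\<^sup>2" using L0 by (intro mult_left_mono) auto
    also have "\<dots> \<le> ln (1 + real N * (r i)\<^sup>2)"
      unfolding L_def using scaled_ln_le_ln_one_plus[of "(r i)\<^sup>2" "real N"] r1[of i]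
      by (simp add: abs_square_le_1 mult.commute)
    finally show ?thesis .
  qed
  have "(\<Sum>i<N. \<Sum>S\<in>J. \<alpha> i * \<beta> S * (L * (2/3 * sg i S - 1/9) - 2))
     = (\<Sum>i<N. \<alpha> i * (L * 2/3 * (\<Sum>S\<in>J. \<beta> S * sg i S) - (L / 9 + 2) * b))"
  proof (rule sum.cong)
    fix i
    have "(\<Sum>S\<in>J. \<alpha> i * \<beta> S * (L * (2/3 * sg i S - 1/9) - 2))
      = (\<Sum>S\<in>J. (\<alpha> i * (L * 2/3)) * (\<beta> S * sg i S) - (\<alpha> i * (L / 9 + 2)) * \<beta> S)"
      by (intro sum.cong) (simp_all add: algebra_simps)
    also have "\<dots> = \<alpha> i * (L * 2/3) * (\<Sum>S\<in>J. \<beta> S * sg i S) - (\<alpha> i * (L / 9 + 2)) * b"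
      unfolding b_def by (simp only: sum_subtractf sum_distrib_left)
    finally show "(\<Sum>S\<in>J. \<alpha> i * \<beta> S * (L * (2/3 * sg i S - 1/9) - 2)) = \<alpha> i * (L * 2/3 * (\<Sum>S\<in>J. \<beta> S * sg i S) - (L / 9 + 2) * b)"
      by (simp add: algebra_simps)
  qed simp
  also have "\<dots> = (\<Sum>i<N. \<alpha> i * b * (L * (2/3 * r i - 1/9))) - 2 * a * b"
    unfolding br a_def by (simp add: sum_distrib_left sum_distrib_right sum_subtractf sum.distrib algebra_simps)
  also have "\<dots> \<le> (\<Sum>i<N. \<alpha> i * b * ln (1 + real N * (r i)\<^sup>2)) - a * b * (ln (1 + S2) - S2 / 8)"
  proof (rule diff_mono)
    show "(\<Sum>i<N. \<alpha> i * b * (L * (2/3 * r i - 1/9))) \<le> (\<Sum>i<N. \<alpha> i * b * ln (1 + real N * (r i)\<^sup>2))"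
      using nn b0 phi by (intro sum_mono mult_left_mono) auto
    have "a * b * (ln (1 + S2) - S2 / 8) \<le> a * b * 2"
      using ln_one_plus_le_eighth[OF S20] a0 b0 by (intro mult_left_mono) auto
    then show "a * b * (ln (1 + S2) - S2 / 8) \<le> 2 * a * b" by simp
  qed
  also have "\<dots> = (\<Sum>i<N. \<alpha> i * b * (ln (1 + real N * (r i)\<^sup>2) - ln (1 + S2))) + a * (b * S2 / 8)"
    unfolding a_def by (simp add: sum_distrib_left sum_distrib_right sum_subtractf sum.distrib algebra_simps)
  also have "\<dots> \<le> (\<Sum>i<N. \<alpha> i * b * (ln (1 + real N * (r i)\<^sup>2) - ln (1 + S2))) + a * (\<Sum>S\<in>J. \<beta> S * (\<Sum>j<N. ln (1 + r j * sg j S / 4)))"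
    using psi a0 by (intro add_left_mono mult_left_mono) auto
  also have "\<dots> = (\<Sum>i<N. \<Sum>S\<in>J. \<alpha> i * \<beta> S * ((ln (1 + real N * (r i)\<^sup>2) - ln (1 + S2)) + (\<Sum>j<N. ln (1 + r j * sg j S / 4))))"
  proof -
    have "(\<Sum>i<N. \<Sum>S\<in>J. \<alpha> i * \<beta> S * (u i + v S)) = (\<Sum>i<N. \<alpha> i * b * u i) + a * (\<Sum>S\<in>J. \<beta> S * v S)" for u :: "nat \<Rightarrow> real" and v :: "nat set \<Rightarrow> real"
    proof -
      have "(\<Sum>S\<in>J. \<alpha> i * \<beta> S * (u i + v S)) = \<alpha> i * b * u i + \<alpha> i * (\<Sum>S\<in>J. \<beta> S * v S)" for i
        unfolding b_def by (simp add: ring_distribs sum.distrib sum_distrib_left sum_distrib_right mult_ac)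
      then show ?thesis unfolding a_def by (simp add: sum.distrib sum_distrib_right)
    qed
    then show ?thesis by simp
  qed
  finally show ?thesis unfolding L_def .
qed

text \<open>\<open>exp (\<phi> i t) / N\<close> is a guess at i: the uniform law and the law
  proportional to \<open>(r t i)\<^sup>2\<close>, mixed with weights in the ratio 1 to
  \<open>S2 t\<close>. \<open>exp (\<psi> S t) / 2 ^ N\<close> guesses S coordinatewise, with bias
  \<open>r t j / 4\<close> towards agreement with the output.\<close>

lemma product_cost_index:
  fixes K :: "nat \<Rightarrow> nat set \<Rightarrow> 't pmf"
  assumes rect: "rectangular K" and N: "N \<ge> 1"
    and correct: "\<And>i S. i < N \<Longrightarrow> S \<subseteq> {..<N} \<Longrightarrow> measure_pmf.prob (K i S) {t. out t = (i \<in> S)} \<ge> 2/3"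
  shows "product_cost_at_least K {..<N} (Pow {..<N}) (ln (1 + real N) / 9 - 2)"
proof -
  obtain \<alpha> \<beta> where nn: "\<And>i t. 0 \<le> (\<alpha> i t :: real)" "\<And>S t. 0 \<le> (\<beta> S t :: real)"
    and eq: "\<And>i S t. pmf (K i S) t = \<alpha> i t * \<beta> S t"
    using rect unfolding rectangular_def by blast
  define J where "J = Pow {..<N}"
  have finJ: "finite J" by (simp add: J_def)
  define sg :: "'t \<Rightarrow> nat \<Rightarrow> nat set \<Rightarrow> real" where "sg = (\<lambda>t i S. if out t = (i \<in> S) then 1 else - 1)"
  have sg1: "\<bar>sg t i S\<bar> = 1" for t i S by (simp add: sg_def)
  define r where "r = (\<lambda>t i. (\<Sum>S\<in>J. \<beta> S t * sg t i S) / (\<Sum>S\<in>J. \<beta> S t))"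
  define S2 where "S2 = (\<lambda>t. \<Sum>i<N. (r t i)\<^sup>2)"
  define \<phi> where "\<phi> = (\<lambda>i t. ln (1 + real N * (r t i)\<^sup>2) - ln (1 + S2 t))"
  define \<psi> where "\<psi> = (\<lambda>S t. \<Sum>j<N. ln (1 + r t j * sg t j S / 4))"
  define L where "L = ln (1 + real N)"
  have L0: "L \<ge> 0" unfolding L_def by simp
  have r1: "\<bar>r t i\<bar> \<le> 1" for t i
  proof -
    have "\<bar>\<Sum>S\<in>J. \<beta> S t * sg t i S\<bar> \<le> (\<Sum>S\<in>J. \<bar>\<beta> S t * sg t i S\<bar>)" by (rule sum_abs)
    also have "\<dots> = (\<Sum>S\<in>J. \<beta> S t)" using nn by (simp add: abs_mult sg1)
    finally show ?thesis unfolding r_def by (simp add: abs_divide divide_le_eq sum_nonneg nn)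
  qed
  have r2: "(r t i)\<^sup>2 \<le> 1" for t i using r1 by (simp add: abs_square_le_1)
  have S20: "0 \<le> S2 t" "S2 t \<le> N" for t
    unfolding S2_def using sum_bounded_above[of "{..<N}" "\<lambda>i. (r t i)\<^sup>2" 1] r2 by (auto intro: sum_nonneg)
  have \<phi>b: "\<bar>\<phi> i t\<bar> \<le> L" for i t
  proof -
    have "ln (1 + real N * (r t i)\<^sup>2) \<le> L" "ln (1 + S2 t) \<le> L"
      unfolding L_def using S20[of t] r2[of t i] by (auto simp: mult_left_le add_pos_nonneg)
    moreover have "0 \<le> ln (1 + real N * (r t i)\<^sup>2)" "0 \<le> ln (1 + S2 t)"
      using S20[of t] by auto
    ultimately show ?thesis unfolding \<phi>_def by linarith
  qed
  have \<psi>b: "\<bar>\<psi> S t\<bar> \<le> N" for S t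
  proof -
    have "\<bar>\<psi> S t\<bar> \<le> (\<Sum>j<N. \<bar>ln (1 + r t j * sg t j S / 4)\<bar>)" unfolding \<psi>_def by (rule sum_abs)
    also have "\<dots> \<le> (\<Sum>j<N. 1)" using ln_one_plus_quarter_ge(2)[OF r1 sg1] by (intro sum_mono) auto
    finally show ?thesis by simp
  qed
  have \<phi>s: "(\<Sum>i<N. exp (\<phi> i t)) \<le> card {..<N}" for t
  proof -
    have "exp (\<phi> i t) = (1 + real N * (r t i)\<^sup>2) / (1 + S2 t)" for i
      unfolding \<phi>_def exp_diff using S20[of t] by (simp add: add_pos_nonneg)
    then have "(\<Sum>i<N. exp (\<phi> i t)) = (\<Sum>i<N. (1 + real N * (r t i)\<^sup>2) / (1 + S2 t))" by simp
    also have "\<dots> = (\<Sum>i<N. 1 + real N * (r t i)\<^sup>2) / (1 + S2 t)"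
      by (rule sum_divide_distrib[symmetric])
    also have "(\<Sum>i<N. 1 + real N * (r t i)\<^sup>2) = real N * (1 + S2 t)"
      unfolding S2_def by (simp add: sum.distrib sum_distrib_left algebra_simps)
    finally show ?thesis using S20[of t] by simp
  qed
  have \<psi>s: "(\<Sum>S\<in>Pow {..<N}. exp (\<psi> S t)) \<le> card (Pow {..<N})" for t
  proof -
    define F where "F = (\<lambda>j b. 1 + r t j * (if out t = b then 1 else -1) / 4)"
    have "exp (\<psi> S t) = (\<Prod>j<N. F j (j \<in> S))" for S
      unfolding \<psi>_def F_def using ln_one_plus_quarter_ge(3)[OF r1 sg1]
      by (simp add: exp_sum sg_def)
    then have "(\<Sum>S\<in>Pow {..<N}. exp (\<psi> S t)) = (\<Prod>j<N. F j True + F j False)"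
      by (simp only: sum_Pow_prod[OF finite_lessThan])
    also have "\<dots> = (\<Prod>j<N. 2)" by (intro prod.cong) (auto simp: F_def)
    finally show ?thesis by (simp add: card_Pow)
  qed
  have sgE: "measure_pmf.expectation (K i S) (\<lambda>t. sg t i S) \<ge> 1/3" if "i < N" "S \<in> J" for i S
  proof -
    have "(\<lambda>t. sg t i S) = (\<lambda>t. - 1 + 2 * indicator {t. out t = (i \<in> S)} t)" by (auto simp: sg_def)
    then have "measure_pmf.expectation (K i S) (\<lambda>t. sg t i S) = - 1 + 2 * measure_pmf.prob (K i S) {t. out t = (i \<in> S)}"
      by (simp only: expectation_affine_indicator)
    then show ?thesis using correct[of i S] that by (simp add: J_def)
  qed
  have intsg: "integrable (measure_pmf (K i S)) (\<lambda>t. sg t i S)" for i S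
    by (intro measure_pmf.integrable_const_bound[where B=1]) (auto simp: sg1)
  \<comment> \<open>At mean sign 1/3 the linear target has the value 2/9 - 1/9 = 1/9 per unit of
    L.\<close>
  have "(L / 9 - 2) * (card {..<N} * card J) = (\<Sum>i<N. \<Sum>S\<in>J. L * (2/3 * (1/3) - 1/9) - 2)"
    by simp
  also have "\<dots> \<le> (\<Sum>i<N. \<Sum>S\<in>J. L * (2/3 * measure_pmf.expectation (K i S) (\<lambda>t. sg t i S) - 1/9) - 2)"
    using sgE L0 by (intro sum_mono diff_right_mono mult_left_mono) auto
  also have "\<dots> = (\<Sum>i<N. \<Sum>S\<in>J. measure_pmf.expectation (K i S) (\<lambda>t. L * (2/3 * sg t i S - 1/9) - 2))"
    using intsg by (intro sum.cong refl) simp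
  also have "\<dots> \<le> (\<Sum>i<N. \<Sum>S\<in>J. measure_pmf.expectation (K i S) (\<lambda>t. \<phi> i t + \<psi> S t))"
  proof (rule sum_expectation_mono)
    show "\<bar>\<phi> i t + \<psi> S t\<bar> \<le> L + N" for i S t using \<phi>b[of i t] \<psi>b[of S t] by linarith
    show "\<bar>L * (2/3 * sg t i S - 1/9) - 2\<bar> \<le> L + 2" for i S t
    proof -
      have "\<bar>2/3 * sg t i S - 1/9\<bar> \<le> 1" using sg1[of t i S] by linarith
      then have "\<bar>L * (2/3 * sg t i S - 1/9)\<bar> \<le> L" using L0 by (simp add: abs_mult mult_left_le)
      then show ?thesis by linarith
    qed
    show "(\<Sum>i<N. \<Sum>S\<in>J. pmf (K i S) t * (L * (2/3 * sg t i S - 1/9) - 2)) \<le> (\<Sum>i<N. \<Sum>S\<in>J. pmf (K i S) t * (\<phi> i t + \<psi> S t))" for t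
      unfolding eq \<phi>_def \<psi>_def S2_def r_def L_def
      by (rule index_pointwise) (use nn sg1 finJ in auto)
  qed
  finally have le: "(L / 9 - 2) * (card {..<N} * card J) \<le> (\<Sum>i<N. \<Sum>S\<in>J. measure_pmf.expectation (K i S) (\<lambda>t. \<phi> i t + \<psi> S t))" .
  show ?thesis unfolding product_cost_at_least_def
  proof (intro conjI exI[where x=\<phi>] exI[where x=\<psi>] exI[where x="L + N"] allI)
    show "\<bar>\<phi> i t\<bar> \<le> L + N" for i t using \<phi>b[of i t] by linarith
    show "\<bar>\<psi> i t\<bar> \<le> L + N" for i t using \<psi>b[of i t] L0 by linarith
  qed (use \<phi>s \<psi>s le N in \<open>auto simp: J_def L_def lessThan_empty_iff\<close>)
qed

section \<open>Disjointness\<close>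

lemma sum_Pow_insert:
  fixes F :: "'a set \<Rightarrow> 'b::comm_monoid_add"
  assumes "finite A" "i \<in> A"
  shows "(\<Sum>d\<in>Pow A. F d) = (\<Sum>d\<in>Pow (A - {i}). F d + F (insert i d))"
proof -
  have P: "Pow A = Pow (A - {i}) \<union> insert i ` Pow (A - {i})"
    using Pow_insert[of i "A - {i}"] assms(2) by (simp add: insert_absorb)
  have "(\<Sum>d\<in>Pow A. F d) = (\<Sum>d\<in>Pow (A - {i}). F d) + (\<Sum>d\<in>insert i ` Pow (A - {i}). F d)"
    unfolding P by (rule sum.union_disjoint) (use assms in auto)
  also have "(\<Sum>d\<in>insert i ` Pow (A - {i}). F d) = (\<Sum>d\<in>Pow (A - {i}). F (insert i d))"
    by (subst sum.reindex) (auto simp: inj_on_def)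
  finally show ?thesis by (simp add: sum.distrib)
qed

text \<open>The pointwise form of the cut-and-paste property: with \<open>P u v = a u * b v\<close>, the pairs
  \<open>(P 1 0, P 0 1)\<close> and \<open>(P 0 0, P 1 1)\<close> have the same geometric mean.\<close>

lemma cut_and_paste:
  fixes a0 a1 b0 b1 l :: real
  assumes nn: "0 \<le> a0" "0 \<le> a1" "0 \<le> b0" "0 \<le> b1" and l: "l > 0"
  shows "(a1 * b0 - a0 * b0)\<^sup>2 / (a1 * b0 + a0 * b0) + (a0 * b1 - a0 * b0)\<^sup>2 / (a0 * b1 + a0 * b0)
     \<ge> (a1 * b0 + a0 * b1) / 2 - (l * (a0 * b0) + a1 * b1 / l) / 2"
proof -
  \<comment> \<open>Since p + q is at most (sqrt p + sqrt q)^2, the quotient dominates the squared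
    Hellinger term.\<close>
  have hel: "(p - q)\<^sup>2 / (p + q) \<ge> (sqrt p - sqrt q)\<^sup>2" if "0 \<le> p" "0 \<le> q" for p q :: real
  proof (cases "p + q = 0")
    case True
    then have "p = 0" "q = 0" using that by auto
    then show ?thesis by simp
  next
    case False
    then have pos: "p + q > 0" using that by simp
    have "(p - q)\<^sup>2 = (sqrt p - sqrt q)\<^sup>2 * (sqrt p + sqrt q)\<^sup>2"
      using that by (simp add: power_mult_distrib[symmetric] algebra_simps)
    moreover have "(sqrt p + sqrt q)\<^sup>2 \<ge> p + q"
      using that by (simp add: power2_sum)
    then have "(sqrt p - sqrt q)\<^sup>2 * (p + q) \<le> (sqrt p - sqrt q)\<^sup>2 * (sqrt p + sqrt q)\<^sup>2"
      by (intro mult_left_mono) auto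
    ultimately show ?thesis using pos by (simp add: le_divide_eq)
  qed
  define u where "u = sqrt (a1 * b0)"
  define v where "v = sqrt (a0 * b1)"
  define w where "w = sqrt (a0 * b0)"
  \<comment> \<open>The triangle inequality for the Hellinger distance through the cell (0,0), in
    squared form.\<close>
  have "(u - w)\<^sup>2 + (v - w)\<^sup>2 \<ge> (u - v)\<^sup>2 / 2"
  proof -
    have "(u - w)\<^sup>2 + (v - w)\<^sup>2 - (u - v)\<^sup>2 / 2 = (u + v - 2 * w)\<^sup>2 / 2"
      by (simp add: power2_eq_square field_simps)
    moreover have "(u + v - 2 * w)\<^sup>2 / 2 \<ge> 0" by simp
    ultimately show ?thesis by linarith
  qed
  moreover have "(u - v)\<^sup>2 / 2 = (a1 * b0 + a0 * b1) / 2 - u * v"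
    unfolding power2_diff u_def v_def using nn by (simp add: field_simps)
  \<comment> \<open>The cut and paste itself: u * v is the geometric mean of the cells (0,0) and
    (1,1). The weighted arithmetic mean makes the bound linear in the two probabilities, so that it
    can be integrated, with l chosen for each transcript.\<close>
  moreover have "u * v \<le> (l * (a0 * b0) + a1 * b1 / l) / 2"
  proof -
    have "u * v = sqrt ((l * (a0 * b0)) * (a1 * b1 / l))"
      unfolding u_def v_def real_sqrt_mult[symmetric] using l by (simp add: mult_ac)
    also have "\<dots> \<le> (l * (a0 * b0) + a1 * b1 / l) / 2"
      using nn l by (intro arith_geo_mean_sqrt) auto
    finally show ?thesis .
  qed
  moreover have "(a1 * b0 - a0 * b0)\<^sup>2 / (a1 * b0 + a0 * b0) \<ge> (u - w)\<^sup>2"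
     "(a0 * b1 - a0 * b0)\<^sup>2 / (a0 * b1 + a0 * b0) \<ge> (v - w)\<^sup>2"
    unfolding u_def v_def w_def using nn by (auto intro!: hel)
  ultimately show ?thesis by linarith
qed

definition chi :: "nat \<Rightarrow> nat set \<Rightarrow> real" where "chi i Z = (if i \<in> Z then 1 else - 1)"

lemma abs_chi [simp]: "\<bar>chi i Z\<bar> = 1" by (simp add: chi_def)

text \<open>For one transcript, w is the unnormalised posterior of (X, Y) and \<open>r i\<close> the
  posterior bias of coordinate i of their union. The gain \<open>(r i)\<^sup>2 / 8\<close>,
  multiplied by the total weight W, becomes the square of W * r i over 8 * W, the form that
  \<open>cut_and_paste\<close> bounds from below.\<close>

lemma chi_pointwise:
  fixes w :: "nat set \<Rightarrow> nat set \<Rightarrow> real"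
  assumes nn: "\<And>X Y. 0 \<le> w X Y" and fin: "finite I" "finite J"
  defines "W \<equiv> (\<Sum>X\<in>I. \<Sum>Y\<in>J. w X Y)"
  defines "r \<equiv> \<lambda>i. (\<Sum>X\<in>I. \<Sum>Y\<in>J. w X Y * chi i (X \<union> Y)) / W"
  shows "(\<Sum>X\<in>I. \<Sum>Y\<in>J. w X Y * (\<Sum>i\<in>A. ln (1 + r i * chi i (X \<union> Y) / 4))) \<ge>
     (\<Sum>i\<in>A. (\<Sum>X\<in>I. \<Sum>Y\<in>J. w X Y * chi i (X \<union> Y))\<^sup>2 / W) / 8"
    and "\<bar>r i\<bar> \<le> 1"
proof -
  define w' where "w' = (\<lambda>z. w (fst z) (snd z))"
  define c where "c = (\<lambda>i (z :: nat set \<times> nat set). chi i (fst z \<union> snd z))"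
  have W: "W = (\<Sum>z\<in>I \<times> J. w' z)" unfolding W_def w'_def sum.cartesian_product by (simp add: case_prod_unfold)
  have R: "(\<Sum>X\<in>I. \<Sum>Y\<in>J. w X Y * chi i (X \<union> Y)) = (\<Sum>z\<in>I \<times> J. w' z * c i z)" for i
    unfolding w'_def c_def sum.cartesian_product by (simp add: case_prod_unfold)
  have w'nn: "0 \<le> w' z" for z by (simp add: w'_def nn)
  have W0: "W \<ge> 0" unfolding W using w'nn by (intro sum_nonneg) auto
  have c1: "\<bar>c i z\<bar> = 1" for i z by (simp add: c_def)
  show r1: "\<bar>r i\<bar> \<le> 1" for i
  proof -
    have "\<bar>\<Sum>z\<in>I \<times> J. w' z * c i z\<bar> \<le> (\<Sum>z\<in>I \<times> J. \<bar>w' z * c i z\<bar>)" by (rule sum_abs)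
    also have "\<dots> = W" unfolding W using w'nn c1 by (simp add: abs_mult)
    finally show ?thesis unfolding r_def R using W0 by (simp add: abs_divide divide_le_eq)
  qed
  have Rr: "(\<Sum>z\<in>I \<times> J. w' z * c i z) = W * r i" for i
  proof (cases "W = 0")
    case True
    then have "\<forall>z\<in>I \<times> J. w' z = 0" unfolding W using w'nn fin by (subst (asm) sum_nonneg_eq_0_iff) auto
    then have "(\<Sum>z\<in>I \<times> J. w' z * c i z) = (\<Sum>z\<in>I \<times> J. 0)" by (intro sum.cong) auto
    then show ?thesis using True by simp
  next
    case False
    then show ?thesis unfolding r_def R by simp
  qed
  have "(\<Sum>i\<in>A. (\<Sum>z\<in>I \<times> J. w' z * c i z)\<^sup>2 / W) / 8 = (\<Sum>i\<in>A. W * (r i)\<^sup>2 / 8)"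
    unfolding Rr sum_divide_distrib by (intro sum.cong) (simp_all add: power_mult_distrib power2_eq_square)
  also have "\<dots> = (\<Sum>i\<in>A. \<Sum>z\<in>I \<times> J. w' z * (r i * c i z / 4 - (r i)\<^sup>2 / 8))"
  proof (rule sum.cong)
    fix i
    have "(\<Sum>z\<in>I \<times> J. w' z * (r i * c i z / 4 - (r i)\<^sup>2 / 8)) = (\<Sum>z\<in>I \<times> J. (r i / 4) * (w' z * c i z) - ((r i)\<^sup>2 / 8) * w' z)"
      by (intro sum.cong) (simp_all add: algebra_simps)
    also have "\<dots> = (r i / 4) * (W * r i) - ((r i)\<^sup>2 / 8) * W"
      unfolding sum_subtractf sum_distrib_left[symmetric] Rr W ..
    finally show "W * (r i)\<^sup>2 / 8 = (\<Sum>z\<in>I \<times> J. w' z * (r i * c i z / 4 - (r i)\<^sup>2 / 8))"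
      by (simp add: power2_eq_square)
  qed simp
  also have "\<dots> \<le> (\<Sum>i\<in>A. \<Sum>z\<in>I \<times> J. w' z * ln (1 + r i * c i z / 4))"
    using w'nn ln_one_plus_quarter_ge(1)[OF r1 c1] by (intro sum_mono mult_left_mono) auto
  also have "\<dots> = (\<Sum>z\<in>I \<times> J. w' z * (\<Sum>i\<in>A. ln (1 + r i * c i z / 4)))"
    by (subst sum.swap) (simp add: sum_distrib_left)
  also have "\<dots> = (\<Sum>X\<in>I. \<Sum>Y\<in>J. w X Y * (\<Sum>i\<in>A. ln (1 + r i * chi i (X \<union> Y) / 4)))"
    unfolding w'_def c_def sum.cartesian_product by (simp add: case_prod_unfold)
  finally show "(\<Sum>X\<in>I. \<Sum>Y\<in>J. w X Y * (\<Sum>i\<in>A. ln (1 + r i * chi i (X \<union> Y) / 4))) \<ge>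
     (\<Sum>i\<in>A. (\<Sum>X\<in>I. \<Sum>Y\<in>J. w X Y * chi i (X \<union> Y))\<^sup>2 / W) / 8"
    unfolding R .
qed

text \<open>
  Coordinates in \<open>d\<close> are held by Alice, the others by Bob, and the other player has a \<open>0\<close> there. The
  information about coordinate \<open>i\<close>, added over the two owners of \<open>i\<close>, controls the Hellinger distance of
  the transcripts on \<open>(0,0)\<close> and \<open>(1,1)\<close> at \<open>i\<close>; averaging over \<open>d\<close> gives a good \<open>d\<close>. The factor
  \<open>l\<close>, close to \<open>1 / sqrt 2\<close> or its inverse, is tuned to an error of \<open>1/3\<close>.
\<close>

lemma product_cost_disjointness:
  fixes K :: "nat set \<Rightarrow> nat set \<Rightarrow> 't pmf"
  assumes rect: "rectangular K" and k: "k \<ge> 1"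
    and disj: "\<And>X Y. X \<subseteq> {..<k} \<Longrightarrow> Y \<subseteq> {..<k} \<Longrightarrow> X \<inter> Y = {} \<Longrightarrow> measure_pmf.prob (K X Y) {t. out t} \<ge> 2/3"
    and inter: "\<And>X Y i. X \<subseteq> {..<k} \<Longrightarrow> Y \<subseteq> {..<k} \<Longrightarrow> X \<inter> Y = {i} \<Longrightarrow> measure_pmf.prob (K X Y) {t. \<not> out t} \<ge> 2/3"
  shows "\<exists>d\<subseteq>{..<k}. product_cost_at_least K (Pow d) (Pow ({..<k} - d)) (real k / 560)"
proof -
  define U where "U = {..<k}"
  have finU: "finite U" by (simp add: U_def)
  obtain \<alpha> \<beta> where nn: "\<And>X t. 0 \<le> (\<alpha> X t :: real)" "\<And>Y t. 0 \<le> (\<beta> Y t :: real)"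
    and eq: "\<And>X Y t. pmf (K X Y) t = \<alpha> X t * \<beta> Y t"
    using rect unfolding rectangular_def by blast
  define W where "W = (\<lambda>d t. \<Sum>X\<in>Pow d. \<Sum>Y\<in>Pow (U - d). pmf (K X Y) t)"
  define R where "R = (\<lambda>d t i. \<Sum>X\<in>Pow d. \<Sum>Y\<in>Pow (U - d). pmf (K X Y) t * chi i (X \<union> Y))"
  define r where "r = (\<lambda>d t i. R d t i / W d t)"
  define \<phi> where "\<phi> = (\<lambda>d X t. \<Sum>i\<in>d. ln (1 + r d t i * chi i X / 4))"
  define \<psi> where "\<psi> = (\<lambda>d Y t. \<Sum>i\<in>U - d. ln (1 + r d t i * chi i Y / 4))"
  define E where "E = (\<lambda>d. \<Sum>X\<in>Pow d. \<Sum>Y\<in>Pow (U - d). measure_pmf.expectation (K X Y) (\<lambda>t. \<phi> d X t + \<psi> d Y t))"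
  define l :: "'t \<Rightarrow> real" where "l = (\<lambda>t. if out t then 5/7 else 7/5)"
  define g where "g = (\<lambda>i X Y t. pmf (K (insert i X) Y) t / 2 + pmf (K X (insert i Y)) t / 2
      - (pmf (K X Y) t * l t + pmf (K (insert i X) (insert i Y)) t * (1 / l t)) / 2)"
  have fin: "finite d" if "d \<subseteq> U" for d using that finU finite_subset by blast
  have r1: "\<bar>r d t i\<bar> \<le> 1" if "d \<subseteq> U" for d t i
    using chi_pointwise(2)[of "\<lambda>X Y. pmf (K X Y) t" "Pow d" "Pow (U - d)" i] that fin finU
    unfolding r_def R_def W_def by simp
  have sb: "\<bar>\<Sum>i\<in>A. ln (1 + r d t i * chi i Z / 4)\<bar> \<le> k" if "d \<subseteq> U" "A \<subseteq> U" for d t A Z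
  proof -
    have "\<bar>\<Sum>i\<in>A. ln (1 + r d t i * chi i Z / 4)\<bar> \<le> (\<Sum>i\<in>A. \<bar>ln (1 + r d t i * chi i Z / 4)\<bar>)" by (rule sum_abs)
    also have "\<dots> \<le> (\<Sum>i\<in>A. 1)" using ln_one_plus_quarter_ge(2)[OF r1[OF that(1)] abs_chi] by (intro sum_mono) auto
    also have "\<dots> \<le> k" using card_mono[OF finU that(2)] by (simp add: U_def)
    finally show ?thesis .
  qed
  have \<phi>b: "\<bar>\<phi> d X t\<bar> \<le> k" and \<psi>b: "\<bar>\<psi> d X t\<bar> \<le> k" if "d \<subseteq> U" for d X t
    unfolding \<phi>_def \<psi>_def using that by (auto intro!: sb)
  have \<phi>\<psi>: "\<phi> d X t + \<psi> d Y t = (\<Sum>i\<in>U. ln (1 + r d t i * chi i (X \<union> Y) / 4))" if "d \<subseteq> U" "X \<subseteq> d" "Y \<subseteq> U - d" for d X Y t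
  proof -
    have "\<phi> d X t = (\<Sum>i\<in>d. ln (1 + r d t i * chi i (X \<union> Y) / 4))"
      unfolding \<phi>_def using that by (intro sum.cong) (auto simp: chi_def)
    moreover have "\<psi> d Y t = (\<Sum>i\<in>U - d. ln (1 + r d t i * chi i (X \<union> Y) / 4))"
      unfolding \<psi>_def using that by (intro sum.cong) (auto simp: chi_def)
    ultimately show ?thesis using sum.subset_diff[OF that(1) finU, of "\<lambda>i. ln (1 + r d t i * chi i (X \<union> Y) / 4)"] by simp
  qed
  have exp_sum_le: "(\<Sum>Z\<in>Pow A. exp (\<Sum>i\<in>A. ln (1 + r d t i * chi i Z / 4))) = card (Pow A)" if "d \<subseteq> U" "A \<subseteq> U" for d t A
  proof -
    have finA: "finite A" using that fin by blast
    define F where "F = (\<lambda>j b. 1 + r d t j * (if b then 1 else -1) / 4)"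
    have "exp (\<Sum>i\<in>A. ln (1 + r d t i * chi i Z / 4)) = (\<Prod>j\<in>A. F j (j \<in> Z))" for Z
      unfolding F_def using ln_one_plus_quarter_ge(3)[OF r1[OF that(1)] abs_chi] finA
      by (simp add: exp_sum chi_def)
    then have "(\<Sum>Z\<in>Pow A. exp (\<Sum>i\<in>A. ln (1 + r d t i * chi i Z / 4))) = (\<Prod>j\<in>A. F j True + F j False)"
      by (simp only: sum_Pow_prod[OF finA])
    also have "\<dots> = (\<Prod>j\<in>A. 2)" by (intro prod.cong) (auto simp: F_def)
    finally show ?thesis using finA by (simp add: card_Pow)
  qed
  have pointwise: "(\<Sum>i\<in>U. \<Sum>d\<in>Pow (U - {i}). \<Sum>X\<in>Pow d. \<Sum>Y\<in>Pow (U - {i} - d). g i X Y t / 8) \<le>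
     (\<Sum>d\<in>Pow U. \<Sum>X\<in>Pow d. \<Sum>Y\<in>Pow (U - d). pmf (K X Y) t * (\<phi> d X t + \<psi> d Y t))" for t
  proof -
    \<comment> \<open>If Alice owns i (\<open>insert i d\<close>), the cells (0,0) and (1,0) occur
      at i; if Bob owns it (\<open>d\<close>), the cells (0,0) and (0,1). The cell (1,1) never
      occurs under these inputs and enters through the factorization alone.\<close>
    have step: "(\<Sum>X\<in>Pow d. \<Sum>Y\<in>Pow (U - {i} - d). g i X Y t) \<le> (R d t i)\<^sup>2 / W d t + (R (insert i d) t i)\<^sup>2 / W (insert i d) t"
      if i: "i \<in> U" and d: "d \<subseteq> U - {i}" for i d
    proof -
      define e where "e = U - {i} - d"
      have fd: "finite d" "finite e" using d finU fin unfolding e_def by auto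
      define a0 where "a0 = (\<Sum>X\<in>Pow d. \<alpha> X t)"
      define a1 where "a1 = (\<Sum>X\<in>Pow d. \<alpha> (insert i X) t)"
      define b0 where "b0 = (\<Sum>Y\<in>Pow e. \<beta> Y t)"
      define b1 where "b1 = (\<Sum>Y\<in>Pow e. \<beta> (insert i Y) t)"
      have nn': "0 \<le> a0" "0 \<le> a1" "0 \<le> b0" "0 \<le> b1"
        unfolding a0_def a1_def b0_def b1_def using nn by (auto intro: sum_nonneg)
      have U1: "U - insert i d = e" and U2: "U - d = insert i e" unfolding e_def using d i by auto
      have ni: "i \<notin> d" "i \<notin> e" using d by (auto simp: e_def)
      have pd: "(\<Sum>X\<in>Pow (insert i d). F X) = (\<Sum>X\<in>Pow d. F X + F (insert i X))" for F :: "nat set \<Rightarrow> real"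
        using sum_Pow_insert[of "insert i d" i F] fd ni by simp
      have pe: "(\<Sum>X\<in>Pow (insert i e). F X) = (\<Sum>X\<in>Pow e. F X + F (insert i X))" for F :: "nat set \<Rightarrow> real"
        using sum_Pow_insert[of "insert i e" i F] fd ni by simp
      have c0: "chi i (X \<union> Y) = -1" "chi i (insert i X \<union> Y) = 1" "chi i (X \<union> insert i Y) = 1"
        if "X \<in> Pow d" "Y \<in> Pow e" for X Y
        using that ni by (auto simp: chi_def)
      have W1: "W (insert i d) t = a1 * b0 + a0 * b0"
        unfolding W_def U1 pd eq a0_def a1_def b0_def
        by (simp add: sum.distrib sum_product ring_distribs)
      have W0: "W d t = a0 * b1 + a0 * b0"
        unfolding W_def U2 pe eq a0_def b1_def b0_def
        by (simp add: sum.distrib sum_product ring_distribs)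
      have "R (insert i d) t i = (\<Sum>X\<in>Pow d. (\<Sum>Y\<in>Pow e. \<alpha> X t * \<beta> Y t * (-1)) + (\<Sum>Y\<in>Pow e. \<alpha> (insert i X) t * \<beta> Y t * 1))"
        unfolding R_def U1 pd eq by (intro sum.cong arg_cong2[where f="(+)"]) (simp_all only: c0)
      then have R1: "R (insert i d) t i = a1 * b0 - a0 * b0"
        unfolding a0_def a1_def b0_def by (simp add: sum.distrib sum_product sum_negf sum_subtractf)
      have "R d t i = (\<Sum>X\<in>Pow d. \<Sum>Y\<in>Pow e. \<alpha> X t * \<beta> Y t * (-1) + \<alpha> X t * \<beta> (insert i Y) t * 1)"
        unfolding R_def U2 pe eq by (intro sum.cong arg_cong2[where f="(+)"]) (simp_all only: c0)
      then have R0: "R d t i = a0 * b1 - a0 * b0"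
        unfolding a0_def b1_def b0_def by (simp add: sum.distrib sum_product sum_negf sum_subtractf)
      have l0: "l t > 0" by (simp add: l_def)
      have "(\<Sum>X\<in>Pow d. \<Sum>Y\<in>Pow (U - {i} - d). g i X Y t) = (a1 * b0) / 2 + (a0 * b1) / 2 - (a0 * b0 * l t + a1 * b1 * (1 / l t)) / 2"
        unfolding g_def eq e_def[symmetric] a0_def a1_def b0_def b1_def sum_product
        by (simp only: sum.distrib sum_subtractf sum_divide_distrib[symmetric] sum_distrib_right[symmetric])
      also have "\<dots> \<le> (R d t i)\<^sup>2 / W d t + (R (insert i d) t i)\<^sup>2 / W (insert i d) t"
        unfolding W0 W1 R0 R1 using cut_and_paste[OF nn' l0] by (simp add: add_divide_distrib mult_ac)
      finally show ?thesis .
    qed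
    have "(\<Sum>i\<in>U. \<Sum>d\<in>Pow (U - {i}). \<Sum>X\<in>Pow d. \<Sum>Y\<in>Pow (U - {i} - d). g i X Y t / 8)
        = (\<Sum>i\<in>U. \<Sum>d\<in>Pow (U - {i}). (\<Sum>X\<in>Pow d. \<Sum>Y\<in>Pow (U - {i} - d). g i X Y t)) / 8"
      by (simp add: sum_divide_distrib)
    also have "\<dots> \<le> (\<Sum>i\<in>U. \<Sum>d\<in>Pow (U - {i}). (R d t i)\<^sup>2 / W d t + (R (insert i d) t i)\<^sup>2 / W (insert i d) t) / 8"
      using step by (intro divide_right_mono sum_mono) auto
    also have "\<dots> = (\<Sum>i\<in>U. \<Sum>d\<in>Pow U. (R d t i)\<^sup>2 / W d t) / 8"
      using sum_Pow_insert[OF finU, where F = "\<lambda>d. (R d t i)\<^sup>2 / W d t" for i] by simp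
    also have "\<dots> = (\<Sum>d\<in>Pow U. (\<Sum>i\<in>U. (R d t i)\<^sup>2 / W d t) / 8)"
      by (subst sum.swap) (simp add: sum_divide_distrib)
    also have "\<dots> \<le> (\<Sum>d\<in>Pow U. \<Sum>X\<in>Pow d. \<Sum>Y\<in>Pow (U - d). pmf (K X Y) t * (\<Sum>i\<in>U. ln (1 + r d t i * chi i (X \<union> Y) / 4)))"
    proof (rule sum_mono)
      fix d assume "d \<in> Pow U"
      then have "finite (Pow d)" "finite (Pow (U - d))" using fin finU by auto
      from chi_pointwise(1)[OF _ this, of "\<lambda>X Y. pmf (K X Y) t" U]
      show "(\<Sum>i\<in>U. (R d t i)\<^sup>2 / W d t) / 8 \<le> (\<Sum>X\<in>Pow d. \<Sum>Y\<in>Pow (U - d). pmf (K X Y) t * (\<Sum>i\<in>U. ln (1 + r d t i * chi i (X \<union> Y) / 4)))"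
        unfolding r_def R_def W_def by simp
    qed
    also have "\<dots> = (\<Sum>d\<in>Pow U. \<Sum>X\<in>Pow d. \<Sum>Y\<in>Pow (U - d). pmf (K X Y) t * (\<phi> d X t + \<psi> d Y t))"
      by (intro sum.cong refl arg_cong2[where f="(*)"] \<phi>\<psi>[symmetric]) auto
    finally show ?thesis .
  qed
  have lb: "\<bar>l t\<bar> \<le> 2" "\<bar>1 / l t\<bar> \<le> 2" for t by (auto simp: l_def)
  have il: "integrable (count_space UNIV) (\<lambda>t. pmf p t * l t)" "integrable (count_space UNIV) (\<lambda>t. pmf p t * (1 / l t))" for p
    by (rule integrable_pmf_mult, rule lb)+
  have int_g: "integrable (count_space UNIV) (g i X Y)" for i X Y
    unfolding g_def
    by (intro Bochner_Integration.integrable_diff Bochner_Integration.integrable_add integrable_divide integrable_pmf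
       il)
  \<comment> \<open>X and Y are disjoint and avoid i, so adding i to both creates a unique
    intersection. Error 1/3 bounds the average of l before, and of 1 / l after, by 7/5 - 24/35 * 2/3
    = 33/35.\<close>
  have gE: "2/35 \<le> (\<integral>t. g i X Y t \<partial>count_space UNIV)" if "i \<in> U" "d \<subseteq> U - {i}" "X \<subseteq> d" "Y \<subseteq> U - {i} - d" for i d X Y
  proof -
    have "(\<integral>t. g i X Y t \<partial>count_space UNIV) = 1/2 + 1/2 -
       (measure_pmf.expectation (K X Y) l + measure_pmf.expectation (K (insert i X) (insert i Y)) (\<lambda>t. 1 / l t)) / 2"
      unfolding g_def expectation_eq_count_space
      by (simp only: Bochner_Integration.integral_diff Bochner_Integration.integral_add integral_divide_zero integrable_divide
          Bochner_Integration.integrable_add integrable_pmf il) (simp add: integral_pmf)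
    moreover have "measure_pmf.expectation (K X Y) l \<le> 33/35"
    proof -
      have "l = (\<lambda>t. 7/5 + (- 24/35) * indicator {t. out t} t)" by (auto simp: l_def)
      then have "measure_pmf.expectation (K X Y) l = 7/5 + (- 24/35) * measure_pmf.prob (K X Y) {t. out t}"
        by (simp only: expectation_affine_indicator)
      moreover have "measure_pmf.prob (K X Y) {t. out t} \<ge> 2/3"
        using that by (intro disj) (auto simp: U_def)
      ultimately show ?thesis by linarith
    qed
    moreover have "measure_pmf.expectation (K (insert i X) (insert i Y)) (\<lambda>t. 1 / l t) \<le> 33/35"
    proof -
      have "(\<lambda>t. 1 / l t) = (\<lambda>t. 7/5 + (- 24/35) * indicator {t. \<not> out t} t)" by (auto simp: l_def)
      then have "measure_pmf.expectation (K (insert i X) (insert i Y)) (\<lambda>t. 1 / l t) = 7/5 + (- 24/35) * measure_pmf.prob (K (insert i X) (insert i Y)) {t. \<not> out t}"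
        by (simp only: expectation_affine_indicator)
      moreover have "measure_pmf.prob (K (insert i X) (insert i Y)) {t. \<not> out t} \<ge> 2/3"
        using that by (intro inter[of _ _ i]) (auto simp: U_def)
      ultimately show ?thesis by linarith
    qed
    moreover have "2/35 \<le> v" if "v = 1/2 + 1/2 - (a + b) / 2" "a \<le> 33/35" "b \<le> 33/35" for v a b :: real
      using that by (simp add: field_simps)
    ultimately show ?thesis by blast
  qed
  have E_eq: "E d = (\<integral>t. (\<Sum>X\<in>Pow d. \<Sum>Y\<in>Pow (U - d). pmf (K X Y) t * (\<phi> d X t + \<psi> d Y t)) \<partial>count_space UNIV)"
    and E_int: "integrable (count_space UNIV) (\<lambda>t. \<Sum>X\<in>Pow d. \<Sum>Y\<in>Pow (U - d). pmf (K X Y) t * (\<phi> d X t + \<psi> d Y t))"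
    if d: "d \<subseteq> U" for d
  proof -
    have b: "\<bar>\<phi> d X t + \<psi> d Y t\<bar> \<le> 2 * k" for X Y t
      using \<phi>b[OF d, of X t] \<psi>b[OF d, of Y t] by linarith
    show "E d = (\<integral>t. (\<Sum>X\<in>Pow d. \<Sum>Y\<in>Pow (U - d). pmf (K X Y) t * (\<phi> d X t + \<psi> d Y t)) \<partial>count_space UNIV)"
      unfolding E_def expectation_eq_count_space by (simp add: integrable_pmf_mult[OF b])
    show "integrable (count_space UNIV) (\<lambda>t. \<Sum>X\<in>Pow d. \<Sum>Y\<in>Pow (U - d). pmf (K X Y) t * (\<phi> d X t + \<psi> d Y t))"
      by (intro Bochner_Integration.integrable_sum integrable_pmf_mult[OF b])
  qed
  have cardsum: "(\<Sum>X\<in>Pow d. \<Sum>Y\<in>Pow (A - d). c) = c * 2 ^ card A" if "d \<subseteq> A" "A \<subseteq> U" for d A and c :: real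
  proof -
    have f: "finite A" "finite d" using that fin by blast+
    have "card d + card (A - d) = card A" using that f by (simp add: card_Diff_subset card_mono)
    then have "(2::real) ^ card A = 2 ^ card d * 2 ^ card (A - d)" by (metis power_add)
    then show ?thesis using f by (simp add: card_Pow)
  qed
  have cU: "card U = k" by (simp add: U_def)
  \<comment> \<open>The constant: 2/35 for each coordinate, 1/8 from the test functions, and 1/4
    because fixing coordinate i halves both the number of d and the number of pairs (X, Y) for each
    d.\<close>
  have "(\<Sum>d\<in>Pow U. real k / 560 * 2 ^ k) = (\<Sum>i\<in>U. \<Sum>d\<in>Pow (U - {i}). \<Sum>X\<in>Pow d. \<Sum>Y\<in>Pow (U - {i} - d). (2/35) / 8)"
  proof -
    have "(\<Sum>i\<in>U. \<Sum>d\<in>Pow (U - {i}). \<Sum>X\<in>Pow d. \<Sum>Y\<in>Pow (U - {i} - d). (2/35) / 8 :: real)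
      = (\<Sum>i\<in>U. \<Sum>d\<in>Pow (U - {i}). (2/35) / 8 * 2 ^ (k - 1))"
      using cardsum[of _ "U - {_}" "(2/35)/8"] finU cU by (intro sum.cong refl) (subst cardsum, auto)
    also have "\<dots> = real k * (2 ^ (k - 1) * ((2/35) / 8 * 2 ^ (k - 1)))"
      using finU cU by (simp add: card_Pow)
    also have "\<dots> = 2 ^ k * (real k / 560 * 2 ^ k)"
      using k power_Suc[of "2::real" "k - 1"] by (simp add: field_simps)
    finally show ?thesis using finU cU by (simp add: card_Pow)
  qed
  also have "\<dots> \<le> (\<Sum>i\<in>U. \<Sum>d\<in>Pow (U - {i}). \<Sum>X\<in>Pow d. \<Sum>Y\<in>Pow (U - {i} - d). (\<integral>t. g i X Y t \<partial>count_space UNIV) / 8)"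
    using gE by (intro sum_mono divide_right_mono) auto
  also have "\<dots> = (\<integral>t. (\<Sum>i\<in>U. \<Sum>d\<in>Pow (U - {i}). \<Sum>X\<in>Pow d. \<Sum>Y\<in>Pow (U - {i} - d). g i X Y t / 8) \<partial>count_space UNIV)"
    by (simp add: int_g)
  also have "\<dots> \<le> (\<integral>t. (\<Sum>d\<in>Pow U. \<Sum>X\<in>Pow d. \<Sum>Y\<in>Pow (U - d). pmf (K X Y) t * (\<phi> d X t + \<psi> d Y t)) \<partial>count_space UNIV)"
    by (intro integral_mono pointwise Bochner_Integration.integrable_sum integrable_divide int_g E_int) auto
  also have "\<dots> = (\<Sum>d\<in>Pow U. E d)"
    using E_int by (subst Bochner_Integration.integral_sum) (auto simp: E_eq)
  finally have tot: "(\<Sum>d\<in>Pow U. real k / 560 * 2 ^ k) \<le> (\<Sum>d\<in>Pow U. E d)" .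
  have "\<exists>d\<in>Pow U. real k / 560 * 2 ^ k \<le> E d"
  proof (rule ccontr)
    assume "\<not> ?thesis"
    then have lt: "E d < real k / 560 * 2 ^ k" if "d \<in> Pow U" for d
      using that not_le by blast
    have "(\<Sum>d\<in>Pow U. E d) < (\<Sum>d\<in>Pow U. real k / 560 * 2 ^ k)"
      by (rule sum_strict_mono[OF _ _ lt]) (use finU in auto)
    with tot show False by simp
  qed
  then obtain d where d: "d \<subseteq> U" and Ed: "real k / 560 * 2 ^ k \<le> E d" by auto
  have "product_cost_at_least K (Pow d) (Pow (U - d)) (real k / 560)"
    unfolding product_cost_at_least_def
  proof (intro conjI, goal_cases)
    case 5
    show ?case
    proof (rule exI[where x="\<phi> d"], rule exI[where x="\<psi> d"], rule exI[where x="real k"], intro conjI allI)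
    show "(\<Sum>X\<in>Pow d. exp (\<phi> d X t)) \<le> card (Pow d)" for t unfolding \<phi>_def using exp_sum_le[OF d d, of t] by simp
    show "(\<Sum>X\<in>Pow (U - d). exp (\<psi> d X t)) \<le> card (Pow (U - d))" for t unfolding \<psi>_def using exp_sum_le[OF d, of "U - d" t] by simp
    have "real (card (Pow d) * card (Pow (U - d))) = (\<Sum>X\<in>Pow d. \<Sum>Y\<in>Pow (U - d). 1)" by simp
    also have "\<dots> = 2 ^ k" using cardsum[OF d order_refl, of 1] cU by simp
    finally show "real k / 560 * real (card (Pow d) * card (Pow (U - d))) \<le> (\<Sum>x\<in>Pow d. \<Sum>y\<in>Pow (U - d). measure_pmf.expectation (K x y) (\<lambda>t. \<phi> d x t + \<psi> d y t))"
      using Ed unfolding E_def by simp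
    qed (use \<phi>b[OF d] \<psi>b[OF d] in auto)
  qed (use fin[OF d] finU in auto)
  then show ?thesis using d unfolding U_def by blast
qed

section \<open>From a jump to indexing and disjointness\<close>

section \<open>Weights, distances and symmetries\<close>

lemma weight_map: "weight (map f xs) = length (filter f xs)"
  unfolding weight_def length_filter_conv_card by (intro arg_cong[where f=card]) auto

lemma hdist_map: "hdist (map f xs) (map g xs) = length (filter (\<lambda>p. f p \<noteq> g p) xs)"
  unfolding hdist_def length_filter_conv_card by (intro arg_cong[where f=card]) auto

lemma map_in_cube: "length xs = n \<Longrightarrow> map f xs \<in> cube n"
  by (simp add: cube_def)

lemma weight_complement: "x \<in> cube n \<Longrightarrow> weight (map Not x) = n - weight x"
  using sum_length_filter_compl[of "\<lambda>b. b" x] weight_map[of "\<lambda>b. b" x]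
  by (simp add: weight_map cube_def)

lemma weight_le: "x \<in> cube n \<Longrightarrow> weight x \<le> n"
  using weight_map[of "\<lambda>b. b" x] length_filter_le[of "\<lambda>b. b" x] by (simp add: cube_def)

lemma hdist_le: "x \<in> cube n \<Longrightarrow> hdist x y \<le> n"
  unfolding hdist_def cube_def using card_mono[of "{..<n}" "{i. i < length x \<and> x ! i \<noteq> y ! i}"] by auto

lemma hdist_commute: "x \<in> cube n \<Longrightarrow> y \<in> cube n \<Longrightarrow> hdist x y = hdist y x"
  unfolding hdist_def cube_def by (intro arg_cong[where f=card]) auto

lemma hdist_complement_both: "x \<in> cube n \<Longrightarrow> y \<in> cube n \<Longrightarrow> hdist (map Not x) (map Not y) = hdist x y"
  unfolding hdist_def cube_def by (intro arg_cong[where f=card]) auto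

lemma hdist_complement: 
  assumes "x \<in> cube n" "y \<in> cube n" shows "hdist x (map Not y) = n - hdist x y"
proof -
  have "hdist x (map Not y) = card ({..<n} - {i. i < length x \<and> x ! i \<noteq> y ! i})"
    unfolding hdist_def using assms by (intro arg_cong[where f=card]) (auto simp: cube_def)
  also have "\<dots> = n - hdist x y"
    unfolding hdist_def using assms by (subst card_Diff_subset) (auto simp: cube_def)
  finally show ?thesis .
qed

text \<open>
  \<open>A\<close>, \<open>B\<close>, \<open>C\<close>, \<open>D\<close> are the numbers of positions with the bit pairs \<open>11\<close>, \<open>10\<close>, \<open>01\<close>, \<open>00\<close>.
\<close>

definition profile_of :: "nat \<Rightarrow> nat \<Rightarrow> nat \<Rightarrow> nat \<Rightarrow> nat \<Rightarrow> nat \<Rightarrow> nat \<Rightarrow> nat \<Rightarrow> bool" where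
  "profile_of n a b d A B C D \<longleftrightarrow> A + B + C + D = n \<and> a = A + B \<and> b = A + C \<and> d = B + C"

lemma profile_count:
  fixes zs :: "(bool \<times> bool) list"
  shows "length zs = length (filter (\<lambda>z. fst z \<and> snd z) zs) + length (filter (\<lambda>z. fst z \<and> \<not> snd z) zs)
       + length (filter (\<lambda>z. \<not> fst z \<and> snd z) zs) + length (filter (\<lambda>z. \<not> fst z \<and> \<not> snd z) zs)"
   "length (filter fst zs) = length (filter (\<lambda>z. fst z \<and> snd z) zs) + length (filter (\<lambda>z. fst z \<and> \<not> snd z) zs)"
   "length (filter snd zs) = length (filter (\<lambda>z. fst z \<and> snd z) zs) + length (filter (\<lambda>z. \<not> fst z \<and> snd z) zs)"
   "length (filter (\<lambda>z. fst z \<noteq> snd z) zs) = length (filter (\<lambda>z. fst z \<and> \<not> snd z) zs) + length (filter (\<lambda>z. \<not> fst z \<and> snd z) zs)"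
  by (induction zs) auto

lemma zip_weights:
  assumes "x \<in> cube n" "y \<in> cube n"
  shows "weight x = length (filter fst (zip x y))" "weight y = length (filter snd (zip x y))"
    "hdist x y = length (filter (\<lambda>z. fst z \<noteq> snd z) (zip x y))"
proof -
  have "map fst (zip x y) = x" "map snd (zip x y) = y" using assms by (auto simp: cube_def)
  then show "weight x = length (filter fst (zip x y))" "weight y = length (filter snd (zip x y))"
    "hdist x y = length (filter (\<lambda>z. fst z \<noteq> snd z) (zip x y))"
    using weight_map[of fst "zip x y"] weight_map[of snd "zip x y"] hdist_map[of fst "zip x y" snd] by auto
qed

lemma profile_exists:
  assumes "x \<in> cube n" "y \<in> cube n"
  shows "\<exists>A B C D. profile_of n (weight x) (weight y) (hdist x y) A B C D"
proof -
  have "length (zip x y) = n" using assms by (simp add: cube_def)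
  then show ?thesis unfolding profile_of_def zip_weights[OF assms] profile_count(2-4)
    using profile_count(1)[of "zip x y"] by (intro exI conjI) (rule sym, assumption | rule refl | simp)+
qed

text \<open>The four pair counts solve a linear system with a unique solution; for instance, twice
  the number of pairs (True, True) is the sum of the weights minus the distance.\<close>

lemma mset_eq_of_profile:
  fixes zs zs' :: "(bool \<times> bool) list"
  assumes "length zs = length zs'" "length (filter fst zs) = length (filter fst zs')"
    "length (filter snd zs) = length (filter snd zs')"
    "length (filter (\<lambda>z. fst z \<noteq> snd z) zs) = length (filter (\<lambda>z. fst z \<noteq> snd z) zs')"
  shows "mset zs = mset zs'"
proof (rule multiset_eqI)
  fix z :: "bool \<times> bool"
  have c: "count (mset ws) (True, True) = length (filter (\<lambda>z. fst z \<and> snd z) ws)"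
     "count (mset ws) (True, False) = length (filter (\<lambda>z. fst z \<and> \<not> snd z) ws)"
     "count (mset ws) (False, True) = length (filter (\<lambda>z. \<not> fst z \<and> snd z) ws)"
     "count (mset ws) (False, False) = length (filter (\<lambda>z. \<not> fst z \<and> \<not> snd z) ws)" for ws :: "(bool \<times> bool) list"
    by (induction ws) auto
  note counts = assms profile_count[of zs] profile_count[of zs']
  have "count (mset zs) (True, True) = count (mset zs') (True, True)" unfolding c using counts by linarith
  moreover have "count (mset zs) (True, False) = count (mset zs') (True, False)" unfolding c using counts by linarith
  moreover have "count (mset zs) (False, True) = count (mset zs') (False, True)" unfolding c using counts by linarith
  moreover have "count (mset zs) (False, False) = count (mset zs') (False, False)" unfolding c using counts by linarith
  moreover have "z = (True, True) \<or> z = (True, False) \<or> z = (False, True) \<or> z = (False, False)"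
    by (cases z) auto
  ultimately show "count (mset zs) z = count (mset zs') z" by metis
qed

text \<open>Equal weights and distance give the zipped strings the same multiset of bit pairs; hence
  one permutation carries both strings at once.\<close>

lemma permutation_invariant_profile:
  assumes inv: "permutation_invariant n f" and xy: "x \<in> cube n" "y \<in> cube n" "x' \<in> cube n" "y' \<in> cube n"
    and eq: "weight x = weight x'" "weight y = weight y'" "hdist x y = hdist x' y'"
  shows "f x y = f x' y'"
proof -
  have "mset (zip x' y') = mset (zip x y)"
    using eq xy unfolding zip_weights[OF xy(1,2)] zip_weights[OF xy(3,4)]
    by (intro mset_eq_of_profile) (auto simp: cube_def)
  then obtain p where p: "p permutes {..<length (zip x y)}" "permute_list p (zip x y) = zip x' y'"
    by (rule mset_eq_permutation)
  have len: "length x = n" "length y = n" "length x' = n" "length y' = n" using xy by (auto simp: cube_def)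
  then have pn: "p permutes {..<n}" using p(1) by simp
  have "zip (permute_list p x) (permute_list p y) = zip x' y'"
    using p(2) pn len by (subst permute_list_zip[symmetric]) auto
  then have "permute_list p x = x'" "permute_list p y = y'"
    using len by (metis length_permute_list map_fst_zip map_snd_zip)+
  moreover have "f (permute_list p x) (permute_list p y) = f x y"
    using inv pn xy(1,2) unfolding permutation_invariant_def by blast
  ultimately show ?thesis by simp
qed

lemma h_fun_eq:
  assumes inv: "permutation_invariant n f" and xy: "x \<in> cube n" "y \<in> cube n"
  shows "h_fun n f (weight x) (weight y) (hdist x y) = f x y"
proof -
  have "(THE v. \<exists>x'\<in>cube n. \<exists>y'\<in>cube n. weight x' = weight x \<and> weight y' = weight y \<and> hdist x' y' = hdist x y \<and> f x' y' = v) = f x y"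
  proof (rule the_equality)
    show "\<exists>x'\<in>cube n. \<exists>y'\<in>cube n. weight x' = weight x \<and> weight y' = weight y \<and> hdist x' y' = hdist x y \<and> f x' y' = f x y"
      using xy by (intro bexI[where x=x] bexI[where x=y]) simp_all
    fix v assume "\<exists>x'\<in>cube n. \<exists>y'\<in>cube n. weight x' = weight x \<and> weight y' = weight y \<and> hdist x' y' = hdist x y \<and> f x' y' = v"
    then obtain x' y' where "x' \<in> cube n" "y' \<in> cube n" "weight x' = weight x" "weight y' = weight y" "hdist x' y' = hdist x y" "f x' y' = v"
      by blast
    then show "v = f x y" using permutation_invariant_profile[OF inv _ _ xy, of x' y'] by simp
  qed
  moreover have "\<exists>x'\<in>cube n. \<exists>y'\<in>cube n. weight x' = weight x \<and> weight y' = weight y \<and> hdist x' y' = hdist x y"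
    using xy by (intro bexI[where x=x] bexI[where x=y]) simp_all
  ultimately show ?thesis unfolding h_fun_def by simp
qed

lemma h_fun_SomeE:
  assumes "h_fun n f a b d \<noteq> None"
  obtains x y where "x \<in> cube n" "y \<in> cube n" "weight x = a" "weight y = b" "hdist x y = d"
  using assms unfolding h_fun_def by (auto split: if_splits)

text \<open>What a jump provides: a separation of distance l from distance u at fixed weights. Any
  kernel may stand for \<open>transcript P\<close>, so that exchanging the players and complementing
  strings act on \<open>K\<close>.\<close>

definition gap_solver :: "nat \<Rightarrow> (bitstring \<Rightarrow> bitstring \<Rightarrow> 't pmf) \<Rightarrow> ('t \<Rightarrow> bool) \<Rightarrow> nat \<Rightarrow> nat \<Rightarrow> nat \<Rightarrow> nat \<Rightarrow> bool" where
  "gap_solver n K out a b l u \<longleftrightarrow> (\<forall>x\<in>cube n. \<forall>y\<in>cube n. weight x = a \<longrightarrow> weight y = b \<longrightarrow>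
     (hdist x y = l \<longrightarrow> measure_pmf.prob (K x y) {t. out t} \<ge> 2/3) \<and>
     (hdist x y = u \<longrightarrow> measure_pmf.prob (K x y) {t. \<not> out t} \<ge> 2/3))"

definition cost_bound :: "nat \<Rightarrow> (bitstring \<Rightarrow> bitstring \<Rightarrow> 't pmf) \<Rightarrow> real \<Rightarrow> bool" where
  "cost_bound n K \<theta> \<longleftrightarrow> (\<exists>I J. I \<subseteq> cube n \<and> J \<subseteq> cube n \<and> product_cost_at_least K I J \<theta>)"

lemma neg_in_cube [simp]: "map Not x \<in> cube n \<longleftrightarrow> x \<in> cube n" by (simp add: cube_def)

lemma cost_bound_swap: "cost_bound n (\<lambda>y x. K x y) \<theta> \<Longrightarrow> cost_bound n K \<theta>"
  unfolding cost_bound_def using product_cost_swap[where K="\<lambda>y x. K x y"] by blast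

lemma cost_bound_compose:
  assumes "cost_bound n (\<lambda>x y. K (f x) (g y)) \<theta>" "inj f" "inj g" "f ` cube n \<subseteq> cube n" "g ` cube n \<subseteq> cube n"
  shows "cost_bound n K \<theta>"
proof -
  obtain I J where IJ: "I \<subseteq> cube n" "J \<subseteq> cube n" and pc: "product_cost_at_least (\<lambda>x y. K (f x) (g y)) I J \<theta>"
    using assms(1) unfolding cost_bound_def by blast
  have "product_cost_at_least K (f ` I) (g ` J) \<theta>"
    by (rule product_cost_image[where f=f and g=g, OF pc]) (use assms(2,3) inj_on_subset in blast)+
  moreover have "f ` I \<subseteq> cube n" "g ` J \<subseteq> cube n" using IJ assms(4,5) by blast+
  ultimately show ?thesis unfolding cost_bound_def by blast
qed

lemma cost_bound_embed:
  assumes pc: "product_cost_at_least (\<lambda>i j. K (map (\<lambda>p. fst p i) cols) (map (\<lambda>p. snd p j) cols)) I J \<theta>"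
    and len: "length cols = n"
    and inj: "inj_on (\<lambda>i. map (\<lambda>p. fst p i) cols) I" "inj_on (\<lambda>j. map (\<lambda>p. snd p j) cols) J"
  shows "cost_bound n K \<theta>"
  unfolding cost_bound_def using product_cost_image[where f="\<lambda>i. map (\<lambda>p. fst p i) cols" and g="\<lambda>j. map (\<lambda>p. snd p j) cols", OF pc inj] len
  by (intro exI conjI) (auto simp: map_in_cube)

lemma gap_solver_swap: "gap_solver n K out a b l u \<Longrightarrow> gap_solver n (\<lambda>y x. K x y) out b a l u"
  unfolding gap_solver_def by (intro ballI impI) (simp add: hdist_commute[of _ n])

lemma gap_solver_complement_both:
  assumes "gap_solver n K out a b l u" "a \<le> n" "b \<le> n"
  shows "gap_solver n (\<lambda>x y. K (map Not x) (map Not y)) out (n - a) (n - b) l u"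
  unfolding gap_solver_def
proof (intro ballI impI)
  fix x y assume xy: "x \<in> cube n" "y \<in> cube n" "weight x = n - a" "weight y = n - b"
  then have "weight (map Not x) = a" "weight (map Not y) = b" "hdist (map Not x) (map Not y) = hdist x y"
    using assms(2,3) by (auto simp: weight_complement hdist_complement_both)
  then show "(hdist x y = l \<longrightarrow> 2/3 \<le> measure_pmf.prob (K (map Not x) (map Not y)) {t. out t}) \<and>
       (hdist x y = u \<longrightarrow> 2/3 \<le> measure_pmf.prob (K (map Not x) (map Not y)) {t. \<not> out t})"
    using assms(1) xy(1,2) unfolding gap_solver_def by simp
qed

text \<open>Complementing y turns distance d into n - d, which reverses the order of the two ends
  and therefore negates the output.\<close>

lemma gap_solver_complement:
  assumes "gap_solver n K out a b l u" "b \<le> n" "l \<le> n" "u \<le> n"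
  shows "gap_solver n (\<lambda>x y. K x (map Not y)) (\<lambda>t. \<not> out t) a (n - b) (n - u) (n - l)"
  unfolding gap_solver_def
proof (intro ballI impI)
  fix x y assume xy: "x \<in> cube n" "y \<in> cube n" "weight x = a" "weight y = n - b"
  then have "weight (map Not y) = b" "hdist x (map Not y) = n - hdist x y" "hdist x y \<le> n"
    using assms(2) by (auto simp: weight_complement hdist_complement hdist_le)
  then show "(hdist x y = n - u \<longrightarrow> 2/3 \<le> measure_pmf.prob (K x (map Not y)) {t. \<not> out t}) \<and>
       (hdist x y = n - l \<longrightarrow> 2/3 \<le> measure_pmf.prob (K x (map Not y)) {t. \<not> \<not> out t})"
    using assms(1,3,4) xy(1-3) unfolding gap_solver_def by simp
qed

lemma length_filter_blocks:
  "length (filter P (concat (map f [0..<N]))) = (\<Sum>k<N. length (filter P (f k)))"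
  by (induction N) auto

section \<open>Embedding indexing and disjointness\<close>

text \<open>
  A position of the two strings, as a function of the instance \<open>i\<close> held by Alice and the instance \<open>j\<close>
  held by Bob.
\<close>

type_synonym ('i, 'j) column = "('i \<Rightarrow> bool) \<times> ('j \<Rightarrow> bool)"

definition padding :: "nat \<Rightarrow> nat \<Rightarrow> nat \<Rightarrow> nat \<Rightarrow> ('i, 'j) column list" where
  "padding A B C D = replicate A (\<lambda>_. True, \<lambda>_. True) @ replicate B (\<lambda>_. True, \<lambda>_. False)
     @ replicate C (\<lambda>_. False, \<lambda>_. True) @ replicate D (\<lambda>_. False, \<lambda>_. False)"

lemma padding_counts:
  "length (padding A B C D) = A + B + C + D"
  "length (filter (\<lambda>p. fst p i) (padding A B C D)) = A + B"
  "length (filter (\<lambda>p. snd p j) (padding A B C D)) = A + C"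
  "length (filter (\<lambda>p. fst p i \<noteq> snd p j) (padding A B C D)) = B + C"
  by (auto simp: padding_def)

text \<open>
  Every \<open>k\<close> contributes \<open>g\<close> ones to Bob's string whether or not \<open>k \<in> S\<close>, so the weights do not depend on
  the instance.
\<close>

definition index_columns :: "nat \<Rightarrow> nat \<Rightarrow> (nat, nat set) column list" where
  "index_columns g N = concat (map (\<lambda>k. replicate g (\<lambda>i. i = k, \<lambda>S. k \<in> S) @ replicate g (\<lambda>i. False, \<lambda>S. k \<notin> S)) [0..<N])"

text \<open>Blocks other than i contribute g to the distance in any case, block i contributes 0 or 2
  g. The distances g (N - 1) and g (N + 1) thus differ by the width of a jump. The additive form
  avoids truncated subtraction.\<close>

lemma index_columns_counts:
  assumes "i < N"
  shows "length (index_columns g N) = 2 * g * N"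
    "length (filter (\<lambda>p. fst p i) (index_columns g N)) = g"
    "length (filter (\<lambda>p. snd p S) (index_columns g N)) = g * N"
    "length (filter (\<lambda>p. fst p i \<noteq> snd p S) (index_columns g N)) + (if i \<in> S then g else 0) = g * N + (if i \<in> S then 0 else g)"
proof -
  have "length (index_columns g N) = length (filter (\<lambda>_. True) (index_columns g N))" by simp
  also have "\<dots> = 2 * g * N" unfolding index_columns_def length_filter_blocks by simp
  finally show "length (index_columns g N) = 2 * g * N" .
  have "length (filter (\<lambda>p. fst p i) (index_columns g N)) = (\<Sum>k<N. if k = i then g else 0)"
    unfolding index_columns_def length_filter_blocks by (intro sum.cong) auto
  then show "length (filter (\<lambda>p. fst p i) (index_columns g N)) = g" using assms by simp
  have "length (filter (\<lambda>p. snd p S) (index_columns g N)) = (\<Sum>k<N. g)"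
    unfolding index_columns_def length_filter_blocks by (intro sum.cong) (auto simp: filter_replicate)
  then show "length (filter (\<lambda>p. snd p S) (index_columns g N)) = g * N" by simp
  have "length (filter (\<lambda>p. fst p i \<noteq> snd p S) (index_columns g N)) + (\<Sum>k<N. if k = i then (if i \<in> S then g else 0) else 0)
     = (\<Sum>k<N. length (filter (\<lambda>p. fst p i \<noteq> snd p S) (replicate g (\<lambda>i. i = k, \<lambda>S. k \<in> S) @ replicate g (\<lambda>i. False, \<lambda>S. k \<notin> S)))
          + (if k = i then (if i \<in> S then g else 0) else 0))"
    unfolding index_columns_def length_filter_blocks sum.distrib ..
  also have "\<dots> = (\<Sum>k<N. g + (if k = i then (if i \<in> S then 0 else g) else 0))"
    by (intro sum.cong) (auto simp: filter_replicate)
  also have "\<dots> = g * N + (if i \<in> S then 0 else g)"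
    unfolding sum.distrib using assms by simp
  finally show "length (filter (\<lambda>p. fst p i \<noteq> snd p S) (index_columns g N)) + (if i \<in> S then g else 0) = g * N + (if i \<in> S then 0 else g)"
    using assms by simp
qed

text \<open>\<open>A\<close>, \<open>B\<close>, \<open>C\<close>, \<open>D\<close> describe distance
  u. An instance with i outside S consists of g pairs 10, g * N pairs 01 and g * (N - 1) pairs 00;
  constant padding supplies the rest.\<close>

lemma index_embedding:
  fixes K :: "bitstring \<Rightarrow> bitstring \<Rightarrow> 't pmf"
  assumes gs: "gap_solver n K out a b l u" and prof: "profile_of n a b u A B C D" "l + 2 * g = u"
    and g: "g \<ge> 1" and N: "N \<ge> 1" and sizes: "g \<le> B" "g * N \<le> C" "g * (N - 1) \<le> D"
  defines "cols \<equiv> padding A (B - g) (C - g * N) (D - g * (N - 1)) @ index_columns g N"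
  defines "K' \<equiv> \<lambda>i S. K (map (\<lambda>p. fst p i) cols) (map (\<lambda>p. snd p S) cols)"
  shows "length cols = n"
    and "inj_on (\<lambda>i. map (\<lambda>p. fst p i) cols) {..<N}" "inj_on (\<lambda>S. map (\<lambda>p. snd p S) cols) (Pow {..<N})"
    and "i < N \<Longrightarrow> measure_pmf.prob (K' i S) {t. out t = (i \<in> S)} \<ge> 2/3"
proof -
  have n: "A + B + C + D = n" "a = A + B" "b = A + C" "u = B + C" using prof by (auto simp: profile_of_def)
  have N1: "g * (N - 1) + g = g * N" using N by (cases N) auto
  have gN: "2 * g * N = g * N + g * N" by simp
  show len: "length cols = n"
    unfolding cols_def using padding_counts(1)[where 'a=nat and 'b="nat set"] index_columns_counts(1)[of 0 N g] N sizes n(1) N1 gN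
    by simp
  have mem: "(\<lambda>i. i = k, \<lambda>S. k \<in> S) \<in> set cols" if "k < N" for k
    unfolding cols_def index_columns_def using that g by force
  show "inj_on (\<lambda>i. map (\<lambda>p. fst p i) cols) {..<N}"
  proof (rule inj_onI)
    fix i i' assume i: "i \<in> {..<N}" and eq: "map (\<lambda>p. fst p i) cols = map (\<lambda>p. fst p i') cols"
    have "\<forall>p\<in>set cols. fst p i = fst p i'" using eq by simp
    from bspec[OF this mem[of i]] i show "i = i'" by simp
  qed
  show "inj_on (\<lambda>S. map (\<lambda>p. snd p S) cols) (Pow {..<N})"
  proof (rule inj_onI)
    fix S S' assume S: "S \<in> Pow {..<N}" "S' \<in> Pow {..<N}" and eq: "map (\<lambda>p. snd p S) cols = map (\<lambda>p. snd p S') cols"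
    have "\<forall>p\<in>set cols. snd p S = snd p S'" using eq by simp
    from bspec[OF this mem] have "k < N \<Longrightarrow> k \<in> S \<longleftrightarrow> k \<in> S'" for k by simp
    then show "S = S'" using S by auto
  qed
  assume i: "i < N"
  let ?x = "map (\<lambda>p. fst p i) cols" and ?y = "map (\<lambda>p. snd p S) cols"
  have cube: "?x \<in> cube n" "?y \<in> cube n" using len by (auto simp: map_in_cube)
  have wx: "weight ?x = a" unfolding weight_map cols_def
    using index_columns_counts(2)[OF i, of g] sizes n by (simp add: padding_counts)
  have wy: "weight ?y = b" unfolding weight_map cols_def
    using index_columns_counts(3)[OF i, of S g] sizes n by (simp add: padding_counts)
  have hd: "hdist ?x ?y + (if i \<in> S then g else 0) + g = u + (if i \<in> S then 0 else g)"
    unfolding hdist_map cols_def filter_append length_append padding_counts(4)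
    using index_columns_counts(4)[OF i, of S g] sizes n by linarith
  show "measure_pmf.prob (K' i S) {t. out t = (i \<in> S)} \<ge> 2/3"
  proof (cases "i \<in> S")
    case True
    then have "hdist ?x ?y = l" using hd prof(2) by simp
    then show ?thesis using gs cube wx wy True unfolding gap_solver_def K'_def by simp
  next
    case False
    then have "hdist ?x ?y = u" using hd prof(2) by simp
    then show ?thesis using gs cube wx wy False unfolding gap_solver_def K'_def by simp
  qed
qed

lemma cost_bound_index:
  fixes K :: "bitstring \<Rightarrow> bitstring \<Rightarrow> 't pmf"
  assumes rect: "rectangular K" and gs: "gap_solver n K out a b l u"
    and prof: "profile_of n a b u A B C D" "l + 2 * g = u"
    and g: "g \<ge> 1" and N: "N \<ge> 1" and sizes: "g \<le> B" "g * N \<le> C" "g * (N - 1) \<le> D"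
  shows "cost_bound n K (ln (1 + real N) / 9 - 2)"
proof -
  define cols :: "(nat, nat set) column list" where "cols = padding A (B - g) (C - g * N) (D - g * (N - 1)) @ index_columns g N"
  note emb = index_embedding[OF gs prof g N sizes, folded cols_def]
  have "product_cost_at_least (\<lambda>i S. K (map (\<lambda>p. fst p i) cols) (map (\<lambda>p. snd p S) cols)) {..<N} (Pow {..<N}) (ln (1 + real N) / 9 - 2)"
    by (rule product_cost_index[OF rectangular_compose[OF rect] N, where out=out]) (rule emb(4))
  then show ?thesis by (rule cost_bound_embed[OF _ emb(1-3)])
qed

text \<open>One block, that is N = 1, already gives Bob two inputs with different answers.\<close>

lemma cost_bound_const:
  fixes K :: "bitstring \<Rightarrow> bitstring \<Rightarrow> 't pmf"
  assumes gs: "gap_solver n K out a b l u"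
    and prof: "profile_of n a b u A B C D" "l + 2 * g = u"
    and g: "g \<ge> 1" and sizes: "g \<le> B" "g \<le> C"
  shows "cost_bound n K (1/20)"
proof -
  have s: "g * 1 \<le> C" "g * (1 - 1) \<le> D" using sizes by auto
  note emb = index_embedding[OF gs prof g order_refl sizes(1) s]
  define cols :: "(nat, nat set) column list" where "cols = padding A (B - g) (C - g * 1) (D - g * (1 - 1)) @ index_columns g 1"
  note emb' = emb[folded cols_def]
  define K' where "K' = (\<lambda>i S. K (map (\<lambda>p. fst p i) cols) (map (\<lambda>p. snd p S) cols))"
  have p1: "measure_pmf.prob (K' 0 {0}) {t. out t} \<ge> 2/3" and p0: "measure_pmf.prob (K' 0 {}) {t. \<not> out t} \<ge> 2/3"
    using emb'(4)[of 0 "{0}"] emb'(4)[of 0 "{}"] by (simp_all add: K'_def)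
  have pc: "product_cost_at_least K' {0} {{}, {0}} (1/20)"
    by (rule product_cost_two_inputs[where K=K' and x=0 and out=out, OF _ p1 p0]) auto
  have inj: "inj_on (\<lambda>S. map (\<lambda>p. snd p S) cols) {{}, {0}}"
    by (rule inj_on_subset[OF emb'(3)]) auto
  show ?thesis by (rule cost_bound_embed[OF pc[unfolded K'_def] emb'(1) _ inj]) simp
qed

text \<open>The second and third group of a block make the weights independent of the instance. A
  block has distance 2 g, from g pairs each of 10, 01 and 00, unless j lies in both sets; then its
  distance is 0.\<close>

definition disjointness_columns :: "nat \<Rightarrow> nat \<Rightarrow> (nat set, nat set) column list" where
  "disjointness_columns g k = concat (map (\<lambda>j. replicate g (\<lambda>X. j \<in> X, \<lambda>Y. j \<in> Y) @ replicate g (\<lambda>X. j \<notin> X, \<lambda>Y. False)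
      @ replicate g (\<lambda>X. False, \<lambda>Y. j \<notin> Y)) [0..<k])"

lemma disjointness_columns_counts:
  "length (disjointness_columns g k) = 3 * g * k"
  "length (filter (\<lambda>p. fst p X) (disjointness_columns g k)) = g * k"
  "length (filter (\<lambda>p. snd p Y) (disjointness_columns g k)) = g * k"
  "length (filter (\<lambda>p. fst p X \<noteq> snd p Y) (disjointness_columns g k)) + 2 * g * card {j. j < k \<and> j \<in> X \<and> j \<in> Y} = 2 * g * k"
proof -
  have "length (disjointness_columns g k) = length (filter (\<lambda>_. True) (disjointness_columns g k))" by simp
  also have "\<dots> = 3 * g * k" unfolding disjointness_columns_def length_filter_blocks by simp
  finally show "length (disjointness_columns g k) = 3 * g * k" .
  have "length (filter (\<lambda>p. fst p X) (disjointness_columns g k)) = (\<Sum>j<k. g)"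
    unfolding disjointness_columns_def length_filter_blocks by (intro sum.cong) (auto simp: filter_replicate)
  then show "length (filter (\<lambda>p. fst p X) (disjointness_columns g k)) = g * k" by simp
  have "length (filter (\<lambda>p. snd p Y) (disjointness_columns g k)) = (\<Sum>j<k. g)"
    unfolding disjointness_columns_def length_filter_blocks by (intro sum.cong) (auto simp: filter_replicate)
  then show "length (filter (\<lambda>p. snd p Y) (disjointness_columns g k)) = g * k" by simp
  have "card {j. j < k \<and> j \<in> X \<and> j \<in> Y} = (\<Sum>j<k. if j \<in> X \<and> j \<in> Y then 1 else 0)"
  proof -
    have "{j. j < k \<and> j \<in> X \<and> j \<in> Y} = {j\<in>{..<k}. j \<in> X \<and> j \<in> Y}" by auto
    then show ?thesis by (simp only: card_eq_sum sum.inter_filter finite_lessThan)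
  qed
  then have "length (filter (\<lambda>p. fst p X \<noteq> snd p Y) (disjointness_columns g k)) + 2 * g * card {j. j < k \<and> j \<in> X \<and> j \<in> Y}
    = (\<Sum>j<k. length (filter (\<lambda>p. fst p X \<noteq> snd p Y) (replicate g (\<lambda>X. j \<in> X, \<lambda>Y. j \<in> Y) @ replicate g (\<lambda>X. j \<notin> X, \<lambda>Y. False)
      @ replicate g (\<lambda>X. False, \<lambda>Y. j \<notin> Y))) + 2 * g * (if j \<in> X \<and> j \<in> Y then 1 else 0))"
    unfolding disjointness_columns_def length_filter_blocks sum.distrib sum_distrib_left[symmetric] by simp
  also have "\<dots> = (\<Sum>j<k. 2 * g)"
    by (intro sum.cong) (auto simp: filter_replicate)
  finally show "length (filter (\<lambda>p. fst p X \<noteq> snd p Y) (disjointness_columns g k)) + 2 * g * card {j. j < k \<and> j \<in> X \<and> j \<in> Y} = 2 * g * k"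
    by simp
qed

text \<open>Disjoint sets have distance u and sets meeting in one point have distance l = u - 2 g,
  so accepting for disjointness means rejecting in the sense of \<open>gap_solver\<close>.\<close>

lemma cost_bound_disjointness:
  fixes K :: "bitstring \<Rightarrow> bitstring \<Rightarrow> 't pmf"
  assumes rect: "rectangular K" and gs: "gap_solver n K out a b l u"
    and prof: "profile_of n a b u A B C D" "l + 2 * g = u"
    and g: "g \<ge> 1" and k: "k \<ge> 1" and sizes: "g * k \<le> B" "g * k \<le> C" "g * k \<le> D"
  shows "cost_bound n K (real k / 560)"
proof -
  define cols where "cols = padding A (B - g * k) (C - g * k) (D - g * k) @ disjointness_columns g k"
  define K' where "K' = (\<lambda>X Y. K (map (\<lambda>p. fst p X) cols) (map (\<lambda>p. snd p Y) cols))"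
  have n: "A + B + C + D = n" "a = A + B" "b = A + C" "u = B + C" using prof by (auto simp: profile_of_def)
  have len: "length cols = n"
    unfolding cols_def using sizes n(1) disjointness_columns_counts(1)[of g k]
    by (simp add: padding_counts)
  have mem: "(\<lambda>X. j \<in> X, \<lambda>Y. j \<in> Y) \<in> set cols" if "j < k" for j
    unfolding cols_def disjointness_columns_def using that g by force
  have inj1: "inj_on (\<lambda>S. map (\<lambda>p. fst p S) cols) (Pow {..<k})"
  proof (rule inj_onI)
    fix S S' assume S: "S \<in> Pow {..<k}" "S' \<in> Pow {..<k}" and eq: "map (\<lambda>p. fst p S) cols = map (\<lambda>p. fst p S') cols"
    have "\<forall>p\<in>set cols. fst p S = fst p S'" using eq by simp
    from bspec[OF this mem] have "j < k \<Longrightarrow> j \<in> S \<longleftrightarrow> j \<in> S'" for j by simp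
    then show "S = S'" using S by auto
  qed
  have inj2: "inj_on (\<lambda>S. map (\<lambda>p. snd p S) cols) (Pow {..<k})"
  proof (rule inj_onI)
    fix S S' assume S: "S \<in> Pow {..<k}" "S' \<in> Pow {..<k}" and eq: "map (\<lambda>p. snd p S) cols = map (\<lambda>p. snd p S') cols"
    have "\<forall>p\<in>set cols. snd p S = snd p S'" using eq by simp
    from bspec[OF this mem] have "j < k \<Longrightarrow> j \<in> S \<longleftrightarrow> j \<in> S'" for j by simp
    then show "S = S'" using S by auto
  qed
  have cube: "map (\<lambda>p. fst p X) cols \<in> cube n" "map (\<lambda>p. snd p Y) cols \<in> cube n" for X Y
    using len by (auto simp: map_in_cube)
  have wx: "weight (map (\<lambda>p. fst p X) cols) = a" for X unfolding weight_map cols_def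
    using disjointness_columns_counts(2)[of X g k] sizes n by (simp add: padding_counts)
  have wy: "weight (map (\<lambda>p. snd p Y) cols) = b" for Y unfolding weight_map cols_def
    using disjointness_columns_counts(3)[of Y g k] sizes n by (simp add: padding_counts)
  have hd: "hdist (map (\<lambda>p. fst p X) cols) (map (\<lambda>p. snd p Y) cols) + 2 * g * card {j. j < k \<and> j \<in> X \<and> j \<in> Y} = u" for X Y
  proof -
    have "2 * g * k = g * k + g * k" by simp
    then have "length (filter (\<lambda>p. fst p X \<noteq> snd p Y) (disjointness_columns g k)) + 2 * g * card {j. j < k \<and> j \<in> X \<and> j \<in> Y} = g * k + g * k"
      using disjointness_columns_counts(4)[of X Y g k] by (rule trans[rotated])
    then show ?thesis
      unfolding hdist_map cols_def filter_append length_append padding_counts(4) using sizes n by linarith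
  qed
  have "\<exists>d\<subseteq>{..<k}. product_cost_at_least K' (Pow d) (Pow ({..<k} - d)) (real k / 560)"
  proof (rule product_cost_disjointness[where out = "\<lambda>t. \<not> out t"])
    show "rectangular K'" unfolding K'_def by (rule rectangular_compose[OF rect])
    show "k \<ge> 1" by fact
    fix X Y assume XY: "X \<subseteq> {..<k}" "Y \<subseteq> {..<k}"
    { assume "X \<inter> Y = {}"
      then have e: "{j. j < k \<and> j \<in> X \<and> j \<in> Y} = {}" by auto
      have "hdist (map (\<lambda>p. fst p X) cols) (map (\<lambda>p. snd p Y) cols) = u" using hd[of X Y] unfolding e by simp
      then show "2/3 \<le> measure_pmf.prob (K' X Y) {t. \<not> out t}"
        using gs cube wx wy unfolding gap_solver_def K'_def by simp }
    { fix i assume "X \<inter> Y = {i}"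
      then have e: "{j. j < k \<and> j \<in> X \<and> j \<in> Y} = {i}" using XY by auto
      have "hdist (map (\<lambda>p. fst p X) cols) (map (\<lambda>p. snd p Y) cols) = l" using hd[of X Y] prof(2) unfolding e by simp
      then show "2/3 \<le> measure_pmf.prob (K' X Y) {t. \<not> \<not> out t}"
        using gs cube wx wy unfolding gap_solver_def K'_def by simp }
  qed
  then obtain d where d: "d \<subseteq> {..<k}" and pc: "product_cost_at_least K' (Pow d) (Pow ({..<k} - d)) (real k / 560)" by blast
  show ?thesis
    by (rule cost_bound_embed[OF pc[unfolded K'_def] len]) (use d in \<open>auto intro!: inj_on_subset[OF inj1] inj_on_subset[OF inj2]\<close>)
qed

lemma profile_swap: "profile_of n a b d A B C D \<Longrightarrow> profile_of n b a d A C B D"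
  by (auto simp: profile_of_def)

lemma profile_complement_both: "profile_of n a b d A B C D \<Longrightarrow> profile_of n (n - a) (n - b) d D C B A"
  by (auto simp: profile_of_def)

lemma cost_bound_complement_both: "cost_bound n (\<lambda>x y. K (map Not x) (map Not y)) \<theta> \<Longrightarrow> cost_bound n K \<theta>"
  by (rule cost_bound_compose[where f="map Not" and g="map Not"]) (auto simp: inj_def)

lemma cost_bound_complement: "cost_bound n (\<lambda>x y. K x (map Not y)) \<theta> \<Longrightarrow> cost_bound n K \<theta>"
  by (rule cost_bound_compose[where f="\<lambda>x. x" and g="map Not"]) (auto simp: inj_def)

text \<open>Since B + C = u and A + D = n - u, one of B, C is at least g * N and one of A, D at
  least g * (N - 1). Exchanging the players swaps B with C; complementing both strings swaps A with
  D and B with C. So the large counts can be moved to where \<open>index_embedding\<close> wants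
  them.\<close>

lemma cost_bound_log_gap:
  fixes K :: "bitstring \<Rightarrow> bitstring \<Rightarrow> 't pmf"
  assumes rect: "rectangular K" and gs: "gap_solver n K out a b l u"
    and prof: "profile_of n a b u A B C D" "l + 2 * g = u"
    and g: "g \<ge> 1" and N: "N \<ge> 1" and gBC: "g \<le> B" "g \<le> C"
    and sizes: "2 * g * N \<le> u" "2 * g * N \<le> n - l"
  shows "cost_bound n K (ln (1 + real N) / 9 - 2)"
proof -
  have n: "A + B + C + D = n" "a = A + B" "b = A + C" "u = B + C" using prof by (auto simp: profile_of_def)
  have N1: "g * (N - 1) + g = g * N" using N by (cases N) auto
  have gN: "2 * g * N = g * N + g * N" by simp
  have BC: "g * N \<le> B \<or> g * N \<le> C" using sizes(1) n(4) gN by linarith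
  have AD: "g * (N - 1) \<le> A \<or> g * (N - 1) \<le> D" using sizes(2) n prof(2) gN N1 by linarith
  have ab: "a \<le> n" "b \<le> n" using n by auto
  note sw = gap_solver_swap[OF gs] 
  show ?thesis
  proof (cases "g * (N - 1) \<le> D")
    case D: True
    show ?thesis
    proof (cases "g * N \<le> C")
      case True
      show ?thesis by (rule cost_bound_index[OF rect gs prof g N gBC(1) True D])
    next
      case False
      then have B: "g * N \<le> B" using BC by simp
      show ?thesis
        by (rule cost_bound_swap, rule cost_bound_index[OF rectangular_swap[OF rect] sw profile_swap[OF prof(1)] prof(2) g N gBC(2) B D])
    qed
  next
    case False
    then have D: "g * (N - 1) \<le> A" using AD by simp
    note gs' = gap_solver_complement_both[OF gs ab]
    note prof' = profile_complement_both[OF prof(1)]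
    note rect' = rectangular_compose[OF rect, where f="map Not" and g="map Not"]
    have "cost_bound n (\<lambda>x y. K (map Not x) (map Not y)) (ln (1 + real N) / 9 - 2)"
    proof (cases "g * N \<le> B")
      case True
      show ?thesis by (rule cost_bound_index[OF rect' gs' prof' prof(2) g N gBC(2) True D])
    next
      case False
      then have C: "g * N \<le> C" using BC by simp
      show ?thesis
        by (rule cost_bound_swap, rule cost_bound_index[OF rectangular_swap[OF rect'] gap_solver_swap[OF gs'] profile_swap[OF prof'] prof(2) g N gBC(1) C D])
    qed
    then show ?thesis by (rule cost_bound_complement_both)
  qed
qed

text \<open>The six sizes are the sums of any two of A, B, C, D, so at most one of the four is below
  g * (k + 1). Symmetries make that one the count of pairs 11, which disjoint instances do not draw
  on. Complementing one string moves the reference end from u to l and shifts every count by g,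
  which is why k + 1 stands in place of k.\<close>

lemma cost_bound_linear_gap:
  fixes K :: "bitstring \<Rightarrow> bitstring \<Rightarrow> 't pmf"
  assumes rect: "rectangular K" and gs: "gap_solver n K out a b l u"
    and prof: "profile_of n a b u A B C D" "l + 2 * g = u"
    and g: "g \<ge> 1" and k: "k \<ge> 1" and gBC: "g \<le> B" "g \<le> C"
    and sizes: "2 * g * (k + 1) \<le> a" "2 * g * (k + 1) \<le> b" "2 * g * (k + 1) \<le> n - a" "2 * g * (k + 1) \<le> n - b"
      "2 * g * (k + 1) \<le> u" "2 * g * (k + 1) \<le> n - u"
  shows "cost_bound n K (real k / 560)"
proof -
  have n: "A + B + C + D = n" "a = A + B" "b = A + C" "u = B + C" using prof by (auto simp: profile_of_def)
  have ab: "a \<le> n" "b \<le> n" "l \<le> n" "u \<le> n" using n prof(2) by auto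
  define q where "q = g * k"
  have q: "2 * g * (k + 1) = 2 * q + 2 * g" by (simp add: q_def algebra_simps)
  note s = sizes[unfolded q] 
  consider "q + g \<le> B" "q + g \<le> C" "q + g \<le> D" | "q + g \<le> A" "q + g \<le> C" "q + g \<le> D"
    | "q + g \<le> A" "q + g \<le> B" "q + g \<le> D" | "q + g \<le> A" "q + g \<le> B" "q + g \<le> C"
    using s n by linarith
  then show ?thesis
  proof cases
    case 1
    show ?thesis by (rule cost_bound_disjointness[OF rect gs prof g k]) (use 1 in \<open>auto simp: q_def\<close>)
  next
    case 4
    show ?thesis
      by (rule cost_bound_complement_both, rule cost_bound_disjointness[OF rectangular_compose[OF rect]
          gap_solver_complement_both[OF gs ab(1,2)] profile_complement_both[OF prof(1)] prof(2) g k]) (use 4 in \<open>auto simp: q_def\<close>)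
  next
    case 2
    have p: "profile_of n a (n - b) (n - l) (B - g) (A + g) (D + g) (C - g)"
      using n prof(2) gBC unfolding profile_of_def by auto
    have lu: "n - u + 2 * g = n - l" using prof(2) ab by simp
    show ?thesis
      by (rule cost_bound_complement, rule cost_bound_disjointness[OF rectangular_compose[OF rect, where f="\<lambda>x. x"]
          gap_solver_complement[OF gs ab(2,3,4)] p lu g k]) (use 2 in \<open>auto simp: q_def\<close>)
  next
    case 3
    have p: "profile_of n b (n - a) (n - l) (C - g) (A + g) (D + g) (B - g)"
      using n prof(2) gBC unfolding profile_of_def by auto
    have lu: "n - u + 2 * g = n - l" using prof(2) ab by simp
    show ?thesis
      by (rule cost_bound_swap, rule cost_bound_complement, rule cost_bound_disjointness[OF rectangular_compose[OF rectangular_swap[OF rect], where f="\<lambda>x. x"]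
          gap_solver_complement[OF gap_solver_swap[OF gs] ab(1,3,4)] p lu g k]) (use 3 in \<open>auto simp: q_def\<close>)
  qed
qed

section \<open>The lower bound\<close>

text \<open>From nats to bits: the cost is nonnegative and ln 2 is below 1.\<close>

lemma cost_bound_information_cost:
  assumes "cost_bound n (transcript P) \<theta>" "\<theta> \<ge> 0"
  shows "\<exists>\<mu>\<in>input_distributions n. \<theta> \<le> information_cost P \<mu>"
proof -
  obtain \<mu> where \<mu>: "\<mu> \<in> input_distributions n" and le: "\<theta> \<le> ln 2 * information_cost P \<mu>"
    using assms(1) information_cost_ge_product_cost unfolding cost_bound_def by blast
  have "ln 2 * information_cost P \<mu> \<ge> 0" using le assms(2) by linarith
  then have "information_cost P \<mu> \<ge> 0" by (simp add: zero_le_mult_iff)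
  then have "ln 2 * information_cost P \<mu> \<le> 1 * information_cost P \<mu>"
    using ln_2_less_1 by (intro mult_right_mono) auto
  then show ?thesis using \<mu> le by (intro bexI[of _ \<mu>]) auto
qed

text \<open>A distance equals a + b - 2 A, so distances at the same weights differ by an even number
  and g is the integer A' - A. Passing from u to l lowers B and C by g, hence both are at least g at
  u.\<close>

lemma jumpE:
  assumes inv: "permutation_invariant n f" and jump: "(c, g) \<in> jumps (h_fun n f a b)"
  obtains l u gn v A B C D where "real l = c - g" "real u = c + g" "g = real gn" "gn \<ge> 1" "l + 2 * gn = u"
    "h_fun n f a b l = Some v" "h_fun n f a b u = Some (\<not> v)" "profile_of n a b u A B C D" "gn \<le> B" "gn \<le> C"
    "l < u" "u \<le> n" "a \<le> n" "b \<le> n"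
proof -
  obtain l u where lu: "real l = c - g" "real u = c + g" "l < u" "h_fun n f a b l \<noteq> None" "h_fun n f a b u \<noteq> None"
    "h_fun n f a b l \<noteq> h_fun n f a b u"
    using jump unfolding jumps_def by blast
  obtain v where v: "h_fun n f a b l = Some v" using lu by auto
  have v': "h_fun n f a b u = Some (\<not> v)" using lu v by auto
  obtain x y where "x \<in> cube n" "y \<in> cube n" "weight x = a" "weight y = b" "hdist x y = u" using lu(5) by (rule h_fun_SomeE)
  then obtain A B C D where p: "profile_of n a b u A B C D" using profile_exists[of x n y] by auto
  obtain x' y' where "x' \<in> cube n" "y' \<in> cube n" "weight x' = a" "weight y' = b" "hdist x' y' = l" using lu(4) by (rule h_fun_SomeE)
  then obtain A' B' C' D' where p': "profile_of n a b l A' B' C' D'" using profile_exists[of x' n y'] by auto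
  define gn where "gn = A' - A"
  have gn: "A' = A + gn" "gn \<ge> 1" "l + 2 * gn = u" "gn \<le> B" "gn \<le> C"
    using p p' lu(3) unfolding profile_of_def gn_def by linarith+
  have "real u = real l + 2 * real gn" using gn(3) by linarith
  then have "g = real gn" using lu(1,2) by linarith
  then show ?thesis using that[OF lu(1,2) _ gn(2,3) v v' p gn(4,5) lu(3)] p unfolding profile_of_def by simp
qed

lemma gap_solver_of_jump:
  assumes inv: "permutation_invariant n f" and comp: "computes n f P"
    and hl: "h_fun n f a b l = Some v" and hu: "h_fun n f a b u = Some (\<not> v)"
  shows "gap_solver n (transcript P) (\<lambda>(r, t). leaf_output (snd P r) t = v) a b l u"
proof -
  have pr: "pmf (result P x y) w = measure_pmf.prob (transcript P x y) {(r, t). leaf_output (snd P r) t = w}" for x y w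
    unfolding result_def pmf_map by (intro arg_cong[where f="measure_pmf.prob _"]) auto
  have "2/3 \<le> measure_pmf.prob (transcript P x y) {(r, t). leaf_output (snd P r) t = w}"
    if "x \<in> cube n" "y \<in> cube n" "weight x = a" "weight y = b" "h_fun n f a b (hdist x y) = Some w" for x y w
  proof -
    have "f x y = Some w" using h_fun_eq[OF inv that(1,2)] that by simp
    then show ?thesis using comp that(1,2) unfolding computes_def pr[symmetric] by blast
  qed
  moreover have "{t. (case t of (r, t) \<Rightarrow> leaf_output (snd P r) t = v)} = {(r, t). leaf_output (snd P r) t = v}"
    "{t. \<not> (case t of (r, t) \<Rightarrow> leaf_output (snd P r) t = v)} = {(r, t). leaf_output (snd P r) t = (\<not> v)}"
    by auto
  ultimately show ?thesis unfolding gap_solver_def using hl hu by simp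
qed

lemma nat_floor_bounds:
  fixes x :: real
  assumes "x \<ge> 1"
  shows "1 \<le> nat \<lfloor>x\<rfloor>" "real (nat \<lfloor>x\<rfloor>) \<le> x" "x \<le> real (nat \<lfloor>x\<rfloor>) + 1"
  using assms le_nat_floor[of 1 x] of_nat_floor[of x] real_of_int_floor_add_one_ge[of x] by auto

lemma jump_value_le:
  assumes inv: "permutation_invariant n f" and comp: "computes n f P"
    and jump: "(c, g) \<in> jumps (h_fun n f a b)"
  shows "\<exists>\<mu>\<in>input_distributions n.
     max (Min {real a, real b, c, real n - real a, real n - real b, real n - c} / g)
         (log 2 (min c (real n - c) / g)) \<le> 4000 * information_cost P \<mu>"
proof -
  obtain l u gn v A B C D where lu: "real l = c - g" "real u = c + g" and g: "g = real gn" "gn \<ge> 1" "l + 2 * gn = u"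
    and h: "h_fun n f a b l = Some v" "h_fun n f a b u = Some (\<not> v)" and prof: "profile_of n a b u A B C D"
    and gBC: "gn \<le> B" "gn \<le> C" and le: "l < u" "u \<le> n" "a \<le> n" "b \<le> n"
    using jumpE[OF inv jump] by blast
  note gs = gap_solver_of_jump[OF inv comp h]
  note rect = rectangular_transcript[of P]
  have g0: "g \<ge> 1" using g by simp
  define M where "M = Min {real a, real b, c, real n - real a, real n - real b, real n - c}"
  have M: "M \<le> real a" "M \<le> real b" "M \<le> c" "M \<le> real n - real a" "M \<le> real n - real b" "M \<le> real n - c"
    unfolding M_def by (auto intro!: Min_le)
  obtain \<mu>0 where \<mu>0: "\<mu>0 \<in> input_distributions n" "1/20 \<le> information_cost P \<mu>0"
    using cost_bound_information_cost[OF cost_bound_const[OF gs prof g(3,2) gBC]] by auto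
  have lin: "\<exists>\<mu>\<in>input_distributions n. M / g \<le> 4000 * information_cost P \<mu>"
  \<comment> \<open>Below 5 the constant bound suffices; from 5 on, k is at least 1.\<close>
  proof (cases "M / g < 5")
    case True
    then show ?thesis using \<mu>0 by (intro bexI[OF _ \<mu>0(1)]) simp
  next
    case False
    \<comment> \<open>The largest k with 2 * g * (k + 1) + g \<le> M; the additional g is the offset
      of u from the centre c.\<close>
    define k where "k = nat \<lfloor>(M / g - 3) / 2\<rfloor>"
    have ge1: "(M / g - 3) / 2 \<ge> 1" using False by simp
    have k1: "k \<ge> 1" using nat_floor_bounds(1)[OF ge1] unfolding k_def .
    have "real k \<le> (M / g - 3) / 2" using nat_floor_bounds(2)[OF ge1] unfolding k_def .
    then have "2 * real k + 3 \<le> M / g" by simp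
    then have kM: "(2 * real k + 3) * g \<le> M" using g0 by (simp add: le_divide_eq)
    have k2: "M / g \<le> 2 * real k + 5" using nat_floor_bounds(3)[OF ge1] unfolding k_def[symmetric] by (simp add: field_simps)
    have e: "real (2 * gn * (k + 1)) = (2 * real k + 3) * g - g" unfolding g(1) by (simp add: algebra_simps)
    have "real (2 * gn * (k + 1)) \<le> real a" "real (2 * gn * (k + 1)) \<le> real b" "real (2 * gn * (k + 1)) \<le> real (n - a)"
      "real (2 * gn * (k + 1)) \<le> real (n - b)" "real (2 * gn * (k + 1)) \<le> real u" "real (2 * gn * (k + 1)) \<le> real (n - u)"
      unfolding e using kM M lu g0 le by (auto simp: of_nat_diff)
    then have cb: "cost_bound n (transcript P) (real k / 560)"
      unfolding of_nat_le_iff by (intro cost_bound_linear_gap[OF rect gs prof g(3,2) k1 gBC])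
    then obtain \<mu> where \<mu>: "\<mu> \<in> input_distributions n" "real k / 560 \<le> information_cost P \<mu>"
      using cost_bound_information_cost[OF cb] by auto
    have "M / g \<le> 4000 * information_cost P \<mu>" using k2 k1 \<mu>(2) by linarith
    then show ?thesis using \<mu>(1) by blast
  qed
  define m where "m = min c (real n - c)"
  have mg: "m / g \<ge> 1" using lu g0 le unfolding m_def by (auto simp: le_divide_eq)
  have logb: "\<exists>\<mu>\<in>input_distributions n. log 2 (m / g) \<le> 4000 * information_cost P \<mu>"
  proof -
    \<comment> \<open>The largest N with 2 * g * N \<le> m + g. Here the half-width helps, because u
      = c + g and n - l = n - c + g.\<close>
    define N where "N = nat \<lfloor>(m / g + 1) / 2\<rfloor>"
    have ge1: "(m / g + 1) / 2 \<ge> 1" using mg by simp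
    have N1: "N \<ge> 1" using nat_floor_bounds(1)[OF ge1] unfolding N_def .
    have "real N \<le> (m / g + 1) / 2" using nat_floor_bounds(2)[OF ge1] unfolding N_def .
    then have "2 * real N \<le> m / g + 1" by simp
    then have "2 * real N * g \<le> (m / g + 1) * g" using g0 by (intro mult_right_mono) auto
    then have Nm: "2 * real N * g \<le> m + g" using g0 by (simp add: algebra_simps)
    have N2: "m / g \<le> 2 * (1 + real N)" using nat_floor_bounds(3)[OF ge1] unfolding N_def[symmetric] by (simp add: field_simps)
    have e: "real (2 * gn * N) = 2 * real N * g" unfolding g(1) by simp
    have "real (2 * gn * N) \<le> real u" "real (2 * gn * N) \<le> real (n - l)"
      unfolding e using Nm lu g0 le by (auto simp: of_nat_diff m_def)
    then have cb: "cost_bound n (transcript P) (ln (1 + real N) / 9 - 2)"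
      unfolding of_nat_le_iff by (intro cost_bound_log_gap[OF rect gs prof g(3,2) N1 gBC])
    have "log 2 (m / g) \<le> log 2 (2 * (1 + real N))" using N2 mg by (intro log_mono) auto
    also have "\<dots> = 1 + ln (1 + real N) / ln 2" unfolding log_def by (subst ln_mult) (auto simp: add_divide_distrib)
    also have "ln (1 + real N) / ln 2 \<le> ln (1 + real N) / (2/3)"
      using ln2_ge_two_thirds by (intro divide_left_mono) auto
    finally have lg: "log 2 (m / g) \<le> 1 + 3/2 * ln (1 + real N)" by simp
    show ?thesis
    \<comment> \<open>If the indexing bound is at most 1/20, the logarithm is below 29, while the
      constant bound gives 4000 / 20 = 200.\<close>
    proof (cases "ln (1 + real N) / 9 - 2 \<le> 1/20")
      case True
      then have "log 2 (m / g) \<le> 4000 * information_cost P \<mu>0" using lg \<mu>0(2) by linarith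
      then show ?thesis using \<mu>0(1) by blast
    next
      case False
      then have "0 \<le> ln (1 + real N) / 9 - 2" by linarith
      then obtain \<mu> where \<mu>: "\<mu> \<in> input_distributions n" "ln (1 + real N) / 9 - 2 \<le> information_cost P \<mu>"
        using cost_bound_information_cost[OF cb] by blast
      have "log 2 (m / g) \<le> 4000 * information_cost P \<mu>" using lg False \<mu>(2) by linarith
      then show ?thesis using \<mu>(1) by blast
    qed
  qed
  show ?thesis
  proof (cases "M / g \<le> log 2 (m / g)")
    case True
    then show ?thesis using logb unfolding M_def[symmetric] m_def[symmetric] by (simp add: max_def)
  next
    case False
    then show ?thesis using lin unfolding M_def[symmetric] m_def[symmetric] by (simp add: max_def)
  qed
qed

lemma jumps_subset:
  "jumps (h_fun n f a b) \<subseteq> (\<lambda>(l, u). ((real l + real u) / 2, (real u - real l) / 2)) ` ({..n} \<times> {..n})"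
proof
  fix p assume "p \<in> jumps (h_fun n f a b)"
  then obtain c g l u where p: "p = (c, g)" "real l = c - g" "real u = c + g" "h_fun n f a b l \<noteq> None" "h_fun n f a b u \<noteq> None"
    unfolding jumps_def by blast
  have "l \<le> n" by (rule h_fun_SomeE[OF p(4)]) (auto intro: hdist_le)
  moreover have "u \<le> n" by (rule h_fun_SomeE[OF p(5)]) (auto intro: hdist_le)
  ultimately have "(l, u) \<in> {..n} \<times> {..n}" by simp
  moreover have "p = (\<lambda>(l, u). ((real l + real u) / 2, (real u - real l) / 2)) (l, u)" using p by simp
  ultimately show "p \<in> (\<lambda>(l, u). ((real l + real u) / 2, (real u - real l) / 2)) ` ({..n} \<times> {..n})" by blast
qed

lemma finite_jumps: "finite (jumps (h_fun n f a b))"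
  by (rule finite_subset[OF jumps_subset]) auto

lemma finite_jump_values: "finite (jump_values n f)"
proof -
  define F where "F = (\<lambda>((a, b), (c, g)). max (Min {real a, real b, c, real n - real a, real n - real b, real n - c} / g)
          (log 2 (min c (real n - c) / g)))"
  have "jump_values n f \<subseteq> F ` (SIGMA ab : {1..n} \<times> {1..n}. jumps (h_fun n f (fst ab) (snd ab)))"
  proof
    fix v assume "v \<in> jump_values n f"
    then obtain a b c g where "v = F ((a, b), (c, g))" "a \<in> {1..n}" "b \<in> {1..n}" "(c, g) \<in> jumps (h_fun n f a b)"
      unfolding jump_values_def F_def prod.case by blast
    then show "v \<in> F ` (SIGMA ab : {1..n} \<times> {1..n}. jumps (h_fun n f (fst ab) (snd ab)))"
      by (intro image_eqI[of _ _ "((a, b), (c, g))"]) auto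
  qed
  moreover have "finite (F ` (SIGMA ab : {1..n} \<times> {1..n}. jumps (h_fun n f (fst ab) (snd ab))))"
    by (intro finite_imageI finite_SigmaI finite_jumps) auto
  ultimately show ?thesis by (rule finite_subset)
qed

lemma m_measure_le_IC:
  assumes inv: "permutation_invariant n f"
  shows "ereal (m_measure 4000 n f) \<le> IC n f"
  unfolding IC_def
proof (rule INF_greatest)
  fix P assume "P \<in> {P. computes n f P}"
  then have comp: "computes n f P" by simp
  have "\<exists>\<mu>\<in>input_distributions n. m_measure 4000 n f \<le> information_cost P \<mu>"
  proof (cases "jump_values n f = {}")
    case True
    \<comment> \<open>Without jumps m is 0, and a single pair of inputs shows that the supremum is
      at least 0.\<close>
    have "product_cost_at_least (transcript P) {replicate n False} {replicate n False} 0"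
      unfolding product_cost_at_least_def
      by (intro conjI exI[where x="\<lambda>_ _. 0"] exI[where x="0::real"]) auto
    then have "cost_bound n (transcript P) 0" unfolding cost_bound_def by (intro exI conjI) (auto simp: cube_def)
    then show ?thesis using cost_bound_information_cost True by (auto simp: m_measure_def)
  next
    case False
    then have "Max (jump_values n f) \<in> jump_values n f" using finite_jump_values by (intro Max_in) auto
    then obtain a b c g where jump: "(c, g) \<in> jumps (h_fun n f a b)"
      and Max: "Max (jump_values n f) = max (Min {real a, real b, c, real n - real a, real n - real b, real n - c} / g)
          (log 2 (min c (real n - c) / g))"
      unfolding jump_values_def by blast
    obtain \<mu> where "\<mu> \<in> input_distributions n" "Max (jump_values n f) \<le> 4000 * information_cost P \<mu>"
      using jump_value_le[OF inv comp jump] unfolding Max by blast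
    then show ?thesis using False by (intro bexI[of _ \<mu>]) (auto simp: m_measure_def)
  qed
  then obtain \<mu> where "\<mu> \<in> input_distributions n" "m_measure 4000 n f \<le> information_cost P \<mu>" by blast
  then show "ereal (m_measure 4000 n f) \<le> (SUP \<mu>\<in>input_distributions n. ereal (information_cost P \<mu>))"
    by (intro SUP_upper2) auto
qed

section \<open>Upper bound: composing and amplifying protocols\<close>

section \<open>Deterministic protocols\<close>

inductive det_computable :: "nat \<Rightarrow> (bitstring \<Rightarrow> bitstring \<Rightarrow> bool) \<Rightarrow> bool" where
  const: "det_computable k (\<lambda>x y. v)"
| alice: "det_computable k F0 \<Longrightarrow> det_computable k F1 \<Longrightarrow> det_computable (Suc k) (\<lambda>x y. if s x then F1 x y else F0 x y)"
| bob: "det_computable k F0 \<Longrightarrow> det_computable k F1 \<Longrightarrow> det_computable (Suc k) (\<lambda>x y. if s y then F1 x y else F0 x y)"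

lemma det_computable_protocol:
  assumes "det_computable k F"
  shows "\<exists>p. deterministic p \<and> (\<forall>x y. \<exists>t. messages p x y = return_pmf t \<and> length t \<le> k \<and> leaf_output p t = F x y)"
  using assms
proof induction
  case (const k v)
  show ?case by (intro exI[where x="Leaf v"]) simp
next
  case (alice k F0 F1 s)
  then obtain p0 p1 where p: "deterministic p0" "deterministic p1"
    "\<And>x y. \<exists>t. messages p0 x y = return_pmf t \<and> length t \<le> k \<and> leaf_output p0 t = F0 x y"
    "\<And>x y. \<exists>t. messages p1 x y = return_pmf t \<and> length t \<le> k \<and> leaf_output p1 t = F1 x y" by blast
  show ?case
  proof (intro exI[where x="Alice (\<lambda>x. return_pmf (s x)) p0 p1"] conjI allI)
    show "deterministic (Alice (\<lambda>x. return_pmf (s x)) p0 p1)" using p by auto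
    fix x y
    obtain t0 t1 where "messages p0 x y = return_pmf t0" "length t0 \<le> k" "leaf_output p0 t0 = F0 x y"
       "messages p1 x y = return_pmf t1" "length t1 \<le> k" "leaf_output p1 t1 = F1 x y" using p(3,4) by metis
    then show "\<exists>t. messages (Alice (\<lambda>x. return_pmf (s x)) p0 p1) x y = return_pmf t \<and> length t \<le> Suc k \<and>
        leaf_output (Alice (\<lambda>x. return_pmf (s x)) p0 p1) t = (if s x then F1 x y else F0 x y)"
      by (intro exI[where x="s x # (if s x then t1 else t0)"]) (auto simp: bind_return_pmf)
  qed
next
  case (bob k F0 F1 s)
  then obtain p0 p1 where p: "deterministic p0" "deterministic p1"
    "\<And>x y. \<exists>t. messages p0 x y = return_pmf t \<and> length t \<le> k \<and> leaf_output p0 t = F0 x y"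
    "\<And>x y. \<exists>t. messages p1 x y = return_pmf t \<and> length t \<le> k \<and> leaf_output p1 t = F1 x y" by blast
  show ?case
  proof (intro exI[where x="Bob (\<lambda>x. return_pmf (s x)) p0 p1"] conjI allI)
    show "deterministic (Bob (\<lambda>x. return_pmf (s x)) p0 p1)" using p by auto
    fix x y
    obtain t0 t1 where "messages p0 x y = return_pmf t0" "length t0 \<le> k" "leaf_output p0 t0 = F0 x y"
       "messages p1 x y = return_pmf t1" "length t1 \<le> k" "leaf_output p1 t1 = F1 x y" using p(3,4) by metis
    then show "\<exists>t. messages (Bob (\<lambda>x. return_pmf (s x)) p0 p1) x y = return_pmf t \<and> length t \<le> Suc k \<and>
        leaf_output (Bob (\<lambda>x. return_pmf (s x)) p0 p1) t = (if s y then F1 x y else F0 x y)"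
      by (intro exI[where x="s y # (if s y then t1 else t0)"]) (auto simp: bind_return_pmf)
  qed
qed

lemma det_computable_mono: "det_computable k F \<Longrightarrow> k \<le> k' \<Longrightarrow> det_computable k' F"
proof (induction arbitrary: k' rule: det_computable.induct)
  case (const k v)
  show ?case by (rule det_computable.const)
next
  case (alice k F0 F1 s)
  then obtain k'' where k: "k' = Suc k''" "k \<le> k''" by (cases k') auto
  show ?case unfolding k(1) by (rule det_computable.alice[OF alice.IH[OF k(2)]])
next
  case (bob k F0 F1 s)
  then obtain k'' where k: "k' = Suc k''" "k \<le> k''" by (cases k') auto
  show ?case unfolding k(1) by (rule det_computable.bob[OF bob.IH[OF k(2)]])
qed

lemma det_computable_compose: "det_computable k F \<Longrightarrow> det_computable k (\<lambda>x y. F (f x) (g y))"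
proof (induction rule: det_computable.induct)
  case (const k v)
  show ?case by (rule det_computable.const)
next
  case (alice k F0 F1 s)
  show ?case by (rule det_computable.alice[OF alice.IH, where s="\<lambda>x. s (f x)"])
next
  case (bob k F0 F1 s)
  show ?case by (rule det_computable.bob[OF bob.IH, where s="\<lambda>x. s (g x)"])
qed

lemma det_computable_swap: "det_computable k F \<Longrightarrow> det_computable k (\<lambda>x y. F y x)"
proof (induction rule: det_computable.induct)
  case (const k v)
  show ?case by (rule det_computable.const)
next
  case (alice k F0 F1 s)
  show ?case by (rule det_computable.bob[OF alice.IH, where s=s])
next
  case (bob k F0 F1 s)
  show ?case by (rule det_computable.alice[OF bob.IH, where s=s])
qed

text \<open>Sequential composition: protocols for F0 and F1 are grafted onto the leaves of one for
  G.\<close>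

lemma det_computable_if:
  assumes "det_computable k1 G" and F: "det_computable k2 F0" "det_computable k2 F1"
  shows "det_computable (k1 + k2) (\<lambda>x y. if G x y then F1 x y else F0 x y)"
  using assms(1)
proof (induction rule: det_computable.induct)
  case (const k v)
  show ?case using F by (cases v) (auto intro: det_computable_mono)
next
  case (alice k G0 G1 s)
  have "(\<lambda>x y. if (if s x then G1 x y else G0 x y) then F1 x y else F0 x y) =
     (\<lambda>x y. if s x then (if G1 x y then F1 x y else F0 x y) else (if G0 x y then F1 x y else F0 x y))"
    by (intro ext) auto
  then show ?case using det_computable.alice[OF alice.IH] by simp
next
  case (bob k G0 G1 s)
  have "(\<lambda>x y. if (if s y then G1 x y else G0 x y) then F1 x y else F0 x y) =
     (\<lambda>x y. if s y then (if G1 x y then F1 x y else F0 x y) else (if G0 x y then F1 x y else F0 x y))"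
    by (intro ext) auto
  then show ?case using det_computable.bob[OF bob.IH] by simp
qed

text \<open>The parity of \<open>s x\<close> is sent first, then recursively
  \<open>s x div 2\<close>.\<close>

lemma det_computable_alice_message:
  assumes "\<And>c. c < 2 ^ j \<Longrightarrow> det_computable k (F c)" "\<And>x. s x < (2::nat) ^ j"
  shows "det_computable (j + k) (\<lambda>x y. F (s x) x y)"
  using assms
proof (induction j arbitrary: F s)
  case 0
  then show ?case by simp
next
  case (Suc j)
  have s2: "s x div 2 < 2 ^ j" for x using Suc.prems(2)[of x] by (simp add: less_mult_imp_div_less mult.commute)
  have "det_computable (j + k) (\<lambda>x y. F (2 * (s x div 2)) x y)"
    by (rule Suc.IH[where F="\<lambda>c. F (2 * c)" and s="\<lambda>x. s x div 2"]) (use Suc.prems s2 in auto)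
  moreover have "det_computable (j + k) (\<lambda>x y. F (2 * (s x div 2) + 1) x y)"
    by (rule Suc.IH[where F="\<lambda>c. F (2 * c + 1)" and s="\<lambda>x. s x div 2"]) (use Suc.prems s2 in auto)
  ultimately have "det_computable (Suc (j + k)) (\<lambda>x y. if odd (s x) then F (2 * (s x div 2) + 1) x y else F (2 * (s x div 2)) x y)"
    by (rule det_computable.alice)
  moreover have "(\<lambda>x y. if odd (s x) then F (2 * (s x div 2) + 1) x y else F (2 * (s x div 2)) x y) = (\<lambda>x y. F (s x) x y)"
    by (intro ext) auto
  ultimately show ?case by simp
qed

lemma det_computable_bob_message:
  assumes "\<And>c. c < 2 ^ j \<Longrightarrow> det_computable k (F c)" "\<And>y. s y < (2::nat) ^ j"
  shows "det_computable (j + k) (\<lambda>x y. F (s y) x y)"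
  using det_computable_swap[OF det_computable_alice_message[where F="\<lambda>c x y. F c y x" and s=s and j=j and k=k]]
    assms det_computable_swap by blast

text \<open>Generalising over H carries the running count: a positive test replaces H by its
  shift.\<close>

lemma det_computable_count:
  assumes "\<And>j. j < N \<Longrightarrow> det_computable s (B j)"
  shows "det_computable (N * s) (\<lambda>x y. H (card {j. j < N \<and> B j x y}))"
  using assms
proof (induction N arbitrary: H)
  case 0
  show ?case by (simp add: det_computable.const)
next
  case (Suc N)
  have "card {j. j < Suc N \<and> B j x y} = card {j. j < N \<and> B j x y} + (if B N x y then 1 else 0)" for x y
  proof -
    have "{j. j < Suc N \<and> B j x y} = {j. j < N \<and> B j x y} \<union> (if B N x y then {N} else {})"
      by (auto simp: less_Suc_eq)
    then show ?thesis by simp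
  qed
  then have eq: "(\<lambda>x y. H (card {j. j < Suc N \<and> B j x y})) =
      (\<lambda>x y. if B N x y then H (card {j. j < N \<and> B j x y} + 1) else H (card {j. j < N \<and> B j x y}))"
    by (intro ext) simp
  have "det_computable (s + N * s) (\<lambda>x y. if B N x y then H (card {j. j < N \<and> B j x y} + 1) else H (card {j. j < N \<and> B j x y}))"
    by (rule det_computable_if[OF _ Suc.IH Suc.IH[where H="\<lambda>c. H (c + 1)"]]) (use Suc.prems in auto)
  then show ?case unfolding eq by simp
qed

text \<open>Take for u the least element with fewer than m elements above it. Its predecessor has at
  least m elements above it, all of them outside the part below u, which leaves fewer than m for
  that part.\<close>

lemma exists_splitting_element:
  fixes Us :: "nat set"
  assumes fin: "finite Us" and ne: "Us \<noteq> {}" and card: "card Us < 2 * m"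
  shows "\<exists>u\<in>Us. card {v\<in>Us. v < u} < m \<and> card {v\<in>Us. u < v} < m"
proof -
  define G where "G = {u\<in>Us. card {v\<in>Us. u < v} < m}"
  have m: "m > 0" using card by auto
  have "{v\<in>Us. Max Us < v} = {}" using fin by (auto simp: not_less)
  then have "Max Us \<in> G" unfolding G_def using fin ne m by (auto simp del: Collect_empty_eq)
  then have Gne: "G \<noteq> {}" and finG: "finite G" using fin by (auto simp: G_def)
  define u where "u = Min G"
  have uG: "u \<in> G" unfolding u_def using finG Gne by (rule Min_in)
  have "card {v\<in>Us. v < u} < m"
  proof (cases "{v\<in>Us. v < u} = {}")
    case True
    then show ?thesis using m by (simp del: Collect_empty_eq)
  next
    case False
    define w where "w = Max {v\<in>Us. v < u}"
    have w: "w \<in> {v\<in>Us. v < u}" unfolding w_def using fin False by (intro Max_in) auto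
    have wmax: "v \<le> w" if "v \<in> Us" "v < u" for v unfolding w_def using fin that by (intro Max_ge) auto
    have "w \<notin> G" using w Min_le[OF finG, of w] unfolding u_def by auto
    then have ge: "card {v\<in>Us. w < v} \<ge> m" using w by (auto simp: G_def)
    have "{v\<in>Us. v < u} \<inter> {v\<in>Us. w < v} = {}" using wmax by fastforce
    then have "card {v\<in>Us. v < u} + card {v\<in>Us. w < v} = card ({v\<in>Us. v < u} \<union> {v\<in>Us. w < v})"
      using fin by (subst card_Un_disjoint) auto
    also have "\<dots> \<le> card Us" using fin by (intro card_mono) auto
    finally show ?thesis using ge card by linarith
  qed
  then show ?thesis using uG unfolding G_def by blast
qed

text \<open>Binary search over thresholds. Correctness is conditional on monotone answers, because a
  run with erroneous random tests may violate monotonicity; the communication bound holds for every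
  run.\<close>

lemma det_computable_search:
  fixes Us :: "nat set" and T :: "nat \<Rightarrow> bitstring \<Rightarrow> bitstring \<Rightarrow> bool" and ans :: "nat set \<Rightarrow> bool"
  assumes "finite Us" "card Us < 2 ^ e" "\<And>u. u \<in> Us \<Longrightarrow> det_computable s (T u)"
  shows "\<exists>F. det_computable (e * s) F \<and> (\<forall>x y. (\<forall>u\<in>Us. \<forall>u'\<in>Us. u' \<le> u \<longrightarrow> T u x y \<longrightarrow> T u' x y) \<longrightarrow> F x y = ans {u\<in>Us. T u x y})"
  using assms
proof (induction e arbitrary: Us ans)
  case 0
  then have "Us = {}" by simp
  then show ?case by (intro exI[where x="\<lambda>x y. ans {}"]) (auto intro: det_computable.const)
next
  case (Suc e)
  show ?case
  proof (cases "Us = {}")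
    case True
    then show ?thesis by (intro exI[where x="\<lambda>x y. ans {}"]) (auto intro: det_computable.const)
  next
    case False
    then obtain u where u: "u \<in> Us" "card {v\<in>Us. v < u} < 2 ^ e" "card {v\<in>Us. u < v} < 2 ^ e"
      using exists_splitting_element[of Us "2 ^ e"] Suc.prems by auto
    obtain F0 where F0: "det_computable (e * s) F0"
      "\<And>x y. (\<forall>w\<in>{v\<in>Us. v < u}. \<forall>u'\<in>{v\<in>Us. v < u}. u' \<le> w \<longrightarrow> T w x y \<longrightarrow> T u' x y) \<Longrightarrow> F0 x y = ans {w\<in>{v\<in>Us. v < u}. T w x y}"
      using Suc.IH[OF _ u(2), of ans] Suc.prems by auto
    \<comment> \<open>If u passes, so do all thresholds below it; they are recorded by changing the
      function \<open>ans\<close> for the remaining search.\<close>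
    obtain F1 where F1: "det_computable (e * s) F1"
      "\<And>x y. (\<forall>w\<in>{v\<in>Us. u < v}. \<forall>u'\<in>{v\<in>Us. u < v}. u' \<le> w \<longrightarrow> T w x y \<longrightarrow> T u' x y) \<Longrightarrow> F1 x y = ans ({v\<in>Us. v \<le> u} \<union> {w\<in>{v\<in>Us. u < v}. T w x y})"
      using Suc.IH[OF _ u(3), of "\<lambda>S. ans ({v\<in>Us. v \<le> u} \<union> S)"] Suc.prems by auto
    show ?thesis
    proof (intro exI[where x="\<lambda>x y. if T u x y then F1 x y else F0 x y"] conjI allI impI)
      show "det_computable (Suc e * s) (\<lambda>x y. if T u x y then F1 x y else F0 x y)"
        using det_computable_if[OF Suc.prems(3)[OF u(1)] F0(1) F1(1)] by simp
      fix x y assume mono: "\<forall>u\<in>Us. \<forall>u'\<in>Us. u' \<le> u \<longrightarrow> T u x y \<longrightarrow> T u' x y"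
      show "(if T u x y then F1 x y else F0 x y) = ans {u \<in> Us. T u x y}"
      proof (cases "T u x y")
        case True
        have "F1 x y = ans ({v\<in>Us. v \<le> u} \<union> {w\<in>{v\<in>Us. u < v}. T w x y})"
          using mono by (intro F1(2)) blast
        also have "{v\<in>Us. v \<le> u} \<union> {w\<in>{v\<in>Us. u < v}. T w x y} = {w\<in>Us. T w x y}"
        proof -
          have "T v x y" if "v \<in> Us" "v \<le> u" for v using mono True u(1) that by blast
          then show ?thesis by force
        qed
        finally show ?thesis using True by simp
      next
        case False
        have "F0 x y = ans {w\<in>{v\<in>Us. v < u}. T w x y}"
          using mono by (intro F0(2)) blast
        also have "{w\<in>{v\<in>Us. v < u}. T w x y} = {w\<in>Us. T w x y}"
        proof -
          have "v < u" if "v \<in> Us" "T v x y" for v using mono False u(1) that not_less by blast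
          then show ?thesis by force
        qed
        finally show ?thesis using False by simp
      qed
    qed
  qed
qed

section \<open>Public coins and amplification\<close>

definition rand_computable :: "nat \<Rightarrow> real \<Rightarrow> (bitstring \<times> bitstring) set \<Rightarrow> (bitstring \<Rightarrow> bitstring \<Rightarrow> bool) \<Rightarrow> bool" where
  "rand_computable k \<epsilon> S g \<longleftrightarrow> (\<exists>(R :: nat pmf) F. (\<forall>r. det_computable k (F r)) \<and>
     (\<forall>(x, y)\<in>S. measure_pmf.prob R {r. F r x y \<noteq> g x y} \<le> \<epsilon>))"

text \<open>Public coins have to be natural numbers. As every pmf has countable support, coins of
  any type, such as labellings of positions, can be encoded.\<close>

lemma nat_encoding_pmf:
  fixes R :: "'r pmf"
  shows "\<exists>(R' :: nat pmf) (dec :: nat \<Rightarrow> 'r). \<forall>Q. measure_pmf.prob R' {m. Q (dec m)} = measure_pmf.prob R {r. Q r}"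
proof (intro exI allI)
  fix Q
  let ?A = "set_pmf R"
  have "measure_pmf.prob (map_pmf (to_nat_on ?A) R) {m. Q (from_nat_into ?A m)} = measure_pmf.prob R {r. Q (from_nat_into ?A (to_nat_on ?A r))}"
    by (simp add: vimage_def)
  also have "\<dots> = measure_pmf.prob R {r. Q r}"
    by (intro measure_pmf.finite_measure_eq_AE AE_pmfI) (auto simp: countable_set_pmf)
  finally show "measure_pmf.prob (map_pmf (to_nat_on ?A) R) {m. Q (from_nat_into ?A m)} = measure_pmf.prob R {r. Q r}" .
qed

lemma rand_computableI:
  fixes R :: "'r pmf"
  assumes "\<And>r. det_computable k (F r)" "\<And>x y. (x, y) \<in> S \<Longrightarrow> measure_pmf.prob R {r. F r x y \<noteq> g x y} \<le> \<epsilon>"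
  shows "rand_computable k \<epsilon> S g"
proof -
  obtain R' :: "nat pmf" and dec where R': "\<forall>Q. measure_pmf.prob R' {m. Q (dec m)} = measure_pmf.prob R {r. Q r}"
    using nat_encoding_pmf[of R] by blast
  have "measure_pmf.prob R' {m. F (dec m) x y \<noteq> g x y} \<le> \<epsilon>" if "(x, y) \<in> S" for x y
    using assms(2)[OF that] spec[OF R', of "\<lambda>r. F r x y \<noteq> g x y"] by simp
  then show ?thesis unfolding rand_computable_def
    using assms(1) by (intro exI[where x=R'] exI[where x="\<lambda>m. F (dec m)"]) auto
qed

lemma rand_computableE:
  assumes "rand_computable k \<epsilon> S g"
  obtains R :: "nat pmf" and F where "\<And>r. det_computable k (F r)"
    "\<And>x y. (x, y) \<in> S \<Longrightarrow> measure_pmf.prob R {r. F r x y \<noteq> g x y} \<le> \<epsilon>"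
proof -
  obtain R :: "nat pmf" and F where RF: "\<forall>r. det_computable k (F r)"
     "\<forall>(x, y)\<in>S. measure_pmf.prob R {r. F r x y \<noteq> g x y} \<le> \<epsilon>"
    using assms unfolding rand_computable_def by (elim exE conjE)
  show ?thesis by (rule that[of F R]) (use RF in auto)
qed

lemma rand_computable_protocol:
  assumes rc: "rand_computable k (1/3) S g"
    and S: "\<And>x y v. x \<in> cube n \<Longrightarrow> y \<in> cube n \<Longrightarrow> f x y = Some v \<Longrightarrow> (x, y) \<in> S \<and> g x y = v"
  shows "\<exists>P. public_coin P \<and> computes n f P \<and> communication_at_most n P k"
proof -
  obtain R :: "nat pmf" and F where F: "\<And>r. det_computable k (F r)"
    and err: "\<And>x y. (x, y) \<in> S \<Longrightarrow> measure_pmf.prob R {r. F r x y \<noteq> g x y} \<le> 1/3"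
    by (rule rand_computableE[OF rc], rule that)
  have "\<forall>r. \<exists>p. deterministic p \<and> (\<forall>x y. \<exists>t. messages p x y = return_pmf t \<and> length t \<le> k \<and> leaf_output p t = F r x y)"
    using det_computable_protocol[OF F] by blast
  then obtain p where p: "\<forall>r. deterministic (p r) \<and> (\<forall>x y. \<exists>t. messages (p r) x y = return_pmf t \<and> length t \<le> k \<and> leaf_output (p r) t = F r x y)"
    by (rule choice[THEN exE])
  then have det: "deterministic (p r)" for r by blast
  define t where "t = (\<lambda>r x y. SOME t. messages (p r) x y = return_pmf t \<and> length t \<le> k \<and> leaf_output (p r) t = F r x y)"
  have "messages (p r) x y = return_pmf (t r x y) \<and> length (t r x y) \<le> k \<and> leaf_output (p r) (t r x y) = F r x y" for r x y
    unfolding t_def by (rule someI_ex) (use p in blast)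
  then have t: "messages (p r) x y = return_pmf (t r x y)" "length (t r x y) \<le> k"
     "leaf_output (p r) (t r x y) = F r x y" for r x y by blast+
  let ?P = "(R, p)"
  have tr: "transcript ?P x y = map_pmf (\<lambda>r. (r, t r x y)) R" for x y
    unfolding transcript_def by (simp add: t map_pmf_def bind_return_pmf bind_assoc_pmf)
  have res: "result ?P x y = map_pmf (\<lambda>r. F r x y) R" for x y
    unfolding result_def tr by (simp add: pmf.map_comp o_def t)
  have "computes n f ?P" unfolding computes_def
  proof (intro ballI allI impI)
    fix x y v assume xy: "x \<in> cube n" "y \<in> cube n" "f x y = Some v"
    have e: "measure_pmf.prob R {r. F r x y \<noteq> v} \<le> 1/3" using S[OF xy] err[of x y] by simp
    have "{r. F r x y \<noteq> v} = UNIV - {r. F r x y = v}" by auto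
    then have "measure_pmf.prob R {r. F r x y \<noteq> v} = 1 - measure_pmf.prob R {r. F r x y = v}"
      using measure_pmf.prob_compl[of "{r. F r x y = v}" R] by simp
    then have "measure_pmf.prob R {r. F r x y = v} \<ge> 2/3" using e by linarith
    then show "2/3 \<le> pmf (result ?P x y) v" unfolding res pmf_map by (simp add: vimage_def)
  qed
  moreover have "public_coin ?P" unfolding public_coin_def using det by simp
  moreover have "communication_at_most n ?P k" unfolding communication_at_most_def tr using t(2) by auto
  ultimately show ?thesis by blast
qed

text \<open>A single public string has to serve all tests, because it is decided during the run
  which of them are performed. The product law has the required marginals.\<close>

lemma rand_computable_family:
  fixes A :: "'a set"
  assumes fin: "finite A" and rc: "\<And>a. a \<in> A \<Longrightarrow> rand_computable k \<epsilon> (S a) (g a)"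
  obtains R :: "('a \<Rightarrow> nat) pmf" and F where "\<And>a r. a \<in> A \<Longrightarrow> det_computable k (F a r)"
    "\<And>a x y. a \<in> A \<Longrightarrow> (x, y) \<in> S a \<Longrightarrow> measure_pmf.prob R {r. F a r x y \<noteq> g a x y} \<le> \<epsilon>"
proof -
  have "\<forall>a\<in>A. \<exists>RF :: nat pmf \<times> (nat \<Rightarrow> bitstring \<Rightarrow> bitstring \<Rightarrow> bool). (\<forall>r. det_computable k (snd RF r)) \<and>
      (\<forall>(x, y)\<in>S a. measure_pmf.prob (fst RF) {r. snd RF r x y \<noteq> g a x y} \<le> \<epsilon>)"
  proof
    fix a assume "a \<in> A"
    from rc[OF this] obtain R :: "nat pmf" and F where RF: "\<forall>r. det_computable k (F r)"
      "\<forall>(x, y)\<in>S a. measure_pmf.prob R {r. F r x y \<noteq> g a x y} \<le> \<epsilon>"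
      unfolding rand_computable_def by (elim exE conjE)
    then show "\<exists>RF :: nat pmf \<times> (nat \<Rightarrow> bitstring \<Rightarrow> bitstring \<Rightarrow> bool). (\<forall>r. det_computable k (snd RF r)) \<and>
      (\<forall>(x, y)\<in>S a. measure_pmf.prob (fst RF) {r. snd RF r x y \<noteq> g a x y} \<le> \<epsilon>)"
      by (intro exI[where x="(R, F)"]) simp
  qed
  then obtain RF :: "'a \<Rightarrow> nat pmf \<times> (nat \<Rightarrow> bitstring \<Rightarrow> bitstring \<Rightarrow> bool)" where
    *: "\<forall>a\<in>A. (\<forall>r. det_computable k (snd (RF a) r)) \<and>
      (\<forall>(x, y)\<in>S a. measure_pmf.prob (fst (RF a)) {r. snd (RF a) r x y \<noteq> g a x y} \<le> \<epsilon>)"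
    by (rule bchoice[THEN exE])
  define R where "R = (\<lambda>a. fst (RF a))"
  define F where "F = (\<lambda>a. snd (RF a))"
  have RF: "det_computable k (F a r)" if "a \<in> A" for a r using * that unfolding F_def by blast
  have RF2: "measure_pmf.prob (R a) {r. F a r x y \<noteq> g a x y} \<le> \<epsilon>" if "a \<in> A" "(x, y) \<in> S a" for a x y
    using * that unfolding F_def R_def by blast
  let ?R = "Pi_pmf A 0 R"
  show ?thesis
  proof
    show "det_computable k (F a (r a))" if "a \<in> A" for a r using RF[OF that] .
    fix a x y assume a: "a \<in> A" and xy: "(x, y) \<in> S a"
    have "measure_pmf.prob ?R {r. F a (r a) x y \<noteq> g a x y} = measure_pmf.prob (map_pmf (\<lambda>r. r a) ?R) {r. F a r x y \<noteq> g a x y}"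
      by (simp add: vimage_def)
    also have "map_pmf (\<lambda>r. r a) ?R = R a" using Pi_pmf_component[OF fin, of a 0 R] a by simp
    finally show "measure_pmf.prob ?R {r. F a (r a) x y \<noteq> g a x y} \<le> \<epsilon>" using RF2[OF a xy] by simp
  qed
qed

text \<open>The union bound covers all thresholds, because the visited ones depend on the coins. If
  no test errs, the answers inherit monotonicity from T and the search is correct.\<close>

lemma rand_computable_search:
  fixes Us :: "nat set"
  assumes fin: "finite Us" and card: "card Us < 2 ^ e"
    and rc: "\<And>u. u \<in> Us \<Longrightarrow> rand_computable s \<epsilon> S (T u)"
    and mono: "\<And>x y u u'. (x, y) \<in> S \<Longrightarrow> u \<in> Us \<Longrightarrow> u' \<in> Us \<Longrightarrow> u' \<le> u \<Longrightarrow> T u x y \<Longrightarrow> T u' x y"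
  shows "rand_computable (e * s) (real (card Us) * \<epsilon>) S (\<lambda>x y. ans {u\<in>Us. T u x y})"
proof -
  obtain R :: "(nat \<Rightarrow> nat) pmf" and F where F: "\<And>u r. u \<in> Us \<Longrightarrow> det_computable s (F u r)"
    and err: "\<And>u x y. u \<in> Us \<Longrightarrow> (x, y) \<in> S \<Longrightarrow> measure_pmf.prob R {r. F u r x y \<noteq> T u x y} \<le> \<epsilon>"
    by (rule rand_computable_family[OF fin, of s \<epsilon> "\<lambda>_. S" T, OF rc], assumption, rule that)
  have "\<forall>r. \<exists>G. det_computable (e * s) G \<and> (\<forall>x y. (\<forall>u\<in>Us. \<forall>u'\<in>Us. u' \<le> u \<longrightarrow> F u r x y \<longrightarrow> F u' r x y) \<longrightarrow> G x y = ans {u\<in>Us. F u r x y})"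
  proof
    fix r
    show "\<exists>G. det_computable (e * s) G \<and> (\<forall>x y. (\<forall>u\<in>Us. \<forall>u'\<in>Us. u' \<le> u \<longrightarrow> F u r x y \<longrightarrow> F u' r x y) \<longrightarrow> G x y = ans {u\<in>Us. F u r x y})"
      by (rule det_computable_search[OF fin card, where T="\<lambda>u. F u r"]) (rule F)
  qed
  then obtain G where GG: "\<forall>r. det_computable (e * s) (G r) \<and> (\<forall>x y. (\<forall>u\<in>Us. \<forall>u'\<in>Us. u' \<le> u \<longrightarrow> F u r x y \<longrightarrow> F u' r x y) \<longrightarrow> G r x y = ans {u\<in>Us. F u r x y})"
    by (rule choice[THEN exE])
  then have G: "det_computable (e * s) (G r)"
    "(\<forall>u\<in>Us. \<forall>u'\<in>Us. u' \<le> u \<longrightarrow> F u r x y \<longrightarrow> F u' r x y) \<Longrightarrow> G r x y = ans {u\<in>Us. F u r x y}" for r x y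
    by blast+
  show ?thesis
  proof (rule rand_computableI[where F=G and R=R])
    show "det_computable (e * s) (G r)" for r by (rule G(1))
    fix x y assume xy: "(x, y) \<in> S"
    have "{r. G r x y \<noteq> ans {u\<in>Us. T u x y}} \<subseteq> (\<Union>u\<in>Us. {r. F u r x y \<noteq> T u x y})"
    proof (rule subsetI, rule ccontr)
      fix r assume r: "r \<in> {r. G r x y \<noteq> ans {u\<in>Us. T u x y}}" "r \<notin> (\<Union>u\<in>Us. {r. F u r x y \<noteq> T u x y})"
      then have eq: "F u r x y = T u x y" if "u \<in> Us" for u using that by auto
      then have "{u\<in>Us. F u r x y} = {u\<in>Us. T u x y}" by auto
      moreover have "G r x y = ans {u\<in>Us. F u r x y}"
        by (rule G(2)) (use eq mono[OF xy] in metis)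
      ultimately show False using r(1) by simp
    qed
    then have "measure_pmf.prob R {r. G r x y \<noteq> ans {u\<in>Us. T u x y}} \<le> measure_pmf.prob R (\<Union>u\<in>Us. {r. F u r x y \<noteq> T u x y})"
      by (intro measure_pmf.finite_measure_mono) auto
    also have "\<dots> \<le> (\<Sum>u\<in>Us. measure_pmf.prob R {r. F u r x y \<noteq> T u x y})"
      by (intro measure_pmf.finite_measure_subadditive_finite) (use fin in auto)
    also have "\<dots> \<le> real (card Us) * \<epsilon>" using err xy by (intro sum_bounded_above) auto
    finally show "measure_pmf.prob R {r. G r x y \<noteq> ans {u\<in>Us. T u x y}} \<le> real (card Us) * \<epsilon>" .
  qed
qed

lemma rand_computable_weights:
  assumes nj: "n < 2 ^ j" and S: "S \<subseteq> cube n \<times> cube n" and wle: "\<And>x. x \<in> cube n \<Longrightarrow> weight x \<le> n"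
    and rc: "\<And>a b. a \<le> n \<Longrightarrow> b \<le> n \<Longrightarrow> rand_computable k \<epsilon> {(x, y)\<in>S. weight x = a \<and> weight y = b} (g a b)"
  shows "rand_computable (j + (j + k)) \<epsilon> S (\<lambda>x y. g (weight x) (weight y) x y)"
proof -
  have rc': "rand_computable k \<epsilon> {(x, y)\<in>S. weight x = fst ab \<and> weight y = snd ab} (g (fst ab) (snd ab))"
    if "ab \<in> {..n} \<times> {..n}" for ab
    using that by (intro rc) auto
  obtain R :: "(nat \<times> nat \<Rightarrow> nat) pmf" and F where F: "\<And>ab r. ab \<in> {..n} \<times> {..n} \<Longrightarrow> det_computable k (F ab r)"
    and err: "\<And>ab x y. ab \<in> {..n} \<times> {..n} \<Longrightarrow> (x, y) \<in> {(x, y)\<in>S. weight x = fst ab \<and> weight y = snd ab} \<Longrightarrow>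
       measure_pmf.prob R {r. F ab r x y \<noteq> g (fst ab) (snd ab) x y} \<le> \<epsilon>"
    by (rule rand_computable_family[OF _ rc', of "{..n} \<times> {..n}"], simp, assumption, rule that)
  \<comment> \<open>Clipped at n because \<open>det_computable\<close> speaks of lists of any length
    and the message must always fit into j bits.\<close>
  define w where "w = (\<lambda>x. min (weight x) n)"
  define F' where "F' = (\<lambda>r a b. if a \<le> n \<and> b \<le> n then F (a, b) r else (\<lambda>x y. False))"
  have F': "det_computable k (F' r a b)" for r a b
    unfolding F'_def using F[of "(a, b)" r] by (auto intro: det_computable.const)
  have wj: "w x < 2 ^ j" for x unfolding w_def using nj by (simp add: min_def)
  show ?thesis
  proof (rule rand_computableI[where F="\<lambda>r x y. F' r (w x) (w y) x y" and R=R])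
    fix r
    have "det_computable (j + k) (\<lambda>x y. F' r a (w y) x y)" for a
      by (rule det_computable_bob_message[where F="\<lambda>b. F' r a b"]) (use F' wj in auto)
    then show "det_computable (j + (j + k)) (\<lambda>x y. F' r (w x) (w y) x y)"
      by (rule det_computable_alice_message[where F="\<lambda>a x y. F' r a (w y) x y"]) (rule wj)
  next
    fix x y assume xy: "(x, y) \<in> S"
    have "weight x \<le> n" "weight y \<le> n" using xy S wle by auto
    then show "measure_pmf.prob R {r. F' r (w x) (w y) x y \<noteq> g (weight x) (weight y) x y} \<le> \<epsilon>"
      using err[of "(weight x, weight y)" x y] xy by (simp add: F'_def w_def min_def)
  qed
qed

definition gap_testable :: "nat \<Rightarrow> real \<Rightarrow> (bitstring \<times> bitstring) set \<Rightarrow> (bitstring \<times> bitstring) set \<Rightarrow> bool" where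
  "gap_testable s \<eta> S1 S0 \<longleftrightarrow> (\<exists>(R :: nat pmf) F \<theta>. (\<forall>r. det_computable s (F r)) \<and>
     (\<forall>(x, y)\<in>S1. measure_pmf.prob R {r. F r x y} \<ge> \<theta> + \<eta>) \<and> (\<forall>(x, y)\<in>S0. measure_pmf.prob R {r. F r x y} \<le> \<theta> - \<eta>))"

lemma gap_testableI:
  fixes R :: "'r pmf"
  assumes "\<And>r. det_computable s (F r)" "\<And>x y. (x, y) \<in> S1 \<Longrightarrow> measure_pmf.prob R {r. F r x y} \<ge> \<theta> + \<eta>"
     "\<And>x y. (x, y) \<in> S0 \<Longrightarrow> measure_pmf.prob R {r. F r x y} \<le> \<theta> - \<eta>"
  shows "gap_testable s \<eta> S1 S0"
proof -
  obtain R' :: "nat pmf" and dec where R': "\<forall>Q. measure_pmf.prob R' {m. Q (dec m)} = measure_pmf.prob R {r. Q r}"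
    using nat_encoding_pmf[of R] by blast
  have "measure_pmf.prob R' {m. F (dec m) x y} = measure_pmf.prob R {r. F r x y}" for x y
    using spec[OF R', of "\<lambda>r. F r x y"] by simp
  then show ?thesis unfolding gap_testable_def
    using assms by (intro exI[where x=R'] exI[where x="\<lambda>m. F (dec m)"] exI[where x=\<theta>]) auto
qed

lemma gap_testableE:
  assumes "gap_testable s \<eta> S1 S0"
  obtains R :: "nat pmf" and F \<theta> where "\<And>r. det_computable s (F r)" "\<And>x y. (x, y) \<in> S1 \<Longrightarrow> measure_pmf.prob R {r. F r x y} \<ge> \<theta> + \<eta>"
     "\<And>x y. (x, y) \<in> S0 \<Longrightarrow> measure_pmf.prob R {r. F r x y} \<le> \<theta> - \<eta>"
proof -
  obtain R :: "nat pmf" and F \<theta> where RF: "\<forall>r. det_computable s (F r)"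
     "\<forall>(x, y)\<in>S1. measure_pmf.prob R {r. F r x y} \<ge> \<theta> + \<eta>" "\<forall>(x, y)\<in>S0. measure_pmf.prob R {r. F r x y} \<le> \<theta> - \<eta>"
    using assms unfolding gap_testable_def by (elim exE conjE)
  show ?thesis by (rule that[of F \<theta> R]) (use RF in auto)
qed

lemma gap_testable_compose:
  assumes "gap_testable s \<eta> S1 S0" "\<And>x y. (x, y) \<in> S1' \<Longrightarrow> (f x, g y) \<in> S1" "\<And>x y. (x, y) \<in> S0' \<Longrightarrow> (f x, g y) \<in> S0"
  shows "gap_testable s \<eta> S1' S0'"
proof -
  obtain R :: "nat pmf" and F \<theta> where "\<And>r. det_computable s (F r)" "\<And>x y. (x, y) \<in> S1 \<Longrightarrow> measure_pmf.prob R {r. F r x y} \<ge> \<theta> + \<eta>"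
     "\<And>x y. (x, y) \<in> S0 \<Longrightarrow> measure_pmf.prob R {r. F r x y} \<le> \<theta> - \<eta>"
    by (rule gap_testableE[OF assms(1)], rule that)
  then show ?thesis using assms(2,3)
    by (intro gap_testableI[where F="\<lambda>r x y. F r (f x) (g y)" and R=R and \<theta>=\<theta>]) (auto intro: det_computable_compose)
qed

lemma gap_testable_swap:
  assumes "gap_testable s \<eta> S1 S0" "\<And>x y. (x, y) \<in> S1' \<Longrightarrow> (y, x) \<in> S1" "\<And>x y. (x, y) \<in> S0' \<Longrightarrow> (y, x) \<in> S0"
  shows "gap_testable s \<eta> S1' S0'"
proof -
  obtain R :: "nat pmf" and F \<theta> where "\<And>r. det_computable s (F r)" "\<And>x y. (x, y) \<in> S1 \<Longrightarrow> measure_pmf.prob R {r. F r x y} \<ge> \<theta> + \<eta>"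
     "\<And>x y. (x, y) \<in> S0 \<Longrightarrow> measure_pmf.prob R {r. F r x y} \<le> \<theta> - \<eta>"
    by (rule gap_testableE[OF assms(1)], rule that)
  then show ?thesis using assms(2,3)
    by (intro gap_testableI[where F="\<lambda>r x y. F r y x" and R=R and \<theta>=\<theta>]) (auto intro: det_computable_swap)
qed

lemma gap_testable_mono:
  assumes "gap_testable s \<eta> S1 S0" "s \<le> s'" "\<eta>' \<le> \<eta>"
  shows "gap_testable s' \<eta>' S1 S0"
proof -
  obtain R :: "nat pmf" and F \<theta> where F: "\<And>r. det_computable s (F r)" and p: "\<And>x y. (x, y) \<in> S1 \<Longrightarrow> measure_pmf.prob R {r. F r x y} \<ge> \<theta> + \<eta>"
     "\<And>x y. (x, y) \<in> S0 \<Longrightarrow> measure_pmf.prob R {r. F r x y} \<le> \<theta> - \<eta>"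
    by (rule gap_testableE[OF assms(1)], rule that)
  show ?thesis
  proof (rule gap_testableI[where F=F and R=R and \<theta>=\<theta>])
    show "det_computable s' (F r)" for r using det_computable_mono[OF F assms(2)] .
  qed (use p assms(3) in fastforce)+
qed

lemma gap_testable_complement:
  assumes "gap_testable s \<eta> S0 S1"
  shows "gap_testable s \<eta> S1 S0"
proof -
  obtain R :: "nat pmf" and F \<theta> where F: "\<And>r. det_computable s (F r)" and p: "\<And>x y. (x, y) \<in> S0 \<Longrightarrow> measure_pmf.prob R {r. F r x y} \<ge> \<theta> + \<eta>"
     "\<And>x y. (x, y) \<in> S1 \<Longrightarrow> measure_pmf.prob R {r. F r x y} \<le> \<theta> - \<eta>"
    by (rule gap_testableE[OF assms(1)], rule that)
  have c: "measure_pmf.prob R {r. \<not> F r x y} = 1 - measure_pmf.prob R {r. F r x y}" for x y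
  proof -
    have "{r. \<not> F r x y} = UNIV - {r. F r x y}" by auto
    then show ?thesis using measure_pmf.prob_compl[of "{r. F r x y}" R] by simp
  qed
  show ?thesis
  proof (rule gap_testableI[where F="\<lambda>r x y. \<not> F r x y" and R=R and \<theta>="1 - \<theta>"])
    fix r
    have "det_computable (s + 0) (\<lambda>x y. if F r x y then False else True)"
      by (rule det_computable_if[OF F]) (rule det_computable.const)+
    moreover have "(\<lambda>x y. if F r x y then False else True) = (\<lambda>x y. \<not> F r x y)" by (intro ext) simp
    ultimately show "det_computable s (\<lambda>x y. \<not> F r x y)" by simp
  qed (use p in \<open>fastforce simp: c\<close>)+
qed

text \<open>In N independent runs the number of acceptances is compared with \<theta> * N;
  Hoeffding's inequality bounds both kinds of error.\<close>

lemma gap_testable_amplify: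
  assumes gt: "gap_testable s \<eta> S1 S0" and \<eta>: "\<eta> > 0" and N: "N \<ge> 1" and \<epsilon>: "exp (- 2 * real N * \<eta>\<^sup>2) \<le> \<epsilon>"
    and S1: "\<And>x y. (x, y) \<in> S1 \<Longrightarrow> g x y" and S0: "\<And>x y. (x, y) \<in> S0 \<Longrightarrow> \<not> g x y"
  shows "rand_computable (N * s) \<epsilon> (S1 \<union> S0) g"
proof -
  obtain R :: "nat pmf" and F \<theta> where F: "\<And>r. det_computable s (F r)"
    and p1: "\<And>x y. (x, y) \<in> S1 \<Longrightarrow> measure_pmf.prob R {r. F r x y} \<ge> \<theta> + \<eta>"
    and p0: "\<And>x y. (x, y) \<in> S0 \<Longrightarrow> measure_pmf.prob R {r. F r x y} \<le> \<theta> - \<eta>"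
    by (rule gap_testableE[OF gt], rule that)
  define RR where "RR = Pi_pmf {..<N} 0 (\<lambda>_. R)"
  define cnt where "cnt = (\<lambda>r x y. card {j. j < N \<and> F (r j) x y})"
  define G where "G = (\<lambda>r x y. real (cnt r x y) > \<theta> * N)"
  have bin: "map_pmf (\<lambda>r. cnt r x y) RR = binomial_pmf N (measure_pmf.prob R {r. F r x y})" for x y
  proof -
    define p where "p = measure_pmf.prob R {r. F r x y}"
    have p: "p \<in> {0..1}" by (simp add: p_def)
    have b: "map_pmf (\<lambda>r. F r x y) R = bernoulli_pmf p"
    proof (rule pmf_eqI)
      fix v
      have "pmf (map_pmf (\<lambda>r. F r x y) R) True = p" by (simp add: pmf_map vimage_def p_def)
      moreover have "pmf (map_pmf (\<lambda>r. F r x y) R) False = 1 - p"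
      proof -
        have "{r. \<not> F r x y} = UNIV - {r. F r x y}" by auto
        then show ?thesis using measure_pmf.prob_compl[of "{r. F r x y}" R] by (simp add: pmf_map vimage_def p_def)
      qed
      ultimately show "pmf (map_pmf (\<lambda>r. F r x y) R) v = pmf (bernoulli_pmf p) v" using p by (cases v) auto
    qed
    \<comment> \<open>The default \<open>F 0 x y\<close> is the image of the default 0 of
      \<open>RR\<close>, as \<open>Pi_pmf_map\<close> demands.\<close>
    have "binomial_pmf N p = map_pmf (\<lambda>v. card {i\<in>{..<N}. v i}) (Pi_pmf {..<N} (F 0 x y) (\<lambda>_. bernoulli_pmf p))"
      by (rule binomial_pmf_altdef') (use p in auto)
    also have "Pi_pmf {..<N} (F 0 x y) (\<lambda>_. bernoulli_pmf p) = map_pmf (\<lambda>r j. F (r j) x y) RR"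
      unfolding RR_def b[symmetric]
      by (subst Pi_pmf_map[where dflt=0 and f="\<lambda>r. F r x y"]) (auto simp: fun_eq_iff intro!: map_pmf_cong)
    also have "map_pmf (\<lambda>v. card {i\<in>{..<N}. v i}) (map_pmf (\<lambda>r j. F (r j) x y) RR) = map_pmf (\<lambda>r. cnt r x y) RR"
      unfolding cnt_def by (simp add: pmf.map_comp o_def)
    finally show ?thesis unfolding p_def ..
  qed
  have prob: "measure_pmf.prob RR {r. Q (cnt r x y)} = measure_pmf.prob (binomial_pmf N (measure_pmf.prob R {r. F r x y})) {c. Q c}" for Q x y
    unfolding bin[symmetric] by (simp add: vimage_def)
  have N0: "real N > 0" using N by simp
  show ?thesis
  proof (rule rand_computableI[where F=G and R=RR])
    show "det_computable (N * s) (G r)" for r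
      unfolding G_def cnt_def by (rule det_computable_count[where B="\<lambda>j. F (r j)"]) (rule F)
    fix x y assume xy: "(x, y) \<in> S1 \<union> S0"
    define p where "p = measure_pmf.prob R {r. F r x y}"
    interpret binomial_distribution N p by unfold_locales (simp add: p_def)
    have exp_eq: "exp (- 2 * real N * \<eta>\<^sup>2) \<le> \<epsilon>" by fact
    from xy show "measure_pmf.prob RR {r. G r x y \<noteq> g x y} \<le> \<epsilon>"
    proof
      assume 1: "(x, y) \<in> S1"
      have "measure_pmf.prob RR {r. G r x y \<noteq> g x y} = measure_pmf.prob (binomial_pmf N p) {c. \<not> real c > \<theta> * N}"
        using S1[OF 1] unfolding G_def p_def by (simp add: prob[where Q="\<lambda>c. \<not> real c > \<theta> * N"])
      also have "\<dots> \<le> measure_pmf.prob (binomial_pmf N p) {c. real c / N \<le> p - \<eta>}"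
      proof (intro measure_pmf.finite_measure_mono subsetI)
        fix c assume "c \<in> {c. \<not> real c > \<theta> * N}"
        then have "real c / N \<le> \<theta>" using N0 by (simp add: divide_le_eq)
        then show "c \<in> {c. real c / N \<le> p - \<eta>}" using p1[OF 1] unfolding p_def by simp
      qed auto
      also have "\<dots> \<le> exp (- 2 * real N * \<eta>\<^sup>2)" using prob_le'[of \<eta>] N \<eta> by simp
      finally show ?thesis using exp_eq by linarith
    next
      assume 0: "(x, y) \<in> S0"
      have "measure_pmf.prob RR {r. G r x y \<noteq> g x y} = measure_pmf.prob (binomial_pmf N p) {c. real c > \<theta> * N}"
        using S0[OF 0] unfolding G_def p_def by (simp add: prob[where Q="\<lambda>c. real c > \<theta> * N"])
      also have "\<dots> \<le> measure_pmf.prob (binomial_pmf N p) {c. real c / N \<ge> p + \<eta>}"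
      proof (intro measure_pmf.finite_measure_mono subsetI)
        fix c assume "c \<in> {c. real c > \<theta> * N}"
        then have "real c / N \<ge> \<theta>" using N0 by (simp add: le_divide_eq)
        then show "c \<in> {c. real c / N \<ge> p + \<eta>}" using p0[OF 0] unfolding p_def by simp
      qed auto
      also have "\<dots> \<le> exp (- 2 * real N * \<eta>\<^sup>2)" using prob_ge'[of \<eta>] N \<eta> by simp
      finally show ?thesis using exp_eq by linarith
    qed
  qed
qed

section \<open>Sketches that test a single jump\<close>

section \<open>The parity sketch\<close>

text \<open>For exponent u Bernoulli's inequality yields only 0. Applied to two halves h1 and h2 of
  u it yields h1 * h2 / u^2, which is at least 1/8.\<close>

lemma one_minus_inverse_power_ge:
  fixes u :: nat
  assumes "u \<ge> 2" "k \<le> u"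
  shows "(1 - 1 / real u) ^ k \<ge> 1/8"
proof -
  define h1 where "h1 = u div 2"
  define h2 where "h2 = u - h1"
  have h: "h1 + h2 = u" "h1 \<ge> 1" "h2 \<ge> h1" "h2 \<le> h1 + 1" unfolding h1_def h2_def using assms by auto
  have b: "(1 - 1 / real u) ^ h \<ge> 1 - real h / real u" for h
    using Bernoulli_inequality[of "- 1 / real u" h] assms by (simp add: divide_simps)
  have u: "real u = real h1 + real h2" using h by simp
  have nn: "0 \<le> 1 - real h1 / real u" "0 \<le> 1 - real h2 / real u"
    using h assms by (auto simp: divide_le_eq)
  have "(1 - real h1 / real u) * (1 - real h2 / real u) = real h2 * real h1 / (real u)\<^sup>2"
    using u assms by (simp add: field_simps power2_eq_square)
  moreover have "(real u)\<^sup>2 \<le> 8 * (real h2 * real h1)"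
  proof -
    have "real h2 \<le> 2 * real h1" using h by linarith
    then have "real h2 * real h2 \<le> 2 * real h1 * real h2" by (intro mult_right_mono) auto
    then have "real h2 * real h2 \<le> 2 * (real h2 * real h1)" by (simp add: mult_ac)
    moreover have "real h1 * real h1 \<le> real h2 * real h1" using h by (intro mult_right_mono) auto
    moreover have "0 \<le> real h2 * real h1" by simp
    moreover have "(real u)\<^sup>2 = real h1 * real h1 + 2 * (real h2 * real h1) + real h2 * real h2"
      unfolding u power2_eq_square by (simp add: algebra_simps)
    ultimately show ?thesis by linarith
  qed
  ultimately have "1/8 \<le> (1 - real h1 / real u) * (1 - real h2 / real u)"
    using assms by (simp add: le_divide_eq)
  also have "\<dots> \<le> (1 - 1 / real u) ^ h1 * (1 - 1 / real u) ^ h2"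
    using b nn assms by (intro mult_mono) (auto intro!: zero_le_power)
  also have "\<dots> = (1 - 1 / real u) ^ u" using h by (simp add: power_add[symmetric])
  also have "\<dots> \<le> (1 - 1 / real u) ^ k" using assms by (intro power_decreasing) auto
  finally show ?thesis .
qed

text \<open>The difference is q^l (1 - q^k) with q = 1 - 1/u and k = u - l. Here q^l is at least
  1/8, and q^k (1 + 1/u)^k \<le> 1 turns Bernoulli's lower bound for the second factor into an upper
  bound for q^k.\<close>

lemma one_minus_inverse_power_diff:
  fixes u :: nat
  assumes u: "u \<ge> 2" and l: "l < u"
  shows "(1 - 1 / real u) ^ l - (1 - 1 / real u) ^ u \<ge> real (u - l) / (16 * real u)"
proof -
  define k where "k = u - l"
  define z where "z = real k / real u"
  have z: "0 < z" "z \<le> 1" unfolding z_def k_def using assms by auto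
  have "(1 - 1 / real u) ^ k * (1 + 1 / real u) ^ k = (1 - (1 / real u)\<^sup>2) ^ k"
    unfolding power_mult_distrib[symmetric] by (simp add: power2_eq_square algebra_simps)
  also have "\<dots> \<le> 1" using u by (intro power_le_one) (auto simp: power_le_one)
  finally have "(1 - 1 / real u) ^ k * (1 + 1 / real u) ^ k \<le> 1" .
  moreover have "1 + z \<le> (1 + 1 / real u) ^ k"
    using Bernoulli_inequality[OF order_trans[of "-1" 0 "1 / real u"], of k] u unfolding z_def by simp
  then have "(1 - 1 / real u) ^ k * (1 + z) \<le> (1 - 1 / real u) ^ k * (1 + 1 / real u) ^ k"
    using u by (intro mult_left_mono) auto
  ultimately have "(1 - 1 / real u) ^ k * (1 + z) \<le> 1" by linarith
  then have "(1 - 1 / real u) ^ k \<le> 1 / (1 + z)" using z by (simp add: le_divide_eq)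
  also have "\<dots> \<le> 1 - z / 2"
  proof -
    have "1 \<le> (1 - z / 2) * (1 + z)" using z by (simp add: algebra_simps mult_left_le)
    then show ?thesis using z by (simp add: divide_le_eq)
  qed
  finally have k: "z / 2 \<le> 1 - (1 - 1 / real u) ^ k" by simp
  have "1/8 * (z / 2) \<le> (1 - 1 / real u) ^ l * (1 - (1 - 1 / real u) ^ k)"
    using one_minus_inverse_power_ge[OF u, of l] l k z by (intro mult_mono) auto
  also have "\<dots> = (1 - 1 / real u) ^ l - (1 - 1 / real u) ^ u"
    unfolding k_def using l by (simp add: algebra_simps power_add[symmetric])
  finally show ?thesis unfolding z_def k_def by simp
qed

definition pairs_with :: "nat \<Rightarrow> (bitstring \<Rightarrow> bitstring \<Rightarrow> bool) \<Rightarrow> (bitstring \<times> bitstring) set" where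
  "pairs_with n Q = {(x, y). x \<in> cube n \<and> y \<in> cube n \<and> Q x y}"

text \<open>The sign of the parity is a product of independent signs, one for each element of D,
  each with mean 1 - 2 \<rho>.\<close>

lemma prob_odd_subset:
  fixes D :: "nat set" and n :: nat
  assumes "\<rho> \<in> {0..1}" "D \<subseteq> {..<n}"
  shows "measure_pmf.prob (Pi_pmf {..<n} False (\<lambda>_. bernoulli_pmf \<rho>)) {r. odd (card {i\<in>D. r i})} = (1 - (1 - 2 * \<rho>) ^ card D) / 2"
proof -
  let ?R = "Pi_pmf {..<n} False (\<lambda>_. bernoulli_pmf \<rho>)"
  define f where "f = (\<lambda>i b. if i \<in> D \<and> b then -1 else 1 :: real)"
  have prod: "(\<Prod>i<n. f i (r i)) = 1 + (- 2) * indicator {r. odd (card {i\<in>D. r i})} r" for r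
  proof -
    have "(\<Prod>i<n. f i (r i)) = (\<Prod>i\<in>{i\<in>D. r i}. -1)"
      using assms(2) by (intro prod.mono_neutral_cong_right) (auto simp: f_def)
    also have "\<dots> = (-1) ^ card {i\<in>D. r i}" by simp
    finally show ?thesis by (simp add: indicator_def)
  qed
  have "measure_pmf.expectation ?R (\<lambda>r. \<Prod>i<n. f i (r i)) = (\<Prod>i<n. measure_pmf.expectation (bernoulli_pmf \<rho>) (f i))"
  proof -
    have "measure_pmf.expectation ?R (\<lambda>r. \<Prod>i<n. f i (r i)) = (\<Prod>i<n. measure_pmf.expectation ?R (\<lambda>r. f i (r i)))"
    proof (rule prob_space.indep_vars_lebesgue_integral)
      show "prob_space ?R" by (rule measure_pmf.prob_space_axioms)
      show "prob_space.indep_vars ?R (\<lambda>_. borel) (\<lambda>i r. f i (r i)) {..<n}"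
        by (intro prob_space.indep_vars_compose2[OF _ indep_vars_Pi_pmf]) (auto simp: measure_pmf.prob_space_axioms)
      show "integrable ?R (\<lambda>r. f i (r i))" for i
        by (intro measure_pmf.integrable_const_bound[where B=1]) (auto simp: f_def)
    qed auto
    also have "\<dots> = (\<Prod>i<n. measure_pmf.expectation (bernoulli_pmf \<rho>) (f i))"
    proof (rule prod.cong)
      fix i assume i: "i \<in> {..<n}"
      have "measure_pmf.expectation ?R (\<lambda>r. f i (r i)) = measure_pmf.expectation (map_pmf (\<lambda>r. r i) ?R) (f i)" by simp
      also have "map_pmf (\<lambda>r. r i) ?R = bernoulli_pmf \<rho>" using i by (simp add: Pi_pmf_component)
      finally show "measure_pmf.expectation ?R (\<lambda>r. f i (r i)) = measure_pmf.expectation (bernoulli_pmf \<rho>) (f i)" .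
    qed simp
    finally show ?thesis .
  qed
  also have "\<dots> = (\<Prod>i<n. if i \<in> D then 1 - 2 * \<rho> else 1)"
    using assms(1) by (intro prod.cong) (auto simp: f_def)
  also have "\<dots> = (\<Prod>i\<in>D. 1 - 2 * \<rho>)"
    using assms(2) by (intro prod.mono_neutral_cong_right) auto
  also have "\<dots> = (1 - 2 * \<rho>) ^ card D" by simp
  finally have "1 + (- 2) * measure_pmf.prob ?R {r. odd (card {i\<in>D. r i})} = (1 - 2 * \<rho>) ^ card D"
    unfolding prod expectation_affine_indicator .
  then show ?thesis by simp
qed

text \<open>The parities of x and y on a random set differ exactly if that set contains an odd
  number of differing positions. Density 1 / (2 u) makes each sign have mean 1 - 1/u. Of the
  constant 64, a factor 16 is the gap of the powers, 2 comes from passing from signs to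
  probabilities, and 2 from placing \<theta> in the middle.\<close>

lemma parity_gap_testable:
  assumes u: "u \<ge> 2" and l: "l < u"
  shows "gap_testable 2 (real (u - l) / (64 * real u)) (pairs_with n (\<lambda>x y. hdist x y \<ge> u)) (pairs_with n (\<lambda>x y. hdist x y \<le> l))"
proof -
  define \<rho> where "\<rho> = 1 / (2 * real u)"
  have \<rho>: "\<rho> \<in> {0..1}" using u by (simp add: \<rho>_def)
  define R where "R = Pi_pmf {..<n} False (\<lambda>_. bernoulli_pmf \<rho>)"
  define s where "s = (\<lambda>r x. odd (card {i\<in>{..<n}. x ! i \<and> r i}))"
  define F where "F = (\<lambda>r (x :: bitstring) (y :: bitstring). if s r x then (if s r y then False else True) else (if s r y then True else False))"
  define q where "q = 1 - 1 / real u"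
  have q: "0 \<le> q" "q \<le> 1" using u by (auto simp: q_def)
  have F: "det_computable 2 (F r)" for r
  proof -
    have "det_computable (Suc (Suc 0)) (F r)"
      unfolding F_def by (intro det_computable.alice det_computable.bob det_computable.const)
    then show ?thesis by (simp add: numeral_2_eq_2)
  qed
  have prob: "measure_pmf.prob R {r. F r x y} = (1 - q ^ hdist x y) / 2" if xy: "x \<in> cube n" "y \<in> cube n" for x y
  proof -
    define D where "D = {i. i < length x \<and> x ! i \<noteq> y ! i}"
    have D: "D \<subseteq> {..<n}" using xy by (auto simp: D_def cube_def)
    have "F r x y \<longleftrightarrow> odd (card {i\<in>D. r i})" for r
    proof -
      let ?X = "{i\<in>{..<n}. x ! i \<and> r i}" and ?Y = "{i\<in>{..<n}. y ! i \<and> r i}"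
      have "card ?X = card (?X - ?Y) + card (?X \<inter> ?Y)"
        by (subst card_Un_disjoint[symmetric]) (auto intro: arg_cong[where f=card])
      moreover have "card ?Y = card (?Y - ?X) + card (?X \<inter> ?Y)"
        by (subst card_Un_disjoint[symmetric]) (auto intro: arg_cong[where f=card])
      moreover have "card {i\<in>D. r i} = card (?X - ?Y) + card (?Y - ?X)"
      proof -
        have "{i\<in>D. r i} = (?X - ?Y) \<union> (?Y - ?X)" using xy by (auto simp: D_def cube_def)
        then show ?thesis by (simp only:) (subst card_Un_disjoint, auto)
      qed
      ultimately show ?thesis unfolding F_def s_def by auto
    qed
    then have "measure_pmf.prob R {r. F r x y} = (1 - (1 - 2 * \<rho>) ^ card D) / 2"
      unfolding R_def using prob_odd_subset[OF \<rho> D] by simp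
    moreover have "1 - 2 * \<rho> = q" unfolding \<rho>_def q_def by simp
    ultimately show ?thesis by (simp add: hdist_def D_def)
  qed
  have gap: "q ^ l - q ^ u \<ge> real (u - l) / (16 * real u)"
    unfolding q_def by (rule one_minus_inverse_power_diff[OF u l])
  have gap': "real (u - l) / (64 * real u) \<le> (q ^ l - q ^ u) / 4" using gap by simp
  show ?thesis
  proof (rule gap_testableI[where F=F and R=R and \<theta>="(1 - (q ^ l + q ^ u) / 2) / 2"])
    show "det_computable 2 (F r)" for r by (rule F)
  next
    fix x y assume "(x, y) \<in> pairs_with n (\<lambda>x y. hdist x y \<ge> u)"
    then have xy: "x \<in> cube n" "y \<in> cube n" "hdist x y \<ge> u" by (auto simp: pairs_with_def)
    have "q ^ hdist x y \<le> q ^ u" using q xy(3) by (intro power_decreasing) auto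
    then show "(1 - (q ^ l + q ^ u) / 2) / 2 + real (u - l) / (64 * real u) \<le> measure_pmf.prob R {r. F r x y}"
      unfolding prob[OF xy(1,2)] using gap' by (simp add: field_simps)
  next
    fix x y assume "(x, y) \<in> pairs_with n (\<lambda>x y. hdist x y \<le> l)"
    then have xy: "x \<in> cube n" "y \<in> cube n" "hdist x y \<le> l" by (auto simp: pairs_with_def)
    have "q ^ l \<le> q ^ hdist x y" using q xy(3) by (intro power_decreasing) auto
    then show "measure_pmf.prob R {r. F r x y} \<le> (1 - (q ^ l + q ^ u) / 2) / 2 - real (u - l) / (64 * real u)"
      unfolding prob[OF xy(1,2)] using gap' by (simp add: field_simps)
  qed
qed

section \<open>The sampling sketch for sparse inputs\<close>

definition overlap :: "bitstring \<Rightarrow> bitstring \<Rightarrow> nat" where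
  "overlap x y = card {i. i < length x \<and> x ! i \<and> y ! i}"

text \<open>
  The public coins give each position no label with probability \<open>1 - 1/a\<close> and a uniform label below \<open>m\<close>
  otherwise. Alice announces a label if exactly one of her ones is labelled, and Bob accepts
  if none of his ones carries it.
\<close>

definition label_pmf :: "nat \<Rightarrow> nat \<Rightarrow> nat option pmf" where
  "label_pmf a m = bind_pmf (bernoulli_pmf (1 / real a)) (\<lambda>k. if k then map_pmf Some (pmf_of_set {..<m}) else return_pmf None)"

lemma pmf_label:
  assumes "a \<ge> 1" "m \<ge> 1"
  shows "pmf (label_pmf a m) None = 1 - 1 / real a"
    and "h < m \<Longrightarrow> pmf (label_pmf a m) (Some h) = 1 / (real a * real m)"
proof -
  have p: "0 \<le> 1 / real a" "1 / real a \<le> 1" using assms by auto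
  have ne: "{..<m} \<noteq> {}" using assms by (auto simp: lessThan_empty_iff)
  have "pmf (map_pmf Some (pmf_of_set {..<m})) None = 0" by (auto simp: pmf_eq_0_set_pmf)
  then show "pmf (label_pmf a m) None = 1 - 1 / real a"
    unfolding label_pmf_def pmf_bind using p by simp
  show "pmf (label_pmf a m) (Some h) = 1 / (real a * real m)" if "h < m"
  proof -
    have "pmf (map_pmf Some (pmf_of_set {..<m})) (Some h) = pmf (pmf_of_set {..<m}) h"
      by (rule pmf_map_inj') simp
    also have "\<dots> = 1 / real m" using that ne by simp
    finally show ?thesis unfolding label_pmf_def pmf_bind using p by simp
  qed
qed

lemma prob_label_compl:
  assumes "a \<ge> 1" "m \<ge> 1" "h < m"
  shows "measure_pmf.prob (label_pmf a m) {k. k \<noteq> Some h} = 1 - 1 / (real a * real m)"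
proof -
  have "{k. k \<noteq> Some h} = UNIV - {Some h}" by auto
  then show ?thesis using measure_pmf.prob_compl[of "{Some h}" "label_pmf a m"] pmf_label(2)[OF assms]
    by (simp add: measure_pmf_single)
qed

lemma prod_three_classes:
  fixes A N \<rho> :: real and X Y :: "nat set"
  assumes "finite I" "X \<subseteq> I" "Y \<subseteq> I" "i \<in> X"
  shows "(\<Prod>j\<in>I. if j = i then A else if j \<in> X then N else if j \<in> Y then \<rho> else 1) = A * N ^ (card X - 1) * \<rho> ^ card (Y - X)"
proof -
  have fin: "finite X" "finite Y" using assms finite_subset by auto
  let ?f = "\<lambda>j. if j = i then A else if j \<in> X then N else if j \<in> Y then \<rho> else 1"
  have "prod ?f I = prod ?f (X \<union> (Y - X))"
    using assms by (intro prod.mono_neutral_right) auto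
  also have "\<dots> = prod ?f X * prod ?f (Y - X)"
    using fin by (intro prod.union_disjoint) auto
  also have "prod ?f X = ?f i * prod ?f (X - {i})" by (rule prod.remove[OF fin(1) assms(4)])
  also have "prod ?f (X - {i}) = (\<Prod>j\<in>X - {i}. N)" by (intro prod.cong) auto
  also have "prod ?f (Y - X) = (\<Prod>j\<in>Y - X. \<rho>)" using assms(4) by (intro prod.cong) auto
  finally show ?thesis using fin assms(4) by (simp add: card_Diff_singleton)
qed

definition sparse_accepts :: "nat \<Rightarrow> nat \<Rightarrow> (nat \<Rightarrow> nat option) \<Rightarrow> bitstring \<Rightarrow> bitstring \<Rightarrow> bool" where
  "sparse_accepts n m r x y \<longleftrightarrow> (\<exists>i<n. \<exists>h<m. x ! i \<and> r i = Some h \<and> (\<forall>j<n. x ! j \<and> j \<noteq> i \<longrightarrow> r j = None) \<and>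
     (\<forall>j<n. y ! j \<longrightarrow> r j \<noteq> Some h))"

lemma sparse_accepts_det_computable:
  "det_computable (Suc e + Suc 0) (sparse_accepts n (2 ^ e) r)"
proof -
  define ok where "ok = (\<lambda>x h. h < 2 ^ e \<and> (\<exists>i<n. x ! i \<and> r i = Some h \<and> (\<forall>j<n. x ! j \<and> j \<noteq> i \<longrightarrow> r j = None)))"
  have uniq: "h = h'" if "ok x h" "ok x h'" for x h h'
    using that unfolding ok_def by (metis option.inject option.distinct(1))
  \<comment> \<open>The value \<open>2 ^ e\<close> says that Alice does not have exactly one
    labelled one; this extra message is why e + 1 bits are sent.\<close>
  define s where "s = (\<lambda>x. if \<exists>h. ok x h then SOME h. ok x h else 2 ^ e)"
  have s: "s x < 2 ^ Suc e" for x
  proof (cases "\<exists>h. ok x h")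
    case True
    then have "ok x (SOME h. ok x h)" by (rule someI_ex)
    then show ?thesis using True unfolding s_def by (simp add: ok_def)
  next
    case False
    then have "s x = 2 ^ e" by (simp only: s_def if_False)
    then show ?thesis by simp
  qed
  define F where "F = (\<lambda>h (x::bitstring) (y::bitstring). if h < 2 ^ e \<and> (\<forall>j<n. y ! j \<longrightarrow> r j \<noteq> Some h) then True else False)"
  have F: "det_computable (Suc 0) (F h)" for h
    unfolding F_def by (rule det_computable.bob[OF det_computable.const det_computable.const])
  have "det_computable (Suc e + Suc 0) (\<lambda>x y. F (s x) x y)"
    by (rule det_computable_alice_message) (rule F, rule s)
  moreover have "F (s x) x y = sparse_accepts n (2 ^ e) r x y" for x y
  proof (cases "\<exists>h. ok x h")
    case True
    then obtain h where h: "ok x h" by blast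
    have "s x = h" unfolding s_def using True uniq[OF someI_ex[OF True] h] by simp
    then have "F (s x) x y \<longleftrightarrow> (\<forall>j<n. y ! j \<longrightarrow> r j \<noteq> Some h)" using h unfolding F_def ok_def by simp
    also have "\<dots> \<longleftrightarrow> (\<exists>h. ok x h \<and> (\<forall>j<n. y ! j \<longrightarrow> r j \<noteq> Some h))" using h uniq by blast
    also have "\<dots> \<longleftrightarrow> sparse_accepts n (2 ^ e) r x y" unfolding sparse_accepts_def ok_def by blast
    finally show ?thesis .
  next
    case False
    then have "s x = 2 ^ e" by (simp only: s_def if_False)
    then have "\<not> F (s x) x y" by (simp add: F_def)
    moreover have "\<not> sparse_accepts n (2 ^ e) r x y" using False unfolding sparse_accepts_def ok_def by blast
    ultimately show ?thesis by simp
  qed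
  ultimately show ?thesis by simp
qed

text \<open>Acceptance is a disjoint union over the position i of Alice's labelled one, which lies
  outside Y, and its label h. Each event is a product: i gets label h, her other a - 1 ones get
  none, and the positions in Y - X avoid h. So at fixed weights only the overlap matters.\<close>

lemma prob_sparse_accepts:
  assumes a: "a \<ge> 1" and m: "m \<ge> 1" and xy: "x \<in> cube n" "y \<in> cube n" and wx: "weight x = a"
  shows "measure_pmf.prob (Pi_pmf {..<n} None (\<lambda>_. label_pmf a m)) {r. sparse_accepts n m r x y} =
     (real a - real (overlap x y)) * (1 - 1 / (real a * real m)) ^ (weight y - overlap x y) * ((1 - 1 / real a) ^ (a - 1) / real a)"
proof -
  let ?R = "Pi_pmf {..<n} None (\<lambda>_. label_pmf a m)"
  define X where "X = {i. i < n \<and> x ! i}"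
  define Y where "Y = {i. i < n \<and> y ! i}"
  have X: "X \<subseteq> {..<n}" "finite X" "card X = a" and Y: "Y \<subseteq> {..<n}" "finite Y" "card Y = weight y"
    using xy wx by (auto simp: X_def Y_def cube_def weight_def)
  have ov: "card (X \<inter> Y) = overlap x y" unfolding X_def Y_def overlap_def using xy
    by (intro arg_cong[where f=card]) (auto simp: cube_def)
  have cXY: "real (card (X - Y)) = real a - real (overlap x y)"
    using card_Diff_subset_Int[of X Y] X(2,3) ov card_mono[of X "X \<inter> Y"] by (simp add: of_nat_diff)
  have cYX: "card (Y - X) = weight y - overlap x y"
    using card_Diff_subset_Int[of Y X] Y(2,3) ov by (simp add: Int_commute)
  define \<rho> where "\<rho> = 1 - 1 / (real a * real m)"
  define E :: "nat \<times> nat \<Rightarrow> (nat \<Rightarrow> nat option) set" where "E = (\<lambda>(i, h). {r. r i = Some h \<and> (\<forall>j\<in>X. j \<noteq> i \<longrightarrow> r j = None) \<and> (\<forall>j\<in>Y. r j \<noteq> Some h)})"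
  have "{r. sparse_accepts n m r x y} = (\<Union>ih\<in>(X - Y) \<times> {..<m}. E ih)"
    unfolding sparse_accepts_def E_def X_def Y_def by auto
  then have "measure_pmf.prob ?R {r. sparse_accepts n m r x y} = measure_pmf.prob ?R (\<Union>ih\<in>(X - Y) \<times> {..<m}. E ih)" by simp
  also have "\<dots> = (\<Sum>ih\<in>(X - Y) \<times> {..<m}. measure_pmf.prob ?R (E ih))"
  proof (rule measure_pmf.finite_measure_finite_Union)
    show "disjoint_family_on E ((X - Y) \<times> {..<m})"
      unfolding disjoint_family_on_def E_def by auto
  qed (use X in auto)
  also have "\<dots> = (\<Sum>ih\<in>(X - Y) \<times> {..<m}. 1 / (real a * real m) * (1 - 1 / real a) ^ (a - 1) * \<rho> ^ card (Y - X))"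
  proof (rule sum.cong)
    fix ih assume "ih \<in> (X - Y) \<times> {..<m}"
    then obtain i h where ih: "ih = (i, h)" "i \<in> X" "i \<notin> Y" "h < m" by auto
    define B where "B = (\<lambda>j. if j = i then {Some h} else if j \<in> X then {None} else if j \<in> Y then {k. k \<noteq> Some h} else UNIV)"
    have "E ih = Pi {..<n} B"
      unfolding ih(1) E_def B_def using X(1) Y(1) ih(2,3) by (fastforce simp: Pi_iff split: if_splits)
    then have "measure_pmf.prob ?R (E ih) = (\<Prod>j<n. measure_pmf.prob (label_pmf a m) (B j))"
      by (simp add: measure_Pi_pmf_Pi)
    also have "\<dots> = (\<Prod>j<n. if j = i then 1 / (real a * real m) else if j \<in> X then 1 - 1 / real a else if j \<in> Y then \<rho> else 1)"
      unfolding B_def \<rho>_def using pmf_label[OF a m] prob_label_compl[OF a m ih(4)] ih(4)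
      by (intro prod.cong) (auto simp: measure_pmf_single)
    also have "\<dots> = 1 / (real a * real m) * (1 - 1 / real a) ^ (card X - 1) * \<rho> ^ card (Y - X)"
      using X Y ih by (intro prod_three_classes) auto
    finally show "measure_pmf.prob ?R (E ih) = 1 / (real a * real m) * (1 - 1 / real a) ^ (a - 1) * \<rho> ^ card (Y - X)"
      by (simp add: X(3))
  qed simp
  also have "\<dots> = real (card (X - Y)) * real m * (1 / (real a * real m) * (1 - 1 / real a) ^ (a - 1) * \<rho> ^ card (Y - X))"
    by (simp add: card_cartesian_product)
  also have "\<dots> = real (card (X - Y)) * \<rho> ^ card (Y - X) * ((1 - 1 / real a) ^ (a - 1) / real a)"
    using m by simp
  finally show ?thesis unfolding cXY cYX \<rho>_def .
qed

text \<open>A larger overlap lowers the first factor and raises the second. The condition a (1 -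
  \<rho>) \<le> 1/2 makes the first effect win, with a loss of at least \<rho>^b / 2 for each unit
  of overlap.\<close>

lemma sparse_profile_decreasing:
  fixes \<rho> :: real
  assumes \<rho>: "0 \<le> \<rho>" "\<rho> \<le> 1" "real a * (1 - \<rho>) \<le> 1/2" and t: "s \<le> t" "t \<le> a" "t \<le> b"
  shows "(real a - real s) * \<rho> ^ (b - s) - (real a - real t) * \<rho> ^ (b - t) \<ge> real (t - s) * (\<rho> ^ b / 2)"
  using t
proof (induction t rule: dec_induct)
  case base
  show ?case by simp
next
  case (step t)
  define k where "k = b - Suc t"
  have k: "b - t = Suc k" using step unfolding k_def by simp
  have "(real a - real t) * \<rho> ^ (b - t) - (real a - real (Suc t)) * \<rho> ^ (b - Suc t) = \<rho> ^ k * (1 - (real a - real t) * (1 - \<rho>))"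
    unfolding k k_def[symmetric] by (simp add: algebra_simps)
  also have "\<dots> \<ge> \<rho> ^ b * (1/2)"
  proof (rule mult_mono)
    show "\<rho> ^ b \<le> \<rho> ^ k" using \<rho> unfolding k_def by (intro power_decreasing) auto
    have "(real a - real t) * (1 - \<rho>) \<le> real a * (1 - \<rho>)" using \<rho> by (intro mult_right_mono) auto
    then show "1/2 \<le> 1 - (real a - real t) * (1 - \<rho>)" using \<rho>(3) by linarith
  qed (use \<rho> in auto)
  finally have "(real a - real t) * \<rho> ^ (b - t) - (real a - real (Suc t)) * \<rho> ^ (b - Suc t) \<ge> \<rho> ^ b / 2" by simp
  moreover have "(real a - real s) * \<rho> ^ (b - s) - (real a - real t) * \<rho> ^ (b - t) \<ge> real (t - s) * (\<rho> ^ b / 2)"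
    using step by simp
  moreover have "real (Suc t - s) * (\<rho> ^ b / 2) = real (t - s) * (\<rho> ^ b / 2) + \<rho> ^ b / 2"
  proof -
    have "real (Suc t - s) = real (t - s) + 1" using step(1) by (simp add: Suc_diff_le)
    then show ?thesis by (simp only: distrib_right mult_1_left)
  qed
  ultimately show ?case by linarith
qed

text \<open>With m = 2^e labels and b \<le> a m, the power \<rho>^b is at least 1/8, so the profile
  drops by 1/16 per unit; the common factor \<kappa> is at least 1 / (8 a), and the threshold in the
  middle costs another 2, which makes 256. From e \<ge> 1 follows a (1 - \<rho>) = 1/m \<le>
  1/2.\<close>

lemma sparse_gap_testable:
  assumes a: "a \<ge> 1" and e: "e \<ge> 1" and b: "b \<le> a * 2 ^ e" and t: "s < t" "t \<le> a" "t \<le> b"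
  shows "gap_testable (e + 2) (real (t - s) / (256 * real a)) (pairs_with n (\<lambda>x y. weight x = a \<and> weight y = b \<and> overlap x y \<le> s))
     (pairs_with n (\<lambda>x y. weight x = a \<and> weight y = b \<and> overlap x y \<ge> t))"
proof -
  define m where "m = (2::nat) ^ e"
  have m2: "m \<ge> 2" unfolding m_def using e self_le_power[of 2 e] by simp
  then have m: "m \<ge> 1" by simp
  define R where "R = Pi_pmf {..<n} None (\<lambda>_. label_pmf a m)"
  define \<rho> where "\<rho> = 1 - 1 / (real a * real m)"
  define \<kappa> where "\<kappa> = (1 - 1 / real a) ^ (a - 1) / real a"
  define Q where "Q = (\<lambda>t. (real a - real t) * \<rho> ^ (b - t))"
  have am: "real a * real m \<ge> 2" using a m2 mult_mono[of 1 "real a" 2 "real m"] by simp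
  have \<rho>: "0 \<le> \<rho>" "\<rho> \<le> 1" unfolding \<rho>_def using am by (auto simp: divide_le_eq)
  have \<rho>3: "real a * (1 - \<rho>) \<le> 1/2" unfolding \<rho>_def using a m2 by (simp add: divide_le_eq)
  have \<rho>b: "\<rho> ^ b \<ge> 1/8"
  proof -
    have "a * m \<ge> 2" using mult_le_mono[OF a m2] by simp
    then have "1/8 \<le> (1 - 1 / real (a * m)) ^ b" using b unfolding m_def[symmetric] by (rule one_minus_inverse_power_ge)
    then show ?thesis unfolding \<rho>_def by simp
  qed
  have \<kappa>: "\<kappa> \<ge> 1 / (8 * real a)"
  proof -
    have "(1 - 1 / real a) ^ (a - 1) \<ge> 1/8"
    proof (cases "a = 1")
      case False
      then show ?thesis using a by (intro one_minus_inverse_power_ge) auto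
    qed simp
    then have "1/8 / real a \<le> \<kappa>" unfolding \<kappa>_def by (intro divide_right_mono) auto
    then show ?thesis by simp
  qed
  have \<kappa>0: "\<kappa> \<ge> 0" using \<kappa> order_trans[of 0 "1 / (8 * real a)" \<kappa>] by simp
  have dec: "Q s' - Q t' \<ge> real (t' - s') * (\<rho> ^ b / 2)" if "s' \<le> t'" "t' \<le> a" "t' \<le> b" for s' t'
    unfolding Q_def using sparse_profile_decreasing[OF \<rho> \<rho>3 that] .
  have mono: "Q t' \<le> Q s'" if "s' \<le> t'" "t' \<le> a" "t' \<le> b" for s' t'
  proof -
    have "0 \<le> real (t' - s') * (\<rho> ^ b / 2)" using \<rho> by simp
    then show ?thesis using dec[OF that] by linarith
  qed
  have gap: "real (t - s) / (256 * real a) \<le> (Q s - Q t) * \<kappa> / 2"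
  proof -
    have "real (t - s) * (1/16) * (1 / (8 * real a)) \<le> (Q s - Q t) * \<kappa>"
    proof (rule mult_mono)
      have "real (t - s) * (1/16) \<le> real (t - s) * (\<rho> ^ b / 2)" using \<rho>b by (intro mult_left_mono) auto
      also have "\<dots> \<le> Q s - Q t" using dec[of s t] t by simp
      finally show "real (t - s) * (1/16) \<le> Q s - Q t" .
      then show "0 \<le> Q s - Q t" by (rule order_trans[rotated]) simp
    qed (use \<kappa> in auto)
    then show ?thesis by simp
  qed
  have prob: "measure_pmf.prob R {r. sparse_accepts n m r x y} = Q (overlap x y) * \<kappa>"
    if "x \<in> cube n" "y \<in> cube n" "weight x = a" "weight y = b" for x y
    unfolding R_def using prob_sparse_accepts[OF a m that(1-3)] that(4) by (simp add: Q_def \<kappa>_def \<rho>_def)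
  have ov: "overlap x y \<le> a" "overlap x y \<le> b" if "x \<in> cube n" "y \<in> cube n" "weight x = a" "weight y = b" for x y
  proof -
    have "overlap x y \<le> weight x" unfolding overlap_def weight_def by (intro card_mono) auto
    moreover have "overlap x y \<le> weight y" unfolding overlap_def weight_def using that by (intro card_mono) (auto simp: cube_def)
    ultimately show "overlap x y \<le> a" "overlap x y \<le> b" using that by auto
  qed
  show ?thesis
  proof (rule gap_testableI[where F="sparse_accepts n m" and R=R and \<theta>="(Q s + Q t) * \<kappa> / 2"])
    show "det_computable (e + 2) (sparse_accepts n m r)" for r
      using sparse_accepts_det_computable[of e n r] unfolding m_def by simp
  next
    fix x y assume "(x, y) \<in> pairs_with n (\<lambda>x y. weight x = a \<and> weight y = b \<and> overlap x y \<le> s)"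
    then have xy: "x \<in> cube n" "y \<in> cube n" "weight x = a" "weight y = b" "overlap x y \<le> s" by (auto simp: pairs_with_def)
    have "Q s \<le> Q (overlap x y)" using xy(5) t by (intro mono) auto
    then have "Q s * \<kappa> \<le> Q (overlap x y) * \<kappa>" using \<kappa>0 by (rule mult_right_mono)
    moreover have "(Q s + Q t) * \<kappa> / 2 + (Q s - Q t) * \<kappa> / 2 = Q s * \<kappa>" by (simp add: field_simps)
    ultimately show "(Q s + Q t) * \<kappa> / 2 + real (t - s) / (256 * real a) \<le> measure_pmf.prob R {r. sparse_accepts n m r x y}"
      unfolding prob[OF xy(1-4)] using gap by linarith
  next
    fix x y assume "(x, y) \<in> pairs_with n (\<lambda>x y. weight x = a \<and> weight y = b \<and> overlap x y \<ge> t)"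
    then have xy: "x \<in> cube n" "y \<in> cube n" "weight x = a" "weight y = b" "overlap x y \<ge> t" by (auto simp: pairs_with_def)
    have "Q (overlap x y) \<le> Q t" using xy ov by (intro mono) auto
    then have "Q (overlap x y) * \<kappa> \<le> Q t * \<kappa>" using \<kappa>0 by (rule mult_right_mono)
    then show "measure_pmf.prob R {r. sparse_accepts n m r x y} \<le> (Q s + Q t) * \<kappa> / 2 - real (t - s) / (256 * real a)"
      unfolding prob[OF xy(1-4)] using gap by (simp add: algebra_simps)
  qed
qed

section \<open>Testing a jump\<close>

lemma weight_plus_weight:
  assumes "x \<in> cube n" "y \<in> cube n"
  shows "weight x + weight y = hdist x y + 2 * overlap x y"
proof -
  define X where "X = {i. i < n \<and> x ! i}"
  define Y where "Y = {i. i < n \<and> y ! i}"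
  have fin: "finite X" "finite Y" by (auto simp: X_def Y_def)
  have e: "weight x = card X" "weight y = card Y" "overlap x y = card (X \<inter> Y)" "hdist x y = card ((X - Y) \<union> (Y - X))"
    unfolding weight_def overlap_def hdist_def X_def Y_def using assms
    by (auto simp: cube_def intro!: arg_cong[where f=card])
  have "card ((X - Y) \<union> (Y - X)) = card (X - Y) + card (Y - X)" using fin by (intro card_Un_disjoint) auto
  moreover have "card X = card (X - Y) + card (X \<inter> Y)"
    using fin by (subst card_Un_disjoint[symmetric]) (auto intro: arg_cong[where f=card])
  moreover have "card Y = card (Y - X) + card (X \<inter> Y)"
    using fin by (subst card_Un_disjoint[symmetric]) (auto intro: arg_cong[where f=card])
  ultimately show ?thesis unfolding e by simp
qed

definition gap_profile :: "nat \<Rightarrow> nat \<Rightarrow> nat \<Rightarrow> nat \<Rightarrow> nat \<Rightarrow> nat \<Rightarrow> bool" where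
  "gap_profile n a b l u g \<longleftrightarrow> g \<ge> 1 \<and> l + 2 * g = u \<and> (\<exists>A B C D. profile_of n a b u A B C D \<and> g \<le> B \<and> g \<le> C)"

lemma gap_profile_swap: "gap_profile n a b l u g \<Longrightarrow> gap_profile n b a l u g"
  unfolding gap_profile_def using profile_swap by blast

lemma gap_profile_complement_both: "gap_profile n a b l u g \<Longrightarrow> gap_profile n (n - a) (n - b) l u g"
  unfolding gap_profile_def using profile_complement_both by blast

text \<open>The upper end of the complemented jump is n - l, so the counts are those at distance l,
  namely A + g, B - g, C - g, D + g, with 11 exchanged with 10 and 01 with 00.\<close>

lemma gap_profile_complement:
  assumes "gap_profile n a b l u g" shows "gap_profile n a (n - b) (n - u) (n - l) g"
proof -
  obtain A B C D where p: "g \<ge> 1" "l + 2 * g = u" "profile_of n a b u A B C D" "g \<le> B" "g \<le> C"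
    using assms unfolding gap_profile_def by blast
  then have "profile_of n a (n - b) (n - l) (B - g) (A + g) (D + g) (C - g)" "n - u + 2 * g = n - l"
    unfolding profile_of_def by auto
  then show ?thesis unfolding gap_profile_def using p(1)
    by (intro conjI exI[where x="B - g"] exI[where x="A + g"] exI[where x="D + g"] exI[where x="C - g"]) auto
qed

lemma gap_profile_bounds:
  assumes "gap_profile n a b l u g"
  shows "a \<le> n" "b \<le> n" "u \<le> n" "l \<le> u" "l < u"
  using assms unfolding gap_profile_def profile_of_def by auto

abbreviation far :: "nat \<Rightarrow> nat \<Rightarrow> nat \<Rightarrow> nat \<Rightarrow> (bitstring \<times> bitstring) set" where
  "far n a b u \<equiv> pairs_with n (\<lambda>x y. weight x = a \<and> weight y = b \<and> hdist x y \<ge> u)"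

abbreviation near :: "nat \<Rightarrow> nat \<Rightarrow> nat \<Rightarrow> nat \<Rightarrow> (bitstring \<times> bitstring) set" where
  "near n a b l \<equiv> pairs_with n (\<lambda>x y. weight x = a \<and> weight y = b \<and> hdist x y \<le> l)"

text \<open>The test has to be right for all distances beyond the two ends, because the binary
  search also runs it on inputs far away from this jump. Bits and advantage are chosen to suit both
  sketches.\<close>

definition testable_at :: "real \<Rightarrow> nat \<Rightarrow> nat \<Rightarrow> nat \<Rightarrow> nat \<Rightarrow> nat \<Rightarrow> bool" where
  "testable_at M n a b l u \<longleftrightarrow> gap_testable (nat \<lceil>M\<rceil> + 3) (1 / (256 * (M + 1))) (far n a b u) (near n a b l)"

lemma testable_at_swap: "testable_at M n b a l u \<Longrightarrow> testable_at M n a b l u"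
  unfolding testable_at_def by (erule gap_testable_swap) (auto simp: pairs_with_def hdist_commute[of _ n])

lemma testable_at_complement_both:
  "testable_at M n (n - a) (n - b) l u \<Longrightarrow> testable_at M n a b l u"
  unfolding testable_at_def
  by (erule gap_testable_compose[where f="map Not" and g="map Not"])
    (auto simp: pairs_with_def weight_complement hdist_complement_both)

lemma testable_at_complement:
  assumes "testable_at M n a (n - b) (n - u) (n - l)" "u \<le> n"
  shows "testable_at M n a b l u"
  unfolding testable_at_def
proof (rule gap_testable_complement)
  show "gap_testable (nat \<lceil>M\<rceil> + 3) (1 / (256 * (M + 1))) (near n a b l) (far n a b u)"
    by (rule gap_testable_compose[where f="\<lambda>x. x" and g="map Not", OF assms(1)[unfolded testable_at_def]])
       (auto simp: pairs_with_def weight_complement hdist_complement)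
qed

text \<open>Here u \<le> (M + 1) g, so the parity sketch has advantage 2 g / (64 u) \<ge> 1 / (32 (M
  + 1)).\<close>

lemma testable_at_small_distance:
  assumes gp: "gap_profile n a b l u g" and M: "M \<ge> 0" and c: "real u - real g \<le> M * real g"
  shows "testable_at M n a b l u"
proof -
  have g: "g \<ge> 1" "l + 2 * g = u" using gp by (auto simp: gap_profile_def)
  have ul: "u \<ge> 2" "l < u" "u - l = 2 * g" using g by auto
  have "gap_testable (nat \<lceil>M\<rceil> + 3) (1 / (256 * (M + 1))) (pairs_with n (\<lambda>x y. hdist x y \<ge> u)) (pairs_with n (\<lambda>x y. hdist x y \<le> l))"
  proof (rule gap_testable_mono[OF parity_gap_testable[OF ul(1,2)]])
    have "real u \<le> (M + 1) * real g" using c by (simp add: algebra_simps)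
    then have "real u * 64 \<le> 256 * (M + 1) * (2 * real g)" using M by (simp add: algebra_simps)
    then show "1 / (256 * (M + 1)) \<le> real (u - l) / (64 * real u)"
      using M ul by (simp add: frac_le_eq divide_le_eq le_divide_eq field_simps)
  qed simp
  then show ?thesis unfolding testable_at_def
    by (rule gap_testable_compose[where f="\<lambda>x. x" and g="\<lambda>y. y"]) (auto simp: pairs_with_def)
qed

text \<open>The logarithmic part of m bounds the length of the labels: b \<le> a + (u - g) and g
  \<le> a give b \<le> 2^(M + 1) a. The linear part bounds the advantage, which is g / (256 a),
  since the overlaps at the ends u and l are A and A + g.\<close>

lemma testable_at_small_weight:
  assumes gp: "gap_profile n a b l u g" and M: "M \<ge> 0" and a: "real a \<le> M * real g"
    and c: "real u - real g \<le> 2 powr M * real g"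
  shows "testable_at M n a b l u"
proof -
  obtain A B C D where p: "g \<ge> 1" "l + 2 * g = u" "profile_of n a b u A B C D" "g \<le> B" "g \<le> C"
    using gp unfolding gap_profile_def by blast
  have n: "A + B + C + D = n" "a = A + B" "b = A + C" "u = B + C" using p by (auto simp: profile_of_def)
  define e where "e = nat \<lceil>M\<rceil> + 1"
  have a1: "a \<ge> 1" using n p by auto
  have "real b \<le> real a + 2 powr M * real g" using c n p by simp
  also have "\<dots> \<le> real a + 2 powr M * real a" using n p by (intro add_left_mono mult_left_mono) auto
  also have "\<dots> \<le> real a * (2 * 2 powr M)"
  proof -
    have "real a * 1 \<le> real a * 2 powr M" using ge_one_powr_ge_zero[of 2 M] M by (intro mult_left_mono) auto
    then show ?thesis by (simp add: algebra_simps)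
  qed
  also have "2 * 2 powr M = 2 powr (M + 1)" by (simp add: powr_add)
  also have "real a * 2 powr (M + 1) \<le> real a * 2 powr real e"
    unfolding e_def using M by (intro mult_left_mono powr_mono) (auto simp: real_nat_ceiling_ge)
  also have "\<dots> = real (a * 2 ^ e)" by (simp add: powr_realpow)
  finally have be: "b \<le> a * 2 ^ e" by (simp only: of_nat_le_iff)
  have st: "A < A + g" "A + g \<le> a" "A + g \<le> b" using n p by auto
  have sp: "gap_testable (e + 2) (real (A + g - A) / (256 * real a)) (pairs_with n (\<lambda>x y. weight x = a \<and> weight y = b \<and> overlap x y \<le> A))
     (pairs_with n (\<lambda>x y. weight x = a \<and> weight y = b \<and> overlap x y \<ge> A + g))"
    by (rule sparse_gap_testable[OF a1 _ be st]) (simp add: e_def)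
  have "real a \<le> (M + 1) * real g" using a by (simp add: algebra_simps)
  then have "1 / (256 * (M + 1)) \<le> real (A + g - A) / (256 * real a)"
    using M a1 by (simp add: field_simps)
  from gap_testable_mono[OF sp order_refl this]
  have "gap_testable (nat \<lceil>M\<rceil> + 3) (1 / (256 * (M + 1))) (pairs_with n (\<lambda>x y. weight x = a \<and> weight y = b \<and> overlap x y \<le> A))
     (pairs_with n (\<lambda>x y. weight x = a \<and> weight y = b \<and> overlap x y \<ge> A + g))" unfolding e_def by (simp add: numeral_3_eq_3)
  then show ?thesis unfolding testable_at_def
  proof (rule gap_testable_compose[where f="\<lambda>x. x" and g="\<lambda>y. y"])
    fix x y assume "(x, y) \<in> far n a b u"
    then have xy: "x \<in> cube n" "y \<in> cube n" "weight x = a" "weight y = b" "hdist x y \<ge> u" by (auto simp: pairs_with_def)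
    then show "(x, y) \<in> pairs_with n (\<lambda>x y. weight x = a \<and> weight y = b \<and> overlap x y \<le> A)"
      using weight_plus_weight[OF xy(1,2)] n by (simp add: pairs_with_def)
  next
    fix x y assume "(x, y) \<in> near n a b l"
    then have xy: "x \<in> cube n" "y \<in> cube n" "weight x = a" "weight y = b" "hdist x y \<le> l" by (auto simp: pairs_with_def)
    then show "(x, y) \<in> pairs_with n (\<lambda>x y. weight x = a \<and> weight y = b \<and> overlap x y \<ge> A + g)"
      using weight_plus_weight[OF xy(1,2)] n p by (simp add: pairs_with_def)
  qed
qed

text \<open>The logarithmic part controls only the smaller of c and n - c; complementing Bob's
  string exchanges them and keeps a.\<close>

lemma testable_at_small_weight':
  assumes gp: "gap_profile n a b l u g" and M: "M \<ge> 0" and a: "real a \<le> M * real g"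
    and c: "min (real u - real g) (real n - (real u - real g)) \<le> 2 powr M * real g"
  shows "testable_at M n a b l u"
proof (cases "real u - real g \<le> 2 powr M * real g")
  case True
  then show ?thesis using testable_at_small_weight[OF gp M a] by simp
next
  case False
  then have "real n - (real u - real g) \<le> 2 powr M * real g" using c by linarith
  moreover have "real (n - l) - real g = real n - (real u - real g)"
    using gap_profile_bounds[OF gp] gp unfolding gap_profile_def by (simp add: of_nat_diff)
  ultimately have "testable_at M n a (n - b) (n - u) (n - l)"
    by (intro testable_at_small_weight[OF gap_profile_complement[OF gp] M a]) simp
  then show ?thesis using gap_profile_bounds(3)[OF gp] by (rule testable_at_complement)
qed

lemma Min_six_le:
  fixes z :: real
  assumes "Min {p, q, r, s, t, v} \<le> z"
  shows "p \<le> z \<or> q \<le> z \<or> r \<le> z \<or> s \<le> z \<or> t \<le> z \<or> v \<le> z"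
  using assms by (simp add: min_le_iff_disj)

lemma testable_at_jump:
  assumes gp: "gap_profile n a b l u g" and M: "M \<ge> 0"
    and lin: "Min {real a, real b, real u - real g, real n - real a, real n - real b, real n - (real u - real g)} / real g \<le> M"
    and log: "log 2 (min (real u - real g) (real n - (real u - real g)) / real g) \<le> M"
  shows "testable_at M n a b l u"
proof -
  note bd = gap_profile_bounds[OF gp]
  have g: "g \<ge> 1" "l + 2 * g = u" using gp by (auto simp: gap_profile_def)
  have rg: "real g > 0" using g(1) by simp
  define m where "m = min (real u - real g) (real n - (real u - real g))"
  have "real l + 2 * real g = real u" "real u \<le> real n" using g(2) bd(3) by linarith+
  then have "real u - real g > 0" "real n - (real u - real g) > 0" using rg by linarith+
  then have "m > 0" unfolding m_def by simp
  then have "m / real g > 0" using rg by simp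
  then have "m / real g \<le> 2 powr M"
    using log unfolding m_def[symmetric] by (subst (asm) log_le_iff) auto
  then have c: "m \<le> 2 powr M * real g" unfolding pos_divide_le_eq[OF rg] .
  have "Min {real a, real b, real u - real g, real n - real a, real n - real b, real n - (real u - real g)} \<le> M * real g"
    using lin unfolding pos_divide_le_eq[OF rg] .
  from Min_six_le[OF this] consider "real a \<le> M * real g" | "real b \<le> M * real g" | "real u - real g \<le> M * real g"
    | "real n - real a \<le> M * real g" | "real n - real b \<le> M * real g" | "real n - (real u - real g) \<le> M * real g"
    by blast
  then show ?thesis
  proof cases
    case 1
    show ?thesis by (rule testable_at_small_weight'[OF gp M 1 c[unfolded m_def]])
  next
    case 2
    show ?thesis by (rule testable_at_swap, rule testable_at_small_weight'[OF gap_profile_swap[OF gp] M 2 c[unfolded m_def]])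
  next
    case 3
    show ?thesis by (rule testable_at_small_distance[OF gp M 3])
  next
    case 4
    then have "real (n - a) \<le> M * real g" unfolding of_nat_diff[OF bd(1)] .
    from testable_at_small_weight'[OF gap_profile_complement_both[OF gp] M this c[unfolded m_def]]
    show ?thesis by (rule testable_at_complement_both)
  next
    case 5
    then have "real (n - b) \<le> M * real g" unfolding of_nat_diff[OF bd(2)] .
    from testable_at_small_weight'[OF gap_profile_swap[OF gap_profile_complement_both[OF gp]] M this c[unfolded m_def]]
    have "testable_at M n (n - a) (n - b) l u" by (rule testable_at_swap)
    then show ?thesis by (rule testable_at_complement_both)
  next
    case 6
    moreover have "l \<le> n" using bd(3,4) by linarith
    then have "real (n - l) = real n - real l" by (rule of_nat_diff)
    moreover have "real l + 2 * real g = real u" using g(2) by linarith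
    ultimately have "real (n - l) - real g \<le> M * real g" by linarith
    from testable_at_small_distance[OF gap_profile_complement[OF gp] M this]
    show ?thesis using bd(3) by (rule testable_at_complement)
  qed
qed

section \<open>Counting jumps and assembling the protocol\<close>

section \<open>Counting jumps\<close>

text \<open>The floors of w are distinct integers between 0 and W.\<close>

lemma card_le_of_separated:
  fixes w :: "nat \<Rightarrow> real"
  assumes sep: "\<And>u u'. u \<in> Us \<Longrightarrow> u' \<in> Us \<Longrightarrow> u < u' \<Longrightarrow> w u + 1 \<le> w u'"
    and range: "\<And>u. u \<in> Us \<Longrightarrow> 0 \<le> w u \<and> w u \<le> W" and W: "0 \<le> W"
  shows "real (card Us) \<le> W + 1"
proof -
  define F where "F = (\<lambda>u. nat \<lfloor>w u\<rfloor>)"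
  have "F u < F u'" if "u \<in> Us" "u' \<in> Us" "u < u'" for u u'
  proof -
    have "\<lfloor>w u\<rfloor> + 1 \<le> \<lfloor>w u'\<rfloor>" using sep[OF that] by (simp add: le_floor_iff) linarith
    moreover have "0 \<le> \<lfloor>w u\<rfloor>" using range[OF that(1)] by simp
    ultimately show ?thesis unfolding F_def by linarith
  qed
  then have "inj_on F Us" by (metis (no_types) inj_onI linorder_neqE_nat less_irrefl)
  moreover have "F ` Us \<subseteq> {..nat \<lfloor>W\<rfloor>}"
    unfolding F_def using range by (auto intro!: nat_mono floor_mono)
  ultimately have "card Us \<le> card {..nat \<lfloor>W\<rfloor>}" using card_inj_on_le by blast
  then have "card Us \<le> nat \<lfloor>W\<rfloor> + 1" by simp
  then have "real (card Us) \<le> real (nat \<lfloor>W\<rfloor>) + 1" by linarith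
  also have "\<dots> \<le> W + 1" using W by (simp add: of_nat_floor)
  finally show ?thesis .
qed

lemma ln_diff_ge:
  fixes p q :: real
  assumes "0 < p" "p \<le> q" shows "ln p + (q - p) / q \<le> ln q"
proof -
  have "ln (p / q) \<le> p / q - 1" using assms by (intro ln_le_minus_one) simp
  then show ?thesis using assms by (simp add: ln_div diff_divide_distrib)
qed

definition jump_pairs :: "(nat \<Rightarrow> bool option) \<Rightarrow> (nat \<times> nat) set" where
  "jump_pairs h = {(l, u). l < u \<and> h l \<noteq> None \<and> h u \<noteq> None \<and> h l \<noteq> h u \<and> (\<forall>i. l < i \<and> i < u \<longrightarrow> h i = None)}"

text \<open>Otherwise u would be a point with a defined value strictly between l' and u'.\<close>

lemma jump_pairs_ordered:
  assumes "(l, u) \<in> jump_pairs h" "(l', u') \<in> jump_pairs h" "u < u'"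
  shows "u \<le> l'"
  using assms unfolding jump_pairs_def by (metis (mono_tags, lifting) case_prodD mem_Collect_eq not_le)

text \<open>Take for u the first defined point after d with a value other than \<open>h d\<close>,
  and for l the last defined point before u; then l still has the value \<open>h d\<close>.\<close>

lemma jump_between:
  assumes "d < d'" "h d \<noteq> None" "h d' \<noteq> None" "h d \<noteq> h d'"
  shows "\<exists>(l, u)\<in>jump_pairs h. d \<le> l \<and> u \<le> d'"
proof -
  define Q where "Q = (\<lambda>i. d < i \<and> h i \<noteq> None \<and> h i \<noteq> h d)"
  have Qd': "Q d'" using assms by (auto simp: Q_def)
  define u where "u = (LEAST i. Q i)"
  have Qu: "Q u" unfolding u_def using Qd' by (rule LeastI)
  have ud': "u \<le> d'" unfolding u_def using Qd' by (rule Least_le)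
  have least: "\<not> Q i" if "i < u" for i using that not_less_Least unfolding u_def by blast
  define L where "L = {i. d \<le> i \<and> i < u \<and> h i \<noteq> None}"
  have L: "finite L" "d \<in> L" using Qu assms by (auto simp: L_def Q_def)
  define l where "l = Max L"
  have lL: "l \<in> L" unfolding l_def using L by (intro Max_in) auto
  have "h l = h d"
  proof (rule ccontr)
    assume "h l \<noteq> h d"
    then have "Q l" using lL unfolding L_def Q_def by (auto simp: order_less_le)
    then show False using least[of l] lL by (simp add: L_def)
  qed
  moreover have "h i = None" if "l < i" "i < u" for i
  proof (rule ccontr)
    assume "h i \<noteq> None"
    then have "i \<in> L" using that lL by (auto simp: L_def)
    then show False using Max_ge[OF L(1), of i] that unfolding l_def by simp
  qed
  ultimately have "(l, u) \<in> jump_pairs h" using Qu lL unfolding jump_pairs_def L_def Q_def by auto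
  then show ?thesis using lL ud' unfolding L_def by blast
qed

lemma gap_profile_of_jump:
  assumes "permutation_invariant n f" and "(l, u) \<in> jump_pairs (h_fun n f a b)"
  shows "\<exists>g. gap_profile n a b l u g \<and> (real u - real g, real g) \<in> jumps (h_fun n f a b)"
proof -
  have j: "((real l + real u) / 2, (real u - real l) / 2) \<in> jumps (h_fun n f a b)"
    using assms(2) unfolding jump_pairs_def jumps_def
    by (auto intro!: exI[where x=l] exI[where x=u] simp: field_simps)
  obtain l' u' gn v A B C D where *: "real l' = (real l + real u) / 2 - (real u - real l) / 2" "real u' = (real l + real u) / 2 + (real u - real l) / 2"
    "(real u - real l) / 2 = real gn" "gn \<ge> 1" "l' + 2 * gn = u'" "profile_of n a b u' A B C D" "gn \<le> B" "gn \<le> C"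
    using jumpE[OF assms(1) j] by metis
  have "real l' = real l" "real u' = real u" using *(1,2) by (simp_all add: field_simps)
  then have lu: "l' = l" "u' = u" by simp_all
  have c: "(real l + real u) / 2 = real u - real gn" using *(3) by (simp add: field_simps)
  have "(real u - real gn, real gn) \<in> jumps (h_fun n f a b)" using j unfolding c *(3) .
  moreover have "gap_profile n a b l u gn" unfolding gap_profile_def using * lu by blast
  ultimately show ?thesis by blast
qed

lemma m_measure_jump_le:
  assumes jump: "(c, g) \<in> jumps (h_fun n f a b)" and ab: "a \<in> {1..n}" "b \<in> {1..n}"
  shows "Min {real a, real b, c, real n - real a, real n - real b, real n - c} / g \<le> 4000 * m_measure 4000 n f"
    "log 2 (min c (real n - c) / g) \<le> 4000 * m_measure 4000 n f"
proof -
  define v where "v = max (Min {real a, real b, c, real n - real a, real n - real b, real n - c} / g) (log 2 (min c (real n - c) / g))"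
  have "v \<in> jump_values n f" unfolding jump_values_def v_def using jump ab by blast
  then have "v \<le> 4000 * m_measure 4000 n f"
    unfolding m_measure_def using finite_jump_values by (auto intro: Max_ge)
  then show "Min {real a, real b, c, real n - real a, real n - real b, real n - c} / g \<le> 4000 * m_measure 4000 n f"
    "log 2 (min c (real n - c) / g) \<le> 4000 * m_measure 4000 n f"
    unfolding v_def by simp_all
qed

lemma m_measure_nonneg: 
  assumes "permutation_invariant n f"
  shows "m_measure 4000 n f \<ge> 0"
proof (cases "jump_values n f = {}")
  case True
  then show ?thesis by (simp add: m_measure_def)
next
  case False
  then obtain a b c g where ab: "a \<in> {1..n}" "b \<in> {1..n}" and jump: "(c, g) \<in> jumps (h_fun n f a b)"
    unfolding jump_values_def by blast
  obtain l u gn where lu: "real l = c - g" "real u = c + g" "g = real gn" "gn \<ge> 1" "u \<le> n"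
    using jumpE[OF assms jump] by metis
  have g: "g > 0" "g \<le> c" "g \<le> real n - c" using lu by auto
  then have "1 \<le> min c (real n - c) / g" by (simp add: le_divide_eq)
  then have "0 \<le> log 2 (min c (real n - c) / g)" by simp
  then show ?thesis using m_measure_jump_le(2)[OF jump ab] by linarith
qed

text \<open>A jump whose minimum is taken at l + u satisfies u \<le> K (u - l), so K * ln u
  increases by at least 1 from one such jump to the next. For the others K * ln (n - l) decreases in
  the same way. Each potential ranges over an interval of length K * ln n.\<close>

lemma card_jump_ends_le:
  assumes J: "\<And>l u. (l, u) \<in> J \<Longrightarrow> l < u \<and> u \<le> n \<and> min (real l + real u) (2 * real n - (real l + real u)) \<le> K * (real u - real l)"
    and ord: "\<And>l u l' u'. (l, u) \<in> J \<Longrightarrow> (l', u') \<in> J \<Longrightarrow> u < u' \<Longrightarrow> u \<le> l'"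
    and n: "n \<ge> 1" and K: "K \<ge> 1"
  shows "real (card (snd ` J)) \<le> 2 * (K * ln (real n) + 1)"
proof -
  define J1 where "J1 = {p\<in>J. real (fst p) + real (snd p) \<le> K * (real (snd p) - real (fst p))}"
  define J2 where "J2 = {p\<in>J. 2 * real n - (real (fst p) + real (snd p)) \<le> K * (real (snd p) - real (fst p))}"
  have fin: "finite (snd ` J')" if "J' \<subseteq> J" for J'
    by (rule finite_subset[of _ "{..n}"]) (use J that in force)+
  have W: "0 \<le> K * ln (real n)" using n K by simp
  have cov: "snd ` J \<subseteq> snd ` J1 \<union> snd ` J2"
    using J unfolding J1_def J2_def by (fastforce simp: min_le_iff_disj)
  have c1: "real (card (snd ` J1)) \<le> K * ln (real n) + 1"
  proof (rule card_le_of_separated[where w="\<lambda>u. K * ln (real u)", OF _ _ W])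
    fix u assume "u \<in> snd ` J1"
    then have "1 \<le> u" "u \<le> n" using J unfolding J1_def by force+
    then show "0 \<le> K * ln (real u) \<and> K * ln (real u) \<le> K * ln (real n)" using K by simp
  next
    fix u u' assume "u \<in> snd ` J1" "u' \<in> snd ` J1" and uu: "u < u'"
    then obtain l l' where J1: "(l, u) \<in> J1" "(l', u') \<in> J1" by auto
    then have u1: "1 \<le> u" "u \<le> l'" "l' < u'" using J[of l u] J[of l' u'] ord[of l u l' u'] uu unfolding J1_def by auto
    have "real l' + real u' \<le> K * (real u' - real l')" using J1(2) by (simp add: J1_def)
    then have "real u' \<le> K * (real u' - real l')" by simp
    then have "1 \<le> K * ((real u' - real l') / real u')" using u1 by (simp add: le_divide_eq)
    moreover have "K * (ln (real l') + (real u' - real l') / real u') \<le> K * ln (real u')"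
      using ln_diff_ge[of "real l'" "real u'"] u1 K by (intro mult_left_mono) auto
    moreover have "K * ln (real u) \<le> K * ln (real l')" using u1 K by (intro mult_left_mono) auto
    ultimately show "K * ln (real u) + 1 \<le> K * ln (real u')" unfolding distrib_left by linarith
  qed
  have c2: "real (card (snd ` J2)) \<le> K * ln (real n) + 1"
  proof -
    \<comment> \<open>For jumps near n the potential uses the lower end, because n - u may be 0
      while n - l is at least 1.\<close>
    define lo where "lo = (\<lambda>u. SOME l. (l, u) \<in> J2)"
    have lo: "(lo u, u) \<in> J2" if "u \<in> snd ` J2" for u
      unfolding lo_def by (rule someI_ex) (use that in auto)
    show ?thesis
    proof (rule card_le_of_separated[where w="\<lambda>u. K * ln (real n) - K * ln (real n - real (lo u))", OF _ _ W])
      fix u assume "u \<in> snd ` J2"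
      from lo[OF this] have "lo u < u" "u \<le> n" using J unfolding J2_def by auto
      then have "1 \<le> real n - real (lo u)" "real n - real (lo u) \<le> real n" by linarith+
      then show "0 \<le> K * ln (real n) - K * ln (real n - real (lo u)) \<and> K * ln (real n) - K * ln (real n - real (lo u)) \<le> K * ln (real n)"
        using K by auto
    next
      fix u u' assume u: "u \<in> snd ` J2" "u' \<in> snd ` J2" and uu: "u < u'"
      define l l' where "l = lo u" and "l' = lo u'"
      have J2: "(l, u) \<in> J2" "(l', u') \<in> J2" using lo u by (auto simp: l_def l'_def)
      then have u1: "l < u" "u \<le> l'" "l' < u'" "u' \<le> n" using J[of l u] J[of l' u'] ord[of l u l' u'] uu unfolding J2_def by auto
      have "2 * real n - (real l + real u) \<le> K * (real u - real l)" using J2(1) by (simp add: J2_def)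
      then have "real n - real l \<le> K * (real u - real l)" using u1 by linarith
      then have "1 \<le> K * ((real u - real l) / (real n - real l))" using u1 by (simp add: le_divide_eq)
      moreover have "K * (ln (real n - real u) + ((real n - real l) - (real n - real u)) / (real n - real l)) \<le> K * ln (real n - real l)"
        using ln_diff_ge[of "real n - real u" "real n - real l"] u1 K by (intro mult_left_mono) auto
      moreover have "K * ln (real n - real l') \<le> K * ln (real n - real u)" using u1 K by (intro mult_left_mono) auto
      ultimately show "K * ln (real n) - K * ln (real n - real (lo u)) + 1 \<le> K * ln (real n) - K * ln (real n - real (lo u'))"
        unfolding distrib_left l_def[symmetric] l'_def[symmetric] by simp
    qed
  qed
  have "card (snd ` J) \<le> card (snd ` J1 \<union> snd ` J2)"
    using cov fin by (intro card_mono) (auto simp: J1_def J2_def)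
  also have "\<dots> \<le> card (snd ` J1) + card (snd ` J2)" by (rule card_Un_le)
  finally have "real (card (snd ` J)) \<le> real (card (snd ` J1)) + real (card (snd ` J2))" by linarith
  then show ?thesis using c1 c2 by (simp add: algebra_simps)
qed

section \<open>The upper bound\<close>

lemma rand_computable_cong:
  assumes "rand_computable k \<epsilon> S g" "S' \<subseteq> S" "\<And>x y. (x, y) \<in> S' \<Longrightarrow> g x y = g' x y" "k \<le> k'" "\<epsilon> \<le> \<epsilon>'"
  shows "rand_computable k' \<epsilon>' S' g'"
proof -
  obtain R :: "nat pmf" and F where RF: "\<And>r. det_computable k (F r)"
    "\<And>x y. (x, y) \<in> S \<Longrightarrow> measure_pmf.prob R {r. F r x y \<noteq> g x y} \<le> \<epsilon>"
    by (rule rand_computableE[OF assms(1)], rule that)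
  show ?thesis
  proof (rule rand_computableI[where F=F and R=R])
    show "det_computable k' (F r)" for r using RF(1) assms(4) by (rule det_computable_mono)
    fix x y assume xy: "(x, y) \<in> S'"
    then have "measure_pmf.prob R {r. F r x y \<noteq> g x y} \<le> \<epsilon>" using RF(2) assms(2) by blast
    then show "measure_pmf.prob R {r. F r x y \<noteq> g' x y} \<le> \<epsilon>'" using assms(3)[OF xy] assms(5) by simp
  qed
qed

lemma real_nat_ceiling_le_add_one:
  fixes x :: real
  assumes "x \<ge> 0" shows "real (nat \<lceil>x\<rceil>) \<le> x + 1"
  using of_int_ceiling_le_add_one[of x] assms by simp

lemma less_nat_floor_add_one:
  fixes x :: real
  assumes "x \<ge> 0" shows "x < real (nat \<lfloor>x\<rfloor> + 1)"
proof -
  have "real (nat \<lfloor>x\<rfloor>) = of_int \<lfloor>x\<rfloor>" using assms by simp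
  moreover have "x < of_int \<lfloor>x\<rfloor> + 1" by linarith
  ultimately show ?thesis by linarith
qed

text \<open>From exp x \<ge> (1 + x/5)^5: the factor is 5^5 * (3/2)^5, below 24000, with 3/2
  bounding 1 / ln 2.\<close>

lemma log_factor_power_le:
  fixes y :: real
  assumes "y \<ge> 1"
  shows "(log 2 y) ^ 5 \<le> 24000 * y"
proof -
  have l0: "ln y \<ge> 0" using assms by simp
  have "(1 + ln y / real 5) ^ 5 \<le> exp (ln y)" using l0 by (intro exp_ge_one_plus_x_over_n_power_n) auto
  moreover have "(ln y / 5) ^ 5 \<le> (1 + ln y / real 5) ^ 5" using l0 by (intro power_mono) auto
  ultimately have "(ln y / 5) ^ 5 \<le> exp (ln y)" by (rule order_trans[rotated])
  then have "(ln y / 5) ^ 5 \<le> y" using assms by simp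
  then have a: "(ln y) ^ 5 \<le> 3125 * y" by (simp add: power_divide)
  have "log 2 y \<le> 3/2 * ln y"
    unfolding log_def using ln2_ge_two_thirds l0 divide_left_mono[of "2/3" "ln 2" "ln y"] by simp
  then have "(log 2 y) ^ 5 \<le> (3/2 * ln y) ^ 5" using assms by (intro power_mono) auto
  also have "\<dots> = (3/2) ^ 5 * (ln y) ^ 5" by (rule power_mult_distrib)
  also have "\<dots> \<le> (3/2) ^ 5 * (3125 * y)" using a by (intro mult_left_mono) auto
  also have "\<dots> \<le> 24000 * y" using assms by (simp add: power_divide)
  finally show ?thesis .
qed

text \<open>
  With advantage \<open>\<eta> = 1 / (256 * (M + 1))\<close>, this makes Hoeffding's bound \<open>exp (- 2 * N * \<eta>\<^sup>2)\<close> at most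
  \<open>1 / (3 * 2 ^ e)\<close>, the share of each of fewer than \<open>2 ^ e\<close> jumps in a total error of \<open>1/3\<close>.
\<close>

definition test_repetitions :: "real \<Rightarrow> nat \<Rightarrow> nat" where
  "test_repetitions M e = nat \<lceil>(real e + 2) * (256 * (M + 1))\<^sup>2\<rceil>"

text \<open>Between consecutive jumps the defined values of h agree, so the set of upper ends not
  exceeding the distance determines the output. Where f is defined, the distance never lies strictly
  inside a jump, so every test is run on inputs for which it is reliable.\<close>

lemma h_fun_rand_computable:
  assumes inv: "permutation_invariant n f" and M: "M = 4000 * m_measure 4000 n f"
    and e: "1 + M + log 2 (ln (real n) + 1) < real e"
  shows "rand_computable (e * (test_repetitions M e * (nat \<lceil>M\<rceil> + 3))) (1/3)
     (pairs_with n (\<lambda>x y. weight x = a \<and> weight y = b \<and> f x y \<noteq> None)) (\<lambda>x y. the (f x y))"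
proof -
  define h where "h = h_fun n f a b"
  define J where "J = jump_pairs h"
  define Us where "Us = snd ` J"
  define S where "S = pairs_with n (\<lambda>x y. weight x = a \<and> weight y = b \<and> f x y \<noteq> None)"
  define N where "N = test_repetitions M e"
  have M0: "M \<ge> 0" unfolding M using m_measure_nonneg[OF inv] by simp
  have gp: "\<exists>g. gap_profile n a b l u g \<and> (real u - real g, real g) \<in> jumps (h_fun n f a b)" if "(l, u) \<in> J" for l u
    using gap_profile_of_jump[OF inv, of l u a b] that unfolding J_def h_def by simp
  have lu: "l < u \<and> u \<le> n" if j: "(l, u) \<in> J" for l u
  proof -
    obtain g where "gap_profile n a b l u g" using gp[OF j] by blast
    from gap_profile_bounds[OF this] show ?thesis by simp
  qed
  have finU: "finite Us" unfolding Us_def by (rule finite_subset[of _ "{..n}"]) (use lu in force)+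
  have ab: "a \<in> {1..n} \<and> b \<in> {1..n}" if "(l, u) \<in> J" for l u
    using gp[OF that] unfolding gap_profile_def profile_of_def by auto
  have gap: "min (real l + real u) (2 * real n - (real l + real u)) \<le> 2 powr M * (real u - real l)" if lu: "(l, u) \<in> J" for l u
  proof -
    obtain g where g: "gap_profile n a b l u g" "(real u - real g, real g) \<in> jumps (h_fun n f a b)" using gp[OF lu] by blast
    have g1: "real g > 0" "real l + 2 * real g = real u" "real u \<le> real n"
      using g(1) gap_profile_bounds(3)[OF g(1)] unfolding gap_profile_def by linarith+
    define m where "m = min (real u - real g) (real n - (real u - real g))"
    have "real u - real g > 0" "real n - (real u - real g) > 0" using g1 by linarith+
    then have "m > 0" unfolding m_def by simp
    then have "m / real g > 0" using g1 by simp
    moreover have "log 2 (m / real g) \<le> M" using m_measure_jump_le(2)[OF g(2)] ab[OF lu] unfolding m_def M by blast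
    ultimately have "m / real g \<le> 2 powr M" by (subst (asm) log_le_iff) auto
    then have c: "m \<le> 2 powr M * real g" unfolding pos_divide_le_eq[OF g1(1)] .
    have "min (real l + real u) (2 * real n - (real l + real u)) = 2 * m"
      unfolding m_def min_mult_distrib_left using g1(2) by (simp add: min_def) 
    also have "\<dots> \<le> 2 powr M * (2 * real g)" using c by simp
    also have "2 * real g = real u - real l" using g1(2) by linarith
    finally show ?thesis .
  qed
  have card: "card Us < 2 ^ e"
  proof (cases "J = {}")
    case False
    then have n: "n \<ge> 1" using lu by fastforce
    have "real (card Us) \<le> 2 * (2 powr M * ln (real n) + 1)"
      unfolding Us_def
      by (rule card_jump_ends_le[OF _ _ n]) (use lu gap jump_pairs_ordered ge_one_powr_ge_zero[of 2 M] M0 in \<open>auto simp: J_def\<close>)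
    also have "\<dots> \<le> 2 * (2 powr M * ln (real n) + 2 powr M)" using ge_one_powr_ge_zero[of 2 M] M0 by simp
    also have "\<dots> = 2 powr (1 + M + log 2 (ln (real n) + 1))"
    proof -
      have "2 powr (1 + M + log 2 (ln (real n) + 1)) = 2 powr 1 * 2 powr M * 2 powr (log 2 (ln (real n) + 1))"
        by (simp only: powr_add)
      also have "2 powr (log 2 (ln (real n) + 1)) = ln (real n) + 1" using n by (intro powr_log_cancel) (auto intro: add_nonneg_pos)
      finally show ?thesis by (simp add: algebra_simps)
    qed
    also have "\<dots> < 2 powr real e" using e by simp
    also have "\<dots> = real (2 ^ e)" by (simp add: powr_realpow)
    finally show ?thesis by (simp only: of_nat_less_iff)
  qed (simp add: Us_def)
  have N0: "(real e + 2) * (256 * (M + 1))\<^sup>2 \<le> real N" unfolding N_def test_repetitions_def by (rule real_nat_ceiling_ge)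
  have "0 < (real e + 2) * (256 * (M + 1))\<^sup>2" using M0 by simp
  then have N1: "N \<ge> 1" using N0 by linarith
  have eps: "exp (- 2 * real N * (1 / (256 * (M + 1)))\<^sup>2) \<le> 1 / (3 * 2 ^ e)"
  proof -
    have "(real e + 2) \<le> real N * (1 / (256 * (M + 1)))\<^sup>2"
      using N0 M0 by (simp add: power_divide le_divide_eq)
    then have "exp (- 2 * real N * (1 / (256 * (M + 1)))\<^sup>2) \<le> exp (- (real e + 2))" by simp
    also have "\<dots> = 1 / (exp 2 * exp 1 ^ e)"
    proof -
      have "exp (real e + 2) = exp 2 * exp 1 ^ e"
        using exp_of_nat_mult[of e "1::real"] by (simp add: exp_add)
      then show ?thesis unfolding exp_minus by (simp add: inverse_eq_divide)
    qed
    also have "\<dots> \<le> 1 / (3 * 2 ^ e)"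
    proof -
      \<comment> \<open>One factor e per halving of the error is more than enough, and the summand 2
        in \<open>test_repetitions\<close> pays for the 3.\<close>
      have "(2::real) \<le> exp 1" using exp_ge_add_one_self[of "1::real"] by simp
      then have "(2::real) ^ e \<le> exp 1 ^ e" by (intro power_mono) auto
      moreover have "(3::real) \<le> exp 2" using exp_ge_add_one_self[of "2::real"] by simp
      ultimately have "3 * (2::real) ^ e \<le> exp 2 * exp 1 ^ e" by (intro mult_mono) auto
      then show ?thesis by (intro divide_left_mono) auto
    qed
    finally show ?thesis .
  qed
  have hS: "h (hdist x y) = f x y" if "(x, y) \<in> S" for x y
    using that h_fun_eq[OF inv, of x y] unfolding S_def pairs_with_def h_def by auto
  have tests: "rand_computable (N * (nat \<lceil>M\<rceil> + 3)) (1 / (3 * 2 ^ e)) S (\<lambda>x y. hdist x y \<ge> u)" if "u \<in> Us" for u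
  proof -
    obtain l where lu: "(l, u) \<in> J" using \<open>u \<in> Us\<close> unfolding Us_def by auto
    obtain g where g: "gap_profile n a b l u g" "(real u - real g, real g) \<in> jumps (h_fun n f a b)" using gp[OF lu] by blast
    have t: "testable_at M n a b l u"
      by (rule testable_at_jump[OF g(1) M0]) (use m_measure_jump_le[OF g(2)] ab[OF lu] in \<open>simp_all only: M\<close>)
    have "l < u" using gap_profile_bounds[OF g(1)] by simp
    have rc: "rand_computable (N * (nat \<lceil>M\<rceil> + 3)) (1 / (3 * 2 ^ e)) (far n a b u \<union> near n a b l) (\<lambda>x y. hdist x y \<ge> u)"
    proof (rule gap_testable_amplify[OF t[unfolded testable_at_def] _ N1 eps])
      show "0 < 1 / (256 * (M + 1))" using M0 by simp
    qed (use \<open>l < u\<close> in \<open>auto simp: pairs_with_def\<close>)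
    show ?thesis
    proof (rule rand_computable_cong[OF rc])
      show "S \<subseteq> far n a b u \<union> near n a b l"
      proof (rule subsetI)
        fix p assume p: "p \<in> S"
        obtain x y where xy: "p = (x, y)" by (cases p)
        have "h (hdist x y) \<noteq> None" using hS[of x y] p unfolding xy by (simp add: S_def pairs_with_def)
        then have "hdist x y \<le> l \<or> u \<le> hdist x y" using lu unfolding J_def jump_pairs_def by (metis (mono_tags, lifting) case_prodD mem_Collect_eq not_le)
        then show "p \<in> far n a b u \<union> near n a b l" using p unfolding xy S_def pairs_with_def by auto
      qed
    qed auto
  qed
  \<comment> \<open>Any defined distance with the same set of ends below it may serve, because
    \<open>jump_between\<close> places an end between two distances with different values.\<close>
  define ans where "ans = (\<lambda>U. the (h (SOME d. h d \<noteq> None \<and> {u\<in>Us. u \<le> d} = U)))"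
  have ans: "ans {u\<in>Us. u \<le> d} = the (h d)" if hd: "h d \<noteq> None" for d
  proof -
    define d' where "d' = (SOME d'. h d' \<noteq> None \<and> {u\<in>Us. u \<le> d'} = {u\<in>Us. u \<le> d})"
    have d': "h d' \<noteq> None \<and> {u\<in>Us. u \<le> d'} = {u\<in>Us. u \<le> d}"
      unfolding d'_def by (rule someI[of _ d]) (use hd in simp)
    have ne: "{u\<in>Us. u \<le> p} \<noteq> {u\<in>Us. u \<le> q}" if pq: "p < q" "h p \<noteq> None" "h q \<noteq> None" "h p \<noteq> h q" for p q
    proof -
      obtain l u where j: "(l, u) \<in> J" "p \<le> l" "u \<le> q" using jump_between[OF pq] unfolding J_def by blast
      then have "u \<in> Us" "\<not> u \<le> p" "u \<le> q" using lu[OF j(1)] unfolding Us_def by force+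
      then show ?thesis by blast
    qed
    have "h d' = h d"
    proof (rule ccontr)
      assume neq: "h d' \<noteq> h d"
      then have "d' < d \<or> d < d'" by (metis linorder_neqE_nat)
      then show False using ne[of d' d] ne[of d d'] d' hd neq by metis
    qed
    then show ?thesis unfolding ans_def d'_def[symmetric] by simp
  qed
  have "rand_computable (e * (N * (nat \<lceil>M\<rceil> + 3))) (real (card Us) * (1 / (3 * 2 ^ e))) S (\<lambda>x y. ans {u\<in>Us. u \<le> hdist x y})"
    by (rule rand_computable_search[OF finU card tests]) auto
  then show ?thesis
    unfolding S_def[symmetric] N_def[symmetric]
  proof (rule rand_computable_cong)
    show "ans {u\<in>Us. u \<le> hdist x y} = the (f x y)" if "(x, y) \<in> S" for x y
      using ans[of "hdist x y"] hS[OF that] that by (simp add: S_def pairs_with_def)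
    have "real (card Us) \<le> 2 ^ e" using card by (metis less_imp_le of_nat_le_iff of_nat_numeral of_nat_power)
    then show "real (card Us) * (1 / (3 * 2 ^ e)) \<le> 1/3" by (simp add: divide_le_eq)
  qed auto
qed

lemma protocol_exists:
  assumes inv: "permutation_invariant n f" and M: "M = 4000 * m_measure 4000 n f"
    and e: "1 + M + log 2 (ln (real n) + 1) < real e" and j: "n < 2 ^ j"
  shows "\<exists>P. public_coin P \<and> computes n f P \<and> communication_at_most n P (j + (j + e * (test_repetitions M e * (nat \<lceil>M\<rceil> + 3))))"
proof (rule rand_computable_protocol[where S="pairs_with n (\<lambda>x y. f x y \<noteq> None)" and g="\<lambda>x y. the (f x y)"])
  show "rand_computable (j + (j + e * (test_repetitions M e * (nat \<lceil>M\<rceil> + 3)))) (1/3) (pairs_with n (\<lambda>x y. f x y \<noteq> None)) (\<lambda>x y. the (f x y))"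
  proof (rule rand_computable_weights[OF j, where g="\<lambda>a b x y. the (f x y)"])
    show "pairs_with n (\<lambda>x y. f x y \<noteq> None) \<subseteq> cube n \<times> cube n" by (auto simp: pairs_with_def)
    show "weight x \<le> n" if "x \<in> cube n" for x using weight_le[OF that] .
    fix a b
    have "{(x, y)\<in>pairs_with n (\<lambda>x y. f x y \<noteq> None). weight x = a \<and> weight y = b} =
       pairs_with n (\<lambda>x y. weight x = a \<and> weight y = b \<and> f x y \<noteq> None)" by (auto simp: pairs_with_def)
    then show "rand_computable (e * (test_repetitions M e * (nat \<lceil>M\<rceil> + 3))) (1/3)
        {(x, y)\<in>pairs_with n (\<lambda>x y. f x y \<noteq> None). weight x = a \<and> weight y = b} (\<lambda>x y. the (f x y))"
      using h_fun_rand_computable[OF inv M e] by simp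
  qed
qed (auto simp: pairs_with_def)

text \<open>With V = M + L + 5, where L is about log log n, the e rounds are at most V, the
  repetitions at most 200000 V^3 and the bits of a test at most V.\<close>

lemma R_public_le:
  assumes inv: "permutation_invariant n f" and M: "M = 4000 * m_measure 4000 n f"
  shows "\<exists>k P. public_coin P \<and> computes n f P \<and> communication_at_most n P k" (is ?ex)
    and "real (R_public n f) \<le> 200000 * 32 * (M + 5) ^ 5 + 200000 * 32 * 24000 * (log 2 (real n) + 1) + 2 * log 2 (real n) + 2"
proof -
  define L where "L = log 2 (ln (real n) + 1)"
  have M0: "M \<ge> 0" unfolding M using m_measure_nonneg[OF inv] by simp
  \<comment> \<open>Also for n = 0, where \<open>ln 0\<close> is 0.\<close>
  have n0: "0 \<le> ln (real n)"
  proof (cases "n = 0")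
    case False
    then show ?thesis by (intro ln_ge_zero) simp
  qed simp
  have n1: "0 \<le> log 2 (real n)" unfolding log_def using n0 by simp
  have L0: "L \<ge> 0" unfolding L_def using n0 by simp
  define e where "e = nat \<lfloor>1 + M + L\<rfloor> + 1"
  have e1: "1 + M + log 2 (ln (real n) + 1) < real e" unfolding L_def[symmetric] e_def
    using M0 L0 by (intro less_nat_floor_add_one) simp
  have e2: "real e \<le> 2 + M + L" 
  proof -
    have "real (nat \<lfloor>1 + M + L\<rfloor>) \<le> 1 + M + L" using M0 L0 by (intro of_nat_floor) simp
    then show ?thesis unfolding e_def by linarith
  qed
  define j where "j = nat \<lfloor>log 2 (real n)\<rfloor> + 1"
  have j1: "n < 2 ^ j"
  proof (cases "n = 0")
    case False
    have "log 2 (real n) < real j" unfolding j_def using n1 by (rule less_nat_floor_add_one)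
    then have "real n < 2 powr real j" using False by (simp add: log_less_iff)
    then have "real n < real (2 ^ j)" by (simp add: powr_realpow)
    then show ?thesis by (simp only: of_nat_less_iff)
  qed simp
  have j2: "real j \<le> log 2 (real n) + 1" unfolding j_def using of_nat_floor[OF n1] by linarith
  define k where "k = j + (j + e * (test_repetitions M e * (nat \<lceil>M\<rceil> + 3)))"
  have P: "\<exists>P. public_coin P \<and> computes n f P \<and> communication_at_most n P k"
    unfolding k_def by (rule protocol_exists[OF inv M e1 j1])
  then show ?ex by blast
  have "R_public n f \<le> k" unfolding R_public_def using P by (rule Least_le)
  then have "real (R_public n f) \<le> real k" by simp
  also have "\<dots> = 2 * real j + real e * (real (test_repetitions M e) * (real (nat \<lceil>M\<rceil>) + 3))" unfolding k_def by simp
  also have "\<dots> \<le> 2 * (log 2 (real n) + 1) + 200000 * (M + L + 5) ^ 5"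
  proof (intro add_mono mult_left_mono j2)
    define V where "V = M + L + 5"
    have V: "V \<ge> 5" unfolding V_def using M0 L0 by simp
    have tr: "real (test_repetitions M e) \<le> 200000 * V ^ 3"
    proof -
      have "real (test_repetitions M e) \<le> (real e + 2) * (256 * (M + 1))\<^sup>2 + 1"
        unfolding test_repetitions_def using M0 by (intro real_nat_ceiling_le_add_one) simp
      also have "\<dots> \<le> V * (256 * V)\<^sup>2 + V ^ 3"
      proof (rule add_mono)
        show "(real e + 2) * (256 * (M + 1))\<^sup>2 \<le> V * (256 * V)\<^sup>2"
          using e2 M0 L0 by (intro mult_mono power_mono) (auto simp: V_def)
        show "1 \<le> V ^ 3" using V by simp
      qed
      also have "\<dots> = 65537 * V ^ 3" by (simp add: eval_nat_numeral)
      also have "\<dots> \<le> 200000 * V ^ 3" using V by simp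
      finally show ?thesis .
    qed
    have c: "real (nat \<lceil>M\<rceil>) + 3 \<le> V"
    proof -
      have "real (nat \<lceil>M\<rceil>) \<le> M + 1" using M0 by (intro real_nat_ceiling_le_add_one)
      then show ?thesis unfolding V_def using L0 by linarith
    qed
    have "real e * (real (test_repetitions M e) * (real (nat \<lceil>M\<rceil>) + 3)) \<le> V * (200000 * V ^ 3 * V)"
      using tr c e2 V M0 L0 by (intro mult_mono) (auto simp: V_def)
    also have "\<dots> = 200000 * V ^ 5" by (simp add: eval_nat_numeral)
    finally show "real e * (real (test_repetitions M e) * (real (nat \<lceil>M\<rceil>) + 3)) \<le> 200000 * (M + L + 5) ^ 5"
      unfolding V_def .
  qed simp
  also have "(M + L + 5) ^ 5 \<le> 32 * (M + 5) ^ 5 + 32 * (24000 * (log 2 (real n) + 1))"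
  proof -
    define p where "p = M + 5"
    have p: "p \<ge> 0" unfolding p_def using M0 by simp
    \<comment> \<open>This separates M from L, whose fifth power is O(log n).\<close>
    have "(p + L) ^ 5 \<le> (2 * max p L) ^ 5" using p L0 by (intro power_mono) auto
    also have "\<dots> = 32 * (max p L) ^ 5" by (simp add: power_mult_distrib)
    also have "\<dots> \<le> 32 * (p ^ 5 + L ^ 5)" using p L0 by (simp add: max_def)
    finally have "(M + L + 5) ^ 5 \<le> 32 * (M + 5) ^ 5 + 32 * L ^ 5" unfolding p_def by (simp add: algebra_simps)
    moreover have "L ^ 5 \<le> 24000 * (ln (real n) + 1)" unfolding L_def using n0 by (intro log_factor_power_le) simp
    then have "32 * L ^ 5 \<le> 32 * (24000 * (ln (real n) + 1))" by (intro mult_left_mono) auto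
    moreover have "32 * (24000 * (ln (real n) + 1)) \<le> 32 * (24000 * (log 2 (real n) + 1))"
    proof (intro mult_left_mono add_right_mono)
      have "ln (real n) * ln 2 \<le> ln (real n) * 1" using n0 ln_2_less_1 by (intro mult_left_mono) auto
      then show "ln (real n) \<le> log 2 (real n)" unfolding log_def by (simp add: le_divide_eq)
    qed auto
    ultimately show ?thesis by (meson add_left_mono order_trans)
  qed
  finally show "real (R_public n f) \<le> 200000 * 32 * (M + 5) ^ 5 + 200000 * 32 * 24000 * (log 2 (real n) + 1) + 2 * log 2 (real n) + 2"
    by (simp add: algebra_simps)
qed

theorem theorem1p1:
  shows "\<exists>C::real. C > 0 \<and> (\<exists>(p :: real poly) (K :: real).
           \<forall>(n :: nat) (f :: partial_fun). permutation_invariant n f \<longrightarrow>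
             ereal (m_measure C n f) \<le> IC n f \<and>
             IC n f \<le> ereal (real (R_public n f)) \<and>
             real (R_public n f) \<le> poly p (m_measure C n f) + K * log 2 (real n))"
proof (intro exI[where x="4000::real"] conjI)
  define D :: real where "D = 200000 * 32 * 24000"
  \<comment> \<open>\<open>[:5, 4000:]\<close> is M + 5 as a polynomial in m. Additive constants go
    into p, because log n vanishes for n = 1.\<close>
  define p :: "real poly" where "p = smult (200000 * 32) ([:5, 4000:] ^ 5) + [:D + 2:]"
  show "\<exists>(p :: real poly) (K :: real).
           \<forall>(n :: nat) (f :: partial_fun). permutation_invariant n f \<longrightarrow>
             ereal (m_measure 4000 n f) \<le> IC n f \<and>
             IC n f \<le> ereal (real (R_public n f)) \<and>
             real (R_public n f) \<le> poly p (m_measure 4000 n f) + K * log 2 (real n)"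
  proof (intro exI[where x=p] exI[where x="D + 2"] allI impI conjI)
    fix n f assume inv: "permutation_invariant n f"
    show "ereal (m_measure 4000 n f) \<le> IC n f" by (rule m_measure_le_IC[OF inv])
    show "IC n f \<le> ereal (real (R_public n f))" by (rule IC_le_R_public[OF R_public_le(1)[OF inv refl]])
    have "poly p (m_measure 4000 n f) = 200000 * 32 * (4000 * m_measure 4000 n f + 5) ^ 5 + (D + 2)"
      unfolding p_def by (simp add: mult.commute add.commute)
    then show "real (R_public n f) \<le> poly p (m_measure 4000 n f) + (D + 2) * log 2 (real n)"
      using R_public_le(2)[OF inv refl] unfolding D_def by (simp add: algebra_simps)
  qed
qed simp

end
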